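(* Let $M$ be a type I manifold. The space of ends $\mathcal F(M)\setminus M$ of $M$ is second countable and $M$ has the end dichotomy property if and only if there exist at most countably many pairwise-disjoint embedded long trunks $\{T_i\}_{i\in I}$ in $M$ such that the complement of the closure of $\bigcup_{i\in I}T_i$ in $M$ is Lindelöf.
   Context: A manifold is a connected Hausdorff space $M$ for which there is an integer $n\ge 1$ such that every point has an open neighborhood homeomorphic to $\mathbb R^n$; second countability is NOT assumed. A manifold $M$ is of type I if there is a sequence $\langle M_\alpha\mid\alpha<\omega_1\rangle$ of open Lindelöf subspaces of $M$ with $M=\bigcup_{\alpha<\omega_1}M_\alpha$ and $\mathrm{cl}_M(M_\alpha)\subseteq M_\beta$ whenever $\alpha<\beta<\omega_1$. Freudenthal compactification. Let $X$ be a locally compact Hausdorff space without isolated points. A subset of $X$ is bounded if it is contained in a compact subset of $X$, and unbounded otherwise; for $U$ open, $\partial(U)=\mathrm{cl}_X(U)\setminus U$. Let $\mathscr K(X)$ be the set of finite pairwise-disjoint collections $\mathscr U=\{U_0,\dots,U_n\}$ of open subsets of $X$, with a distinguished element $U_0$, such that $U_0$ is bounded, every $\partial(U_i)$ is compact, and $X=U_0\cup\bigcup_{i=1}^n\mathrm{cl}_X(U_i)$ with this union disjoint. Put $P_{\mathscr U}=\{\{x\}\mid x\in U_0\}\cup\{\mathrm{cl}_X(U_i)\mid 1\le i\le n\}$, a partition of $X$, and order $\mathscr K(X)$ by $\mathscr U\le\mathscr V$ iff $P_{\mathscr V}$ refines $P_{\mathscr U}$; this is a directed set. Let $X_{\mathscr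 U}$ be the quotient space of $X$ by $P_{\mathscr U}$ (compact Hausdorff), with the natural maps $X_{\mathscr V}\to X_{\mathscr U}$ for $\mathscr U\le\mathscr V$. The Freudenthal compactification $\mathcal F(X)$ is the inverse limit of this system; it is a compact Hausdorff space containing $X$ as a dense open subspace. The space of ends is $\mathcal E(X)=\mathcal F(X)\setminus X$; its points are the ends of $X$. An end $e$ of $X$ is long if it is a weak $P$-point of $\mathcal F(X)$, i.e. $e$ is not an accumulation point of any countable subset of $\mathcal F(X)$; it is short if it is a $G_\delta$ point of $\mathcal F(X)$. $X$ has the end dichotomy property (EDP) if every end of $X$ is either long or short. A locally connected space $T$ is trunklike if, for every closed Lindelöf subset $C$ of $T$, the set $T\setminus C$ has at most one non-Lindelöf component. A long trunk is a type I trunklike manifold with the end dichotomy property and finitely many ends, exactly one of which is long.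
   Formalization: "Embedded" long trunks are required to have the same dimension as M; with lower-dimensional trunks the claim fails, e.g. for M = ℝ × L (L the open long ray) with the trunks {q} × L, q rational. *)

theory Defs
  imports "HOL-Analysis.Analysis"
begin

section \<open>Type I manifolds\<close>

definition manifold_of_dim :: "nat \<Rightarrow> 'a topology \<Rightarrow> bool" where
  "manifold_of_dim n X \<longleftrightarrow>
     1 \<le> n \<and> connected_space X \<and> Hausdorff_space X \<and>
     (\<forall>x \<in> topspace X. \<exists>U. openin X U \<and> x \<in> U \<and>
        subtopology X U homeomorphic_space Euclidean_space n)"

definition manifold :: "'a topology \<Rightarrow> bool" where
  "manifold X \<longleftrightarrow> (\<exists>n. manifold_of_dim n X)"

text \<open>
  The ordinal \<open>\<omega>\<^sub>1\<close> is rendered as the initial well-order \<^term>\<open>cardSuc natLeq\<close> of the first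
  uncountable cardinal; its elements are the countable ordinals.
\<close>

definition omega1 :: "nat set rel" where
  "omega1 = cardSuc natLeq"

definition type_I :: "'a topology \<Rightarrow> bool" where
  "type_I X \<longleftrightarrow>
     (\<exists>A :: nat set \<Rightarrow> 'a set.
        (\<forall>\<alpha> \<in> Field omega1. openin X (A \<alpha>) \<and> Lindelof_space (subtopology X (A \<alpha>))) \<and>
        topspace X = (\<Union>\<alpha> \<in> Field omega1. A \<alpha>) \<and>
        (\<forall>\<alpha> \<beta>. (\<alpha>, \<beta>) \<in> omega1 \<and> \<alpha> \<noteq> \<beta> \<longrightarrow> X closure_of A \<alpha> \<subseteq> A \<beta>))"


section \<open>Quotients by partitions and inverse limits\<close>

definition partition_quotient :: "'a topology \<Rightarrow> 'a set set \<Rightarrow> 'a set topology" where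
  "partition_quotient X P = topology (\<lambda>W. W \<subseteq> P \<and> openin X (\<Union>W))"

lemma openin_partition_quotient:
  assumes "partition_on (topspace X) P"
  shows "openin (partition_quotient X P) W \<longleftrightarrow> W \<subseteq> P \<and> openin X (\<Union>W)"
proof -
  have disj: "B = C" if "B \<in> P" "C \<in> P" "x \<in> B" "x \<in> C" for B C x
    using partition_onD2[OF assms] that by (auto simp: pairwise_def disjnt_def)
  have Int: "\<Union>(S \<inter> T) = \<Union>S \<inter> \<Union>T" if "S \<subseteq> P" "T \<subseteq> P" for S T
    using that disj by blast
  have "istopology (\<lambda>W. W \<subseteq> P \<and> openin X (\<Union>W))"
    unfolding istopology_def
  proof (intro conjI allI impI; (elim conjE)?)
    fix S T assume "S \<subseteq> P" "openin X (\<Union>S)" "T \<subseteq> P" "openin X (\<Union>T)"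
    then show "S \<inter> T \<subseteq> P" "openin X (\<Union>(S \<inter> T))"
      using Int[of S T] by (blast, simp add: openin_Int)
  next
    fix K assume *: "\<forall>S\<in>K. S \<subseteq> P \<and> openin X (\<Union>S)"
    then show "\<Union>K \<subseteq> P" by blast
    have "\<Union>(\<Union>K) = \<Union>(Union ` K)" by blast
    with * show "openin X (\<Union>(\<Union>K))"
      by (metis (no_types, lifting) imageE openin_Union)
  qed
  then show ?thesis
    by (simp add: partition_quotient_def topology_inverse')
qed

definition inverse_limit ::
    "'i set \<Rightarrow> ('i \<Rightarrow> 'i \<Rightarrow> bool) \<Rightarrow> ('i \<Rightarrow> 'b topology) \<Rightarrow> ('i \<Rightarrow> 'i \<Rightarrow> 'b \<Rightarrow> 'b) \<Rightarrow> ('i \<Rightarrow> 'b) topology"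
  where
  "inverse_limit I le Y p =
     subtopology (product_topology Y I) {f. \<forall>i\<in>I. \<forall>j\<in>I. le i j \<longrightarrow> p i j (f j) = f i}"


section \<open>The Freudenthal compactification\<close>

definition bounded_subset :: "'a topology \<Rightarrow> 'a set \<Rightarrow> bool" where
  "bounded_subset X S \<longleftrightarrow> (\<exists>K. compactin X K \<and> S \<subseteq> K)"

text \<open>
  A member of \<open>\<K>(X)\<close> is encoded as the pair of its distinguished element \<open>U\<^sub>0\<close> and the set
  \<open>\<V> = {U\<^sub>1, \<dots>, U\<^sub>n}\<close>. The sets in \<open>\<V>\<close> are nonempty, since otherwise \<open>P\<^sub>\<U>\<close> would not be a
  partition; \<open>U\<^sub>0\<close> and \<open>\<V>\<close> themselves may be empty.
\<close>

type_synonym 'a end_cover = "'a set \<times> 'a set set"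

definition end_covers :: "'a topology \<Rightarrow> 'a end_cover set" where
  "end_covers X = {(U\<^sub>0, \<V>).
     finite \<V> \<and> {} \<notin> \<V> \<and> pairwise disjnt (insert U\<^sub>0 \<V>) \<and>
     (\<forall>U \<in> insert U\<^sub>0 \<V>. openin X U \<and> compactin X (X closure_of U - U)) \<and>
     bounded_subset X U\<^sub>0 \<and>
     topspace X = U\<^sub>0 \<union> (\<Union>V\<in>\<V>. X closure_of V) \<and>
     (\<forall>V\<in>\<V>. disjnt U\<^sub>0 (X closure_of V)) \<and>
     pairwise (\<lambda>V W. disjnt (X closure_of V) (X closure_of W)) \<V>}"

definition cover_partition :: "'a topology \<Rightarrow> 'a end_cover \<Rightarrow> 'a set set" where
  "cover_partition X \<U> = {{x} |x. x \<in> fst \<U>} \<union> {X closure_of V |V. V \<in> snd \<U>}"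

lemma partition_on_cover_partition:
  assumes "\<U> \<in> end_covers X"
  shows "partition_on (topspace X) (cover_partition X \<U>)"
proof -
  obtain U0 VV where U: "\<U> = (U0, VV)" by fastforce
  have 1: "{} \<notin> VV" "\<And>V. V \<in> VV \<Longrightarrow> openin X V"
      "topspace X = U0 \<union> (\<Union>V\<in>VV. X closure_of V)"
      "\<And>V. V \<in> VV \<Longrightarrow> disjnt U0 (X closure_of V)"
      "pairwise (\<lambda>V W. disjnt (X closure_of V) (X closure_of W)) VV"
    using assms unfolding U end_covers_def by blast+
  have cl: "X closure_of V \<noteq> {}" if "V \<in> VV" for V
    using 1(1) closure_of_subset[OF openin_subset[OF 1(2)[OF that]]] that by force
  have eq: "cover_partition X \<U> = (\<lambda>x. {x}) ` U0 \<union> (\<lambda>V. X closure_of V) ` VV"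
    by (auto simp: U cover_partition_def)
  show ?thesis
  proof (rule partition_onI)
    show "\<Union>(cover_partition X \<U>) = topspace X"
      unfolding eq 1(3) by auto
    show "{} \<notin> cover_partition X \<U>"
      using cl unfolding eq by auto
    fix p q assume pq: "p \<in> cover_partition X \<U>" "q \<in> cover_partition X \<U>" "p \<noteq> q"
    have "disjnt {x} {y}" if "x \<noteq> y" for x y :: 'a
      using that by (simp add: disjnt_iff)
    moreover have "disjnt {x} (X closure_of V)" "disjnt (X closure_of V) {x}"
      if "x \<in> U0" "V \<in> VV" for x V
      using 1(4)[OF that(2)] that(1) by (auto simp: disjnt_def)
    moreover have "disjnt (X closure_of V) (X closure_of W)"
      if "V \<in> VV" "W \<in> VV" "X closure_of V \<noteq> X closure_of W" for V W
      using pairwiseD[OF 1(5) that(1,2)] that(3) by metis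
    ultimately show "disjnt p q"
      using pq unfolding eq by (elim UnE imageE) metis+
  qed
qed

definition cover_le :: "'a topology \<Rightarrow> 'a end_cover \<Rightarrow> 'a end_cover \<Rightarrow> bool" where
  "cover_le X \<U> \<V> \<longleftrightarrow>
     refines (topspace X) (cover_partition X \<V>) (cover_partition X \<U>)"

definition cover_quotient :: "'a topology \<Rightarrow> 'a end_cover \<Rightarrow> 'a set topology" where
  "cover_quotient X \<U> = partition_quotient X (cover_partition X \<U>)"

definition cover_bond ::
    "'a topology \<Rightarrow> 'a end_cover \<Rightarrow> 'a end_cover \<Rightarrow> 'a set \<Rightarrow> 'a set" where
  "cover_bond X \<U> \<V> B = (THE C. C \<in> cover_partition X \<U> \<and> B \<subseteq> C)"

definition freudenthal :: "'a topology \<Rightarrow> ('a end_cover \<Rightarrow> 'a set) topology" where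
  "freudenthal X = inverse_limit (end_covers X) (cover_le X) (cover_quotient X) (cover_bond X)"

text \<open>The canonical embedding of \<open>X\<close> into its Freudenthal compactification.\<close>

definition freudenthal_emb :: "'a topology \<Rightarrow> 'a \<Rightarrow> ('a end_cover \<Rightarrow> 'a set)" where
  "freudenthal_emb X x =
     (\<lambda>\<U> \<in> end_covers X. THE C. C \<in> cover_partition X \<U> \<and> x \<in> C)"

definition ends :: "'a topology \<Rightarrow> ('a end_cover \<Rightarrow> 'a set) set" where
  "ends X = topspace (freudenthal X) - freudenthal_emb X ` topspace X"

definition end_space :: "'a topology \<Rightarrow> ('a end_cover \<Rightarrow> 'a set) topology" where
  "end_space X = subtopology (freudenthal X) (ends X)"


section \<open>Long and short ends, long trunks\<close>

definition long_end :: "'a topology \<Rightarrow> ('a end_cover \<Rightarrow> 'a set) \<Rightarrow> bool" where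
  "long_end X e \<longleftrightarrow> e \<in> ends X \<and>
     (\<forall>C. C \<subseteq> topspace (freudenthal X) \<and> countable C \<longrightarrow>
          e \<notin> freudenthal X derived_set_of C)"

definition short_end :: "'a topology \<Rightarrow> ('a end_cover \<Rightarrow> 'a set) \<Rightarrow> bool" where
  "short_end X e \<longleftrightarrow> e \<in> ends X \<and> gdelta_in (freudenthal X) {e}"

definition end_dichotomy :: "'a topology \<Rightarrow> bool" where
  "end_dichotomy X \<longleftrightarrow> (\<forall>e \<in> ends X. long_end X e \<or> short_end X e)"

definition trunklike :: "'a topology \<Rightarrow> bool" where
  "trunklike X \<longleftrightarrow> locally_connected_space X \<and>
     (\<forall>C. closedin X C \<and> Lindelof_space (subtopology X C) \<longrightarrow>
        (\<exists>\<^sub>\<le>\<^sub>1 K. K \<in> connected_components_of (subtopology X (topspace X - C)) \<and>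
                \<not> Lindelof_space (subtopology X K)))"

definition long_trunk :: "'a topology \<Rightarrow> bool" where
  "long_trunk X \<longleftrightarrow> manifold X \<and> type_I X \<and> trunklike X \<and> end_dichotomy X \<and>
     finite (ends X) \<and> (\<exists>!e. long_end X e)"

text \<open>
  Embedded trunks have the same dimension as the ambient manifold. Without this requirement the
  countably many disjoint long rays \<open>{q} \<times> L\<close> with \<open>q\<close> rational, whose union is dense in \<open>\<real> \<times> L\<close>
  for the open long ray \<open>L\<close>, would have to be admitted.
\<close>

definition embedded_long_trunk :: "'a topology \<Rightarrow> 'a set \<Rightarrow> bool" where
  "embedded_long_trunk M T \<longleftrightarrow> T \<subseteq> topspace M \<and> long_trunk (subtopology M T) \<and>
     (\<exists>n. manifold_of_dim n M \<and> manifold_of_dim n (subtopology M T))"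

end

theory Submission
  imports Defs "HOL-Homology.Invariance_of_Domain"
begin

text \<open>
  Ends are separated by open sets with compact frontier, and two such sets contain the same ends if
  and only if they differ by bounded sets. If \<open>e\<close> is the only end in such a set \<open>U\<close>, then \<open>e\<close> is long
  if and only if all countable subsets of \<open>U\<close> are bounded.

  Given the trunks, let \<open>U\<^sub>i\<close> be a neighbourhood of the long end of \<open>T\<^sub>i\<close> that contains no
  other end of \<open>T\<^sub>i\<close>. Since countable subsets of \<open>U\<^sub>i\<close> are bounded, its closure and its frontier
  are the same in \<open>T\<^sub>i\<close> and in \<open>M\<close>, and \<open>U\<^sub>i\<close> contains just one end of \<open>M\<close>. A
  closed Lindelof set \<open>L\<close> contains everything outside of the sets \<open>U\<^sub>i\<close>. Hence, up to bounded sets,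
  an open set with compact frontier is a finite union of components of \<open>M - K\<close> with \<open>K\<close> in a countable
  family of compact sets, which leaves countably many cases.

  Conversely, if the ends form a second countable space, the long ends are isolated and countable.
  Let \<open>U\<^sub>i\<close> be disjoint neighbourhoods that contain just one long end each. Enclose the frontier of
  \<open>U\<^sub>i\<close> in a compact connected set \<open>Z\<close>; the unbounded component \<open>T\<^sub>i\<close> of \<open>U\<^sub>i - Z\<close> is
  the trunk. It has finitely many ends at \<open>Z\<close> because only finitely many double covers of a
  neighbourhood of \<open>Z\<close> can be distinguished on a finite atlas. Finally let \<open>L\<close> be a closed Lindelof
  set that contains the frontiers of a countable base of the ends. A component of \<open>M - L\<close> sees at
  most one end, so it is contained in some \<open>T\<^sub>i\<close> if that end is long, and is Lindelof if it is short.
\<close>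

section \<open>The Freudenthal compactification\<close>

text \<open>Compactness of the Freudenthal compactification enters only through
  \<open>ends_cluster\<close>: an unbounded set clusters at some end, which is found by extending
  the ideal of bounded sets to a prime ideal. This turns inclusions between sets of ends into
  boundedness of differences in \<open>X\<close>, and most arguments can then stay inside
  \<open>X\<close>. Ends of \<open>M\<close> and ends of a trunk are points of different inverse
  limits and are never compared; the conditions \<open>one_ended\<close> and
  \<open>omega_bounded\<close>, which speak of subsets only, carry the information across. The
  obstacle is the finiteness clause for trunks: cutting along an arbitrary compact set, such as a
  Cantor set, may create infinitely many ends at the cut. If \<open>Z\<close> and \<open>T\<close>
  are connected, then k + 1 ends of \<open>T\<close> at \<open>Z\<close> produce k independent loops
  through \<open>Z\<close> and \<open>T\<close>, hence k independent cohomology classes mod 2, as in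
  a Mayer-Vietoris sequence, while restriction to a compact set leaves only finite rank. The classes
  are represented by nowhere zero complex functions modulo squares.\<close>

definition cf_open :: "'a topology \<Rightarrow> 'a set \<Rightarrow> bool" where
  "cf_open X U \<longleftrightarrow> openin X U \<and> bounded_subset X (X closure_of U - U)"

text \<open>In a locally compact Hausdorff space and for open \<open>U\<close> this is the usual
  extension of \<open>U\<close> to the compactification: an open set
  (\<open>openin_end_nbhd\<close>) that contains the image of a point \<open>x\<close> exactly when
  \<open>x\<close> lies in \<open>U\<close>. Such sets form a base
  (\<open>freudenthal_base\<close>).\<close>

definition end_nbhd :: "'a topology \<Rightarrow> 'a set \<Rightarrow> ('a end_cover \<Rightarrow> 'a set) set" where
  "end_nbhd X U = {e \<in> topspace (freudenthal X). \<exists>\<U>\<in>end_covers X. e \<U> \<subseteq> U}"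

section \<open>Bounded sets and open sets with bounded frontier\<close>

lemma bounded_subset_mono: "bounded_subset X T \<Longrightarrow> S \<subseteq> T \<Longrightarrow> bounded_subset X S"
  unfolding bounded_subset_def by blast

lemma compactin_imp_bounded_subset: "compactin X K \<Longrightarrow> bounded_subset X K"
  unfolding bounded_subset_def by blast

lemma bounded_subset_empty [simp]: "bounded_subset X {}"
  by (simp add: compactin_imp_bounded_subset)

lemma bounded_subset_Un [simp]:
  "bounded_subset X (S \<union> T) \<longleftrightarrow> bounded_subset X S \<and> bounded_subset X T"
proof
  assume "bounded_subset X S \<and> bounded_subset X T"
  then obtain K L where "compactin X K" "S \<subseteq> K" "compactin X L" "T \<subseteq> L"
    unfolding bounded_subset_def by blast
  then have "compactin X (K \<union> L)" "S \<union> T \<subseteq> K \<union> L"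
    by (auto intro: compactin_Un)
  then show "bounded_subset X (S \<union> T)"
    unfolding bounded_subset_def by blast
qed (auto elim: bounded_subset_mono)

lemma bounded_subset_Union:
  "finite \<F> \<Longrightarrow> (\<And>S. S \<in> \<F> \<Longrightarrow> bounded_subset X S) \<Longrightarrow> bounded_subset X (\<Union>\<F>)"
  by (induction \<F> rule: finite_induct) auto

lemma cf_openD: "cf_open X U \<Longrightarrow> openin X U" "cf_open X U \<Longrightarrow> U \<subseteq> topspace X"
  unfolding cf_open_def by (auto dest: openin_subset)

lemma cf_openI:
  "openin X U \<Longrightarrow> bounded_subset X B \<Longrightarrow> X closure_of U - U \<subseteq> B \<Longrightarrow> cf_open X U"
  unfolding cf_open_def using bounded_subset_mono by blast

lemma cf_open_Int:
  assumes "cf_open X U" "cf_open X V" shows "cf_open X (U \<inter> V)"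
proof (rule cf_openI)
  show "bounded_subset X ((X closure_of U - U) \<union> (X closure_of V - V))"
    using assms by (simp add: cf_open_def)
  show "X closure_of (U \<inter> V) - U \<inter> V \<subseteq> (X closure_of U - U) \<union> (X closure_of V - V)"
    using closure_of_mono[of "U \<inter> V" U X] closure_of_mono[of "U \<inter> V" V X] by blast
qed (use assms in \<open>auto simp: cf_open_def\<close>)

lemma cf_open_Un:
  assumes "cf_open X U" "cf_open X V" shows "cf_open X (U \<union> V)"
proof (rule cf_openI)
  show "bounded_subset X ((X closure_of U - U) \<union> (X closure_of V - V))"
    using assms by (simp add: cf_open_def)
qed (use assms in \<open>auto simp: cf_open_def\<close>)

lemma cf_open_empty [simp]: "cf_open X {}"
  and cf_open_topspace [simp]: "cf_open X (topspace X)"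
  by (auto simp: cf_open_def)

lemma cf_open_Union:
  "finite \<F> \<Longrightarrow> (\<And>S. S \<in> \<F> \<Longrightarrow> cf_open X S) \<Longrightarrow> cf_open X (\<Union>\<F>)"
  by (induction \<F> rule: finite_induct) (auto intro: cf_open_Un)

lemma openin_Int_closure_of_empty:
  "openin X U \<Longrightarrow> U \<inter> V = {} \<Longrightarrow> U \<inter> X closure_of V = {}"
  by (metis openin_Int_closure_of_eq_empty)

text \<open>The exterior serves as the complement of \<open>U\<close>: together they miss only the
  bounded frontier, so every end will lie on one of the two sides
  (\<open>end_cases\<close>).\<close>

lemma cf_open_Compl:
  assumes "cf_open X U" shows "cf_open X (topspace X - X closure_of U)"
proof (rule cf_openI)
  show "bounded_subset X (X closure_of U - U)"
    using assms by (simp add: cf_open_def)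
  have "U \<inter> (topspace X - X closure_of U) = {}"
    using closure_of_subset[OF cf_openD(2)[OF assms]] by blast
  then have "U \<inter> X closure_of (topspace X - X closure_of U) = {}"
    using cf_openD(1)[OF assms] openin_Int_closure_of_empty by blast
  then show "X closure_of (topspace X - X closure_of U) - (topspace X - X closure_of U)
      \<subseteq> X closure_of U - U"
    using closure_of_subset_topspace[of X] by blast
qed auto

lemma cf_open_bounded: "openin X N \<Longrightarrow> bounded_subset X (X closure_of N) \<Longrightarrow> cf_open X N"
  using cf_openI by blast

section \<open>End covers and the points of the inverse limit\<close>

lemma end_covers_iff:
  "\<U> \<in> end_covers X \<longleftrightarrow> finite (snd \<U>) \<and> {} \<notin> snd \<U> \<and> pairwise disjnt (insert (fst \<U>) (snd \<U>)) \<and>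
     (\<forall>U \<in> insert (fst \<U>) (snd \<U>). openin X U \<and> compactin X (X closure_of U - U)) \<and>
     bounded_subset X (fst \<U>) \<and>
     topspace X = fst \<U> \<union> (\<Union>V\<in>snd \<U>. X closure_of V) \<and>
     (\<forall>V\<in>snd \<U>. disjnt (fst \<U>) (X closure_of V)) \<and>
     pairwise (\<lambda>V W. disjnt (X closure_of V) (X closure_of W)) (snd \<U>)"
  unfolding end_covers_def by (cases \<U>) auto

lemma end_cover_cases:
  assumes "\<U> \<in> end_covers X" "x \<in> topspace X"
  shows "x \<in> fst \<U> \<or> (\<exists>V\<in>snd \<U>. x \<in> X closure_of V)"
proof -
  have "topspace X = fst \<U> \<union> (\<Union>V\<in>snd \<U>. X closure_of V)"
    using assms(1) unfolding end_covers_iff by (elim conjE) assumption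
  then have "x \<in> fst \<U> \<union> (\<Union>V\<in>snd \<U>. X closure_of V)"
    using assms(2) by (rule subst)
  then show ?thesis by blast
qed

lemma end_cover_blocks:
  assumes "B \<in> cover_partition X \<U>"
  shows "(\<exists>x \<in> fst \<U>. B = {x}) \<or> (\<exists>V \<in> snd \<U>. B = X closure_of V)"
  using assms unfolding cover_partition_def by blast

lemma Union_cover_partition: "\<U> \<in> end_covers X \<Longrightarrow> \<Union>(cover_partition X \<U>) = topspace X"
  by (metis partition_onD1 partition_on_cover_partition)

lemma cover_partition_unique:
  "\<U> \<in> end_covers X \<Longrightarrow> B \<in> cover_partition X \<U> \<Longrightarrow> C \<in> cover_partition X \<U> \<Longrightarrow>
    x \<in> B \<Longrightarrow> x \<in> C \<Longrightarrow> B = C"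
  using partition_onD2[OF partition_on_cover_partition[of \<U> X]]
  by (metis disjnt_iff pairwiseD)

lemma cover_partition_nonempty:
  "\<U> \<in> end_covers X \<Longrightarrow> B \<in> cover_partition X \<U> \<Longrightarrow> B \<noteq> {}"
  using partition_onD3[OF partition_on_cover_partition[of \<U> X]] by blast

lemma topspace_cover_quotient:
  assumes "\<U> \<in> end_covers X"
  shows "topspace (cover_quotient X \<U>) = cover_partition X \<U>"
proof -
  have "openin (cover_quotient X \<U>) W \<longleftrightarrow> W \<subseteq> cover_partition X \<U> \<and> openin X (\<Union>W)" for W
    unfolding cover_quotient_def
    by (rule openin_partition_quotient[OF partition_on_cover_partition[OF assms]])
  moreover have "openin X (\<Union>(cover_partition X \<U>))"
    by (simp add: Union_cover_partition assms)
  ultimately show ?thesis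
    unfolding topspace_def by blast
qed

lemma cover_le_iff:
  "\<U> \<in> end_covers X \<Longrightarrow> \<V> \<in> end_covers X \<Longrightarrow>
     cover_le X \<U> \<V> \<longleftrightarrow> (\<forall>B\<in>cover_partition X \<V>. \<exists>C\<in>cover_partition X \<U>. B \<subseteq> C)"
  unfolding cover_le_def refines_def by (simp add: partition_on_cover_partition)

text \<open>Blocks are nonempty and the blocks of one partition are disjoint, so a single block of
  the coarser partition contains \<open>B\<close>. This trades the definite description in
  \<open>cover_bond\<close> for an inclusion.\<close>

lemma cover_bond_eq_iff:
  assumes \<U>: "\<U> \<in> end_covers X" and \<V>: "\<V> \<in> end_covers X" and le: "cover_le X \<U> \<V>"
    and B: "B \<in> cover_partition X \<V>" and C: "C \<in> cover_partition X \<U>"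
  shows "cover_bond X \<U> \<V> B = C \<longleftrightarrow> B \<subseteq> C"
proof -
  obtain D where D: "D \<in> cover_partition X \<U>" "B \<subseteq> D"
    using le B cover_le_iff[OF \<U> \<V>] by blast
  have "B \<noteq> {}"
    using cover_partition_nonempty[OF \<V> B] .
  then have uniq: "E = D" if "E \<in> cover_partition X \<U>" "B \<subseteq> E" for E
    using cover_partition_unique[OF \<U> that(1) D(1)] that D(2) by blast
  have "cover_bond X \<U> \<V> B = D"
    unfolding cover_bond_def using D by (intro the_equality uniq) blast+
  then show ?thesis
    using uniq[OF C] D by blast
qed

text \<open>Since the bonding maps only pass to the surrounding block, a thread of the inverse limit
  is a choice of one block per cover that shrinks under refinement.\<close>

lemma mem_freudenthal:
  "e \<in> topspace (freudenthal X) \<longleftrightarrow>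
     e \<in> (\<Pi>\<^sub>E \<U>\<in>end_covers X. cover_partition X \<U>) \<and>
     (\<forall>\<U>\<in>end_covers X. \<forall>\<V>\<in>end_covers X. cover_le X \<U> \<V> \<longrightarrow> e \<V> \<subseteq> e \<U>)"
proof -
  have "e \<in> topspace (freudenthal X) \<longleftrightarrow>
      e \<in> (\<Pi>\<^sub>E \<U>\<in>end_covers X. topspace (cover_quotient X \<U>)) \<and>
      (\<forall>\<U>\<in>end_covers X. \<forall>\<V>\<in>end_covers X. cover_le X \<U> \<V> \<longrightarrow> cover_bond X \<U> \<V> (e \<V>) = e \<U>)"
    unfolding freudenthal_def inverse_limit_def by auto
  also have "(\<Pi>\<^sub>E \<U>\<in>end_covers X. topspace (cover_quotient X \<U>)) = (\<Pi>\<^sub>E \<U>\<in>end_covers X. cover_partition X \<U>)"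
    by (rule PiE_cong) (simp add: topspace_cover_quotient)
  finally have "e \<in> topspace (freudenthal X) \<longleftrightarrow>
      e \<in> (\<Pi>\<^sub>E \<U>\<in>end_covers X. cover_partition X \<U>) \<and>
      (\<forall>\<U>\<in>end_covers X. \<forall>\<V>\<in>end_covers X. cover_le X \<U> \<V> \<longrightarrow> cover_bond X \<U> \<V> (e \<V>) = e \<U>)" .
  also have "\<dots> \<longleftrightarrow> e \<in> (\<Pi>\<^sub>E \<U>\<in>end_covers X. cover_partition X \<U>) \<and>
     (\<forall>\<U>\<in>end_covers X. \<forall>\<V>\<in>end_covers X. cover_le X \<U> \<V> \<longrightarrow> e \<V> \<subseteq> e \<U>)"
  proof (rule conj_cong[OF refl])
    assume e: "e \<in> (\<Pi>\<^sub>E \<U>\<in>end_covers X. cover_partition X \<U>)"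
    have "cover_bond X \<U> \<V> (e \<V>) = e \<U> \<longleftrightarrow> e \<V> \<subseteq> e \<U>"
      if "\<U> \<in> end_covers X" "\<V> \<in> end_covers X" "cover_le X \<U> \<V>" for \<U> \<V>
      by (rule cover_bond_eq_iff[OF that PiE_mem[OF e that(2)] PiE_mem[OF e that(1)]])
    then show "(\<forall>\<U>\<in>end_covers X. \<forall>\<V>\<in>end_covers X. cover_le X \<U> \<V> \<longrightarrow> cover_bond X \<U> \<V> (e \<V>) = e \<U>) \<longleftrightarrow>
      (\<forall>\<U>\<in>end_covers X. \<forall>\<V>\<in>end_covers X. cover_le X \<U> \<V> \<longrightarrow> e \<V> \<subseteq> e \<U>)"
      by simp
  qed
  finally show ?thesis .
qed

lemma freudenthal_mem_partition:
  "e \<in> topspace (freudenthal X) \<Longrightarrow> \<U> \<in> end_covers X \<Longrightarrow> e \<U> \<in> cover_partition X \<U>"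
  unfolding mem_freudenthal by (elim conjE) (rule PiE_mem)

lemma freudenthal_nonempty:
  "e \<in> topspace (freudenthal X) \<Longrightarrow> \<U> \<in> end_covers X \<Longrightarrow> e \<U> \<noteq> {}"
  using cover_partition_nonempty freudenthal_mem_partition by blast

lemma freudenthal_subset_topspace:
  "e \<in> topspace (freudenthal X) \<Longrightarrow> \<U> \<in> end_covers X \<Longrightarrow> e \<U> \<subseteq> topspace X"
  using freudenthal_mem_partition Union_cover_partition by blast

lemma freudenthal_antimono:
  "e \<in> topspace (freudenthal X) \<Longrightarrow> \<U> \<in> end_covers X \<Longrightarrow> \<V> \<in> end_covers X \<Longrightarrow> cover_le X \<U> \<V> \<Longrightarrow> e \<V> \<subseteq> e \<U>"
  unfolding mem_freudenthal by (elim conjE) simp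

lemma freudenthal_emb_block:
  assumes "\<U> \<in> end_covers X" "x \<in> topspace X"
  shows "freudenthal_emb X x \<U> \<in> cover_partition X \<U>" "x \<in> freudenthal_emb X x \<U>"
proof -
  obtain B where B: "B \<in> cover_partition X \<U>" "x \<in> B"
    using Union_cover_partition assms by blast
  then have "(THE C. C \<in> cover_partition X \<U> \<and> x \<in> C) = B"
    by (intro the_equality) (use cover_partition_unique[OF assms(1)] in metis)+
  then show "freudenthal_emb X x \<U> \<in> cover_partition X \<U>" "x \<in> freudenthal_emb X x \<U>"
    using B assms(1) by (auto simp: freudenthal_emb_def)
qed

lemma freudenthal_emb_in_topspace:
  assumes "x \<in> topspace X" shows "freudenthal_emb X x \<in> topspace (freudenthal X)"
  unfolding mem_freudenthal
proof (intro conjI ballI impI PiE_I)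
  fix \<U> assume "\<U> \<in> end_covers X"
  then show "freudenthal_emb X x \<U> \<in> cover_partition X \<U>"
    by (rule freudenthal_emb_block(1)[OF _ assms])
next
  fix \<U> \<V> assume *: "\<U> \<in> end_covers X" "\<V> \<in> end_covers X" "cover_le X \<U> \<V>"
  then obtain C where C: "C \<in> cover_partition X \<U>" "freudenthal_emb X x \<V> \<subseteq> C"
    using freudenthal_emb_block(1)[OF *(2) assms] cover_le_iff[OF *(1,2)] by blast
  then have "x \<in> C"
    using freudenthal_emb_block(2)[OF *(2) assms] by blast
  then have "C = freudenthal_emb X x \<U>"
    by (rule cover_partition_unique[OF *(1) C(1) freudenthal_emb_block(1)[OF *(1) assms] _ freudenthal_emb_block(2)[OF *(1) assms]])
  with C show "freudenthal_emb X x \<V> \<subseteq> freudenthal_emb X x \<U>"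
    by blast
qed (simp add: freudenthal_emb_def)

lemma end_nbhd_mono: "U \<subseteq> V \<Longrightarrow> end_nbhd X U \<subseteq> end_nbhd X V"
  unfolding end_nbhd_def by blast

lemma end_nbhd_subset: "end_nbhd X U \<subseteq> topspace (freudenthal X)"
  unfolding end_nbhd_def by blast

lemma end_nbhd_empty [simp]: "end_nbhd X {} = {}"
proof (rule equals0I)
  fix e assume "e \<in> end_nbhd X {}"
  then obtain \<U> where "e \<in> topspace (freudenthal X)" "\<U> \<in> end_covers X" "e \<U> \<subseteq> {}"
    unfolding end_nbhd_def by blast
  then show False
    using freudenthal_nonempty[of e X \<U>] by simp
qed

lemma freudenthal_emb_end_nbhdD:
  "x \<in> topspace X \<Longrightarrow> freudenthal_emb X x \<in> end_nbhd X U \<Longrightarrow> x \<in> U"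
  unfolding end_nbhd_def using freudenthal_emb_block(2)[of _ X x] by blast

section \<open>Construction of end covers in locally compact Hausdorff spaces\<close>

locale lc_Hausdorff =
  fixes X :: "'a topology"
  assumes lc: "locally_compact_space X" and haus: "Hausdorff_space X"
begin

lemma bounded_closure: "bounded_subset X S \<Longrightarrow> compactin X (X closure_of S)"
  unfolding bounded_subset_def
  by (meson closed_compactin closedin_closure_of compactin_imp_closedin[OF haus] closure_of_minimal)

lemma bounded_closedin: "bounded_subset X S \<Longrightarrow> closedin X S \<Longrightarrow> compactin X S"
  using bounded_closure closure_of_closedin by fastforce

lemma bounded_subset_closure_of: "bounded_subset X S \<Longrightarrow> bounded_subset X (X closure_of S)"
  using bounded_closure compactin_imp_bounded_subset by blast

lemma cf_open_bounded': "openin X N \<Longrightarrow> bounded_subset X N \<Longrightarrow> cf_open X N"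
  by (simp add: bounded_subset_closure_of cf_open_bounded)

text \<open>The frontier of an open set is closed, so the boundedness asked for in
  \<open>cf_open\<close>, convenient because it passes to subsets, amounts to compactness
  here.\<close>

lemma compact_frontier: "cf_open X U \<Longrightarrow> compactin X (X closure_of U - U)"
  unfolding cf_open_def by (simp add: bounded_closedin closedin_diff)

lemma cf_open_Diff_compact:
  assumes "cf_open X U" "compactin X K" shows "cf_open X (U - K)"
proof (rule cf_openI)
  show "openin X (U - K)"
    using assms cf_openD(1) compactin_imp_closedin[OF haus] by blast
  show "bounded_subset X ((X closure_of U - U) \<union> K)"
    using assms by (simp add: cf_open_def compactin_imp_bounded_subset)
  show "X closure_of (U - K) - (U - K) \<subseteq> (X closure_of U - U) \<union> K"
    using closure_of_mono[of "U - K" U X] by blast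
qed

lemma compact_nbhd:
  assumes "compactin X K"
  obtains N where "openin X N" "K \<subseteq> N" "compactin X (X closure_of N)"
proof -
  obtain U L where "openin X U" "compactin X L" "K \<subseteq> U" "U \<subseteq> L"
    using lc haus assms locally_compact_space_compact_closed_compact[of X] by blast
  then show ?thesis
    using that[of U] bounded_closure[of U] unfolding bounded_subset_def by blast
qed

lemma compact_nbhd_in:
  assumes "compactin X K" "openin X W" "K \<subseteq> W"
  obtains N where "openin X N" "K \<subseteq> N" "compactin X (X closure_of N)" "X closure_of N \<subseteq> W"
proof -
  have "regular_space X"
    using haus lc locally_compact_Hausdorff_imp_regular_space by blast
  moreover have "closedin X (topspace X - W)" "disjnt K (topspace X - W)"
    using assms by (auto simp: disjnt_def)
  ultimately obtain U V where UV: "openin X U" "openin X V" "K \<subseteq> U" "topspace X - W \<subseteq> V" "disjnt U V"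
    using regular_space_compact_closed_sets assms(1) by metis
  obtain N where N: "openin X N" "K \<subseteq> N" "compactin X (X closure_of N)"
    using compact_nbhd assms(1) by blast
  have "V \<inter> X closure_of (N \<inter> U) = {}"
    using UV by (intro openin_Int_closure_of_empty) (auto simp: disjnt_def)
  then have "X closure_of (N \<inter> U) \<subseteq> W"
    using UV(4) closure_of_subset_topspace[of X "N \<inter> U"] by blast
  moreover have "compactin X (X closure_of (N \<inter> U))"
    by (rule closed_compactin[OF N(3)]) (simp_all add: closure_of_mono)
  ultimately show ?thesis
    using that[of "N \<inter> U"] UV(1,3) N(1,2) by blast
qed

lemma end_cover_cf_open:
  "\<U> \<in> end_covers X \<Longrightarrow> V \<in> snd \<U> \<Longrightarrow> cf_open X V"
  "\<U> \<in> end_covers X \<Longrightarrow> cf_open X (fst \<U>)"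
  unfolding end_covers_iff cf_open_def by (auto intro: compactin_imp_bounded_subset)

text \<open>The distinguished member is determined by the others, so a cover can be given by the
  remaining pieces alone. An empty piece is dropped because it would yield an empty block.\<close>

lemma end_coverI:
  assumes fin: "finite \<V>" and cf: "\<And>V. V \<in> \<V> \<Longrightarrow> cf_open X V"
    and disj: "\<And>V W. V \<in> \<V> \<Longrightarrow> W \<in> \<V> \<Longrightarrow> V \<noteq> W \<Longrightarrow> X closure_of V \<inter> X closure_of W = {}"
    and bdd: "bounded_subset X (topspace X - (\<Union>V\<in>\<V>. X closure_of V))"
  shows "(topspace X - (\<Union>V\<in>\<V>. X closure_of V), \<V> - {{}}) \<in> end_covers X"
proof -
  let ?U = "topspace X - (\<Union>V\<in>\<V>. X closure_of V)"
  have U: "openin X ?U"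
    using fin by (intro openin_diff openin_topspace closedin_Union) auto
  have cfU: "cf_open X ?U"
    using cf_open_bounded'[OF U bdd] .
  have sub: "V \<subseteq> X closure_of V" if "V \<in> \<V>" for V
    by (rule closure_of_subset[OF cf_openD(2)[OF cf[OF that]]])
  have "pairwise disjnt (insert ?U (\<V> - {{}}))"
  proof -
    have 1: "disjnt V W" if "V \<in> \<V>" "W \<in> \<V>" "V \<noteq> W" for V W
      using disj[OF that] sub[OF that(1)] sub[OF that(2)] unfolding disjnt_def by blast
    have 2: "disjnt V ?U" "disjnt ?U V" if "V \<in> \<V>" for V
      using sub[OF that] that unfolding disjnt_def by blast+
    show ?thesis
      unfolding pairwise_insert by (intro conjI allI impI pairwiseI 1 2) blast+
  qed
  moreover have "(\<Union>V\<in>\<V> - {{}}. X closure_of V) = (\<Union>V\<in>\<V>. X closure_of V)"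
    by auto
  moreover have "pairwise (\<lambda>V W. disjnt (X closure_of V) (X closure_of W)) (\<V> - {{}})"
    using disj by (auto simp: pairwise_def disjnt_def)
  moreover have "\<forall>V\<in>\<V> - {{}}. disjnt ?U (X closure_of V)"
    by (auto simp: disjnt_def)
  moreover have "topspace X = ?U \<union> (\<Union>V\<in>\<V>. X closure_of V)"
    using closure_of_subset_topspace[of X] by blast
  ultimately show ?thesis
    unfolding end_covers_iff using fin bdd cf cfU by (simp add: compact_frontier cf_openD(1) U)
qed

text \<open>The common refinement consists of all intersections of a member of one cover with a
  member of the other. What their closures leave uncovered is bounded and becomes a set of
  singletons.\<close>

lemma end_covers_directed:
  assumes \<U>: "\<U> \<in> end_covers X" and \<V>: "\<V> \<in> end_covers X"
  obtains \<W> where "\<W> \<in> end_covers X" "cover_le X \<U> \<W>" "cover_le X \<V> \<W>"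
proof -
  define \<A> where "\<A> = (\<lambda>(U,V). U \<inter> V) ` (snd \<U> \<times> snd \<V>)"
  define \<W> where "\<W> = (topspace X - (\<Union>V\<in>\<A>. X closure_of V), \<A> - {{}})"
  have fin: "finite \<A>" "finite (snd \<U>)" "finite (snd \<V>)"
    using \<U> \<V> unfolding \<A>_def end_covers_iff by auto
  have cf: "cf_open X A" if "A \<in> \<A>" for A
  proof -
    from that obtain U V where "U \<in> snd \<U>" "V \<in> snd \<V>" "A = U \<inter> V"
      unfolding \<A>_def by blast
    then show ?thesis
      using end_cover_cf_open(1)[OF \<U>] end_cover_cf_open(1)[OF \<V>] by (simp add: cf_open_Int)
  qed
  have cl: "X closure_of (U \<inter> V) \<subseteq> X closure_of U" "X closure_of (U \<inter> V) \<subseteq> X closure_of V" for U V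
    by (auto intro!: closure_of_mono)
  have dj: "X closure_of V \<inter> X closure_of W = {}" if "V \<in> snd \<R>" "W \<in> snd \<R>" "V \<noteq> W" "\<R> \<in> end_covers X" for V W \<R>
    using that unfolding end_covers_iff by (auto simp: pairwise_def disjnt_def)
  have disj: "X closure_of A \<inter> X closure_of B = {}" if AB: "A \<in> \<A>" "B \<in> \<A>" "A \<noteq> B" for A B
  proof -
    obtain U V U' V' where *: "A = U \<inter> V" "B = U' \<inter> V'" "U \<in> snd \<U>" "U' \<in> snd \<U>" "V \<in> snd \<V>" "V' \<in> snd \<V>"
      using AB(1,2) unfolding \<A>_def by auto
    then have "U \<noteq> U' \<or> V \<noteq> V'"
      using AB(3) by blast
    then show ?thesis
      using dj[of U \<U> U'] dj[of V \<V> V'] \<U> \<V> * cl by (elim disjE) blast+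
  qed
  \<comment> \<open>Outside of \<open>?B\<close> a point lies in some member of each cover, and in
    the member itself rather than just in its closure.\<close>
  let ?B = "(fst \<U> \<union> fst \<V>) \<union> ((\<Union>V\<in>snd \<U>. X closure_of V - V) \<union> (\<Union>V\<in>snd \<V>. X closure_of V - V))"
  have bB: "bounded_subset X ?B"
    unfolding bounded_subset_Un
  proof (intro conjI bounded_subset_Union)
    show "bounded_subset X (fst \<U>)" "bounded_subset X (fst \<V>)"
      using \<U> \<V> unfolding end_covers_iff by auto
  next
    show "finite ((\<lambda>V. X closure_of V - V) ` snd \<U>)" "finite ((\<lambda>V. X closure_of V - V) ` snd \<V>)"
      using fin by simp_all
  next
    fix S assume "S \<in> (\<lambda>V. X closure_of V - V) ` snd \<U>"
    then show "bounded_subset X S"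
      using end_cover_cf_open(1)[OF \<U>] unfolding cf_open_def by fast
  next
    fix S assume "S \<in> (\<lambda>V. X closure_of V - V) ` snd \<V>"
    then show "bounded_subset X S"
      using end_cover_cf_open(1)[OF \<V>] unfolding cf_open_def by fast
  qed
  have bdd: "bounded_subset X (topspace X - (\<Union>V\<in>\<A>. X closure_of V))"
  proof (rule bounded_subset_mono[OF bB], rule subsetI, rule ccontr)
    fix x assume x: "x \<in> topspace X - (\<Union>V\<in>\<A>. X closure_of V)" "x \<notin> ?B"
    have xX: "x \<in> topspace X"
      using x(1) by blast
    obtain U where U: "U \<in> snd \<U>" "x \<in> U"
      using end_cover_cases[OF \<U> xX] x(2) by blast
    obtain V where V: "V \<in> snd \<V>" "x \<in> V"
      using end_cover_cases[OF \<V> xX] x(2) by blast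
    note UV = U V
    have "U \<inter> V \<in> \<A>"
      using UV
      unfolding \<A>_def by force
    moreover have "x \<in> X closure_of (U \<inter> V)"
      using UV closure_of_subset[OF cf_openD(2)[OF cf[OF calculation]]] by blast
    ultimately show False
      using x(1) by blast
  qed
  have \<W>: "\<W> \<in> end_covers X"
    unfolding \<W>_def using fin(1) cf disj bdd by (rule end_coverI)
  have le: "cover_le X \<R> \<W>" if \<R>: "\<R> \<in> end_covers X" and sub: "\<And>A. A \<in> \<A> \<Longrightarrow> \<exists>R\<in>snd \<R>. X closure_of A \<subseteq> X closure_of R" for \<R>
    unfolding cover_le_iff[OF \<R> \<W>]
  proof
    fix B assume B: "B \<in> cover_partition X \<W>"
    have "(\<exists>x. x \<in> topspace X \<and> B = {x}) \<or> (\<exists>A. A \<in> \<A> \<and> B = X closure_of A)"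
      using end_cover_blocks[OF B] unfolding \<W>_def fst_conv snd_conv by blast
    then consider x where "x \<in> topspace X" "B = {x}" | A where "A \<in> \<A>" "B = X closure_of A"
      by metis
    then show "\<exists>C\<in>cover_partition X \<R>. B \<subseteq> C"
    proof cases
      case 1
      then show ?thesis
        using Union_cover_partition[OF \<R>] by blast
    next
      case 2
      then obtain R where "R \<in> snd \<R>" "X closure_of A \<subseteq> X closure_of R"
        using sub by blast
      then show ?thesis
        using 2 unfolding cover_partition_def by blast
    qed
  qed
  have "cover_le X \<U> \<W>"
  proof (rule le[OF \<U>])
    fix A assume "A \<in> \<A>"
    then obtain U V where "U \<in> snd \<U>" "A = U \<inter> V"
      unfolding \<A>_def by blast
    then show "\<exists>R\<in>snd \<U>. X closure_of A \<subseteq> X closure_of R"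
      using cl(1) by blast
  qed
  moreover have "cover_le X \<V> \<W>"
  proof (rule le[OF \<V>])
    fix A assume "A \<in> \<A>"
    then obtain U V where "V \<in> snd \<V>" "A = U \<inter> V"
      unfolding \<A>_def by blast
    then show "\<exists>R\<in>snd \<V>. X closure_of A \<subseteq> X closure_of R"
      using cl(2) by blast
  qed
  ultimately show ?thesis
    by (rule that[OF \<W>])
qed

lemma end_nbhd_Int: "end_nbhd X (U \<inter> V) = end_nbhd X U \<inter> end_nbhd X V"
proof
  show "end_nbhd X U \<inter> end_nbhd X V \<subseteq> end_nbhd X (U \<inter> V)"
  proof
    fix e assume "e \<in> end_nbhd X U \<inter> end_nbhd X V"
    then obtain \<U> \<V> where e: "e \<in> topspace (freudenthal X)" "\<U> \<in> end_covers X" "\<V> \<in> end_covers X" "e \<U> \<subseteq> U" "e \<V> \<subseteq> V"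
      unfolding end_nbhd_def by blast
    obtain \<W> where W: "\<W> \<in> end_covers X" "cover_le X \<U> \<W>" "cover_le X \<V> \<W>"
      using end_covers_directed[OF e(2,3)] by blast
    then have "e \<W> \<subseteq> U \<inter> V"
      using freudenthal_antimono[OF e(1,2) W(1,2)] freudenthal_antimono[OF e(1,3) W(1,3)] e(4,5) by blast
    then show "e \<in> end_nbhd X (U \<inter> V)"
      using e(1) W(1) unfolding end_nbhd_def by blast
  qed
qed (use end_nbhd_mono[of "U \<inter> V"] in auto)

lemma end_nbhd_disjoint: "U \<inter> V = {} \<Longrightarrow> end_nbhd X U \<inter> end_nbhd X V = {}"
  using end_nbhd_Int[of U V] by simp

text \<open>In a common refinement with any other cover the coordinate still lies in
  \<open>{x}\<close> and is nonempty; hence \<open>x\<close> belongs to every coordinate, which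
  determines all of them.\<close>

lemma freudenthal_singleton:
  assumes e: "e \<in> topspace (freudenthal X)" and \<U>: "\<U> \<in> end_covers X" and "e \<U> \<subseteq> {x}"
  shows "x \<in> topspace X \<and> e = freudenthal_emb X x"
proof -
  have x: "x \<in> topspace X"
    using assms freudenthal_nonempty freudenthal_subset_topspace by blast
  have "e \<V> = freudenthal_emb X x \<V>" if \<V>: "\<V> \<in> end_covers X" for \<V>
  proof -
    obtain \<W> where W: "\<W> \<in> end_covers X" "cover_le X \<U> \<W>" "cover_le X \<V> \<W>"
      using end_covers_directed[OF \<U> \<V>] by blast
    have "e \<W> \<subseteq> {x}"
      using freudenthal_antimono[OF e \<U> W(1,2)] assms by blast
    then have "x \<in> e \<W>"
      using freudenthal_nonempty[OF e W(1)] by blast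
    then have "x \<in> e \<V>"
      using freudenthal_antimono[OF e \<V> W(1,3)] by blast
    then show ?thesis
      using cover_partition_unique[OF \<V>] freudenthal_mem_partition[OF e \<V>] freudenthal_emb_block[OF \<V> x] by blast
  qed
  then have "e = freudenthal_emb X x"
    using e freudenthal_emb_in_topspace[OF x] unfolding mem_freudenthal
    by (intro PiE_ext[of e "end_covers X" _ "freudenthal_emb X x"]) auto
  with x show ?thesis by blast
qed

lemma end_block:
  assumes "e \<in> ends X" "\<U> \<in> end_covers X"
  obtains V where "V \<in> snd \<U>" "e \<U> = X closure_of V"
proof -
  have e: "e \<in> topspace (freudenthal X)"
    using assms unfolding ends_def by blast
  have ns: "e \<U> \<noteq> {x}" for x
  proof
    assume "e \<U> = {x}"
    then have "x \<in> topspace X \<and> e = freudenthal_emb X x"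
      by (intro freudenthal_singleton[OF e assms(2)]) simp
    with assms(1) show False
      unfolding ends_def by blast
  qed
  obtain V where "V \<in> snd \<U>" "e \<U> = X closure_of V"
    using end_cover_blocks[OF freudenthal_mem_partition[OF e assms(2)]] ns by blast
  then show ?thesis
    by (rule that)
qed

text \<open>Enclose the frontier of \<open>U\<close> and \<open>K\<close> in an open
  \<open>N\<close> with compact closure, and take \<open>U\<close> and its exterior, each without
  the closure of \<open>N\<close>, as the two pieces. Their closures miss the open set
  \<open>N\<close>, hence \<open>K\<close> and the frontier, and so stay on their sides.\<close>

lemma split_end_cover:
  assumes U: "cf_open X U" and K: "compactin X K"
  obtains \<U> where "\<U> \<in> end_covers X"
    "\<And>B. B \<in> cover_partition X \<U> \<Longrightarrow>
       (\<exists>x. B = {x}) \<or> B \<subseteq> U - K \<or> B \<subseteq> topspace X - X closure_of U - K"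
proof -
  have "compactin X ((X closure_of U - U) \<union> K)"
    using K compact_frontier[OF U] by (simp add: compactin_Un)
  then obtain N where N: "openin X N" "(X closure_of U - U) \<union> K \<subseteq> N" "compactin X (X closure_of N)"
    by (rule compact_nbhd)
  let ?V1 = "U - X closure_of N" and ?V2 = "(topspace X - X closure_of U) - X closure_of N"
  have NN: "N \<subseteq> X closure_of N"
    by (rule closure_of_subset[OF openin_subset[OF N(1)]])
  have cf1: "cf_open X ?V1" and cf2: "cf_open X ?V2"
    by (rule cf_open_Diff_compact[OF _ N(3)] U cf_open_Compl)+
  have s1: "?V1 \<subseteq> X closure_of ?V1" and s2: "?V2 \<subseteq> X closure_of ?V2"
    by (rule closure_of_subset[OF cf_openD(2)], rule cf1 cf2)+
  have "N \<inter> X closure_of ?V1 = {}" "N \<inter> X closure_of ?V2 = {}" "U \<inter> X closure_of ?V2 = {}"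
    using NN closure_of_subset[OF cf_openD(2)[OF U]]
    by (intro openin_Int_closure_of_empty N(1) cf_openD(1)[OF U]; blast)+
  moreover have "X closure_of ?V1 \<subseteq> X closure_of U"
    by (rule closure_of_mono) blast
  moreover have "A \<subseteq> U - K" if "N \<inter> A = {}" "A \<subseteq> X closure_of U" for A
    using that N(2) by blast
  moreover have "A \<subseteq> topspace X - X closure_of U - K" if "N \<inter> A = {}" "U \<inter> A = {}" "A \<subseteq> topspace X" for A
    using that N(2) by blast
  ultimately have c1: "X closure_of ?V1 \<subseteq> U - K" and c2: "X closure_of ?V2 \<subseteq> topspace X - X closure_of U - K"
    by (simp_all add: closure_of_subset_topspace)
  let ?W = "{?V1, ?V2}"
  have bdd: "bounded_subset X (topspace X - (\<Union>V\<in>?W. X closure_of V))"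
  proof (rule bounded_subset_mono[OF compactin_imp_bounded_subset[OF N(3)]], rule subsetI, rule ccontr)
    fix x assume "x \<in> topspace X - (\<Union>V\<in>?W. X closure_of V)" "x \<notin> X closure_of N"
    moreover from this have "x \<notin> X closure_of U - U" "x \<in> topspace X" "x \<notin> X closure_of ?V1" "x \<notin> X closure_of ?V2"
      using N(2) NN by auto
    ultimately have "x \<in> ?V1 \<or> x \<in> ?V2"
      by blast
    with s1 s2 \<open>x \<notin> X closure_of ?V1\<close> \<open>x \<notin> X closure_of ?V2\<close> show False
      by (meson subsetD)
  qed
  have UU: "U \<subseteq> X closure_of U"
    by (rule closure_of_subset[OF cf_openD(2)[OF U]])
  have "(topspace X - (\<Union>V\<in>?W. X closure_of V), ?W - {{}}) \<in> end_covers X" (is "?\<U> \<in> _")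
  proof (rule end_coverI[OF _ _ _ bdd])
    show "cf_open X V" if "V \<in> ?W" for V
      using that cf1 cf2 by blast
    have "X closure_of ?V1 \<inter> X closure_of ?V2 = {}"
      using c1 c2 UU by blast
    then show "X closure_of V \<inter> X closure_of W = {}" if "V \<in> ?W" "W \<in> ?W" "V \<noteq> W" for V W
      using that by (metis Int_commute insertE singletonD)
  qed simp
  moreover have "(\<exists>x. B = {x}) \<or> B \<subseteq> U - K \<or> B \<subseteq> topspace X - X closure_of U - K"
    if "B \<in> cover_partition X ?\<U>" for B
    using end_cover_blocks[OF that] c1 c2 unfolding fst_conv snd_conv by blast
  ultimately show ?thesis
    by (rule that)
qed

section \<open>The side of a cut on which an end lies\<close>

lemma end_in_topspace: "e \<in> ends X \<Longrightarrow> e \<in> topspace (freudenthal X)"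
  unfolding ends_def by blast

lemma end_not_singleton:
  assumes e: "e \<in> ends X" and "\<U> \<in> end_covers X" shows "e \<U> \<noteq> {x}"
proof
  assume "e \<U> = {x}"
  then have "x \<in> topspace X \<and> e = freudenthal_emb X x"
    by (intro freudenthal_singleton[OF end_in_topspace[OF e] assms(2)]) simp
  with e show False
    unfolding ends_def by blast
qed

lemma end_split:
  assumes e: "e \<in> ends X" and U: "cf_open X U" and K: "bounded_subset X K"
  shows "e \<in> end_nbhd X (U - K) \<or> e \<in> end_nbhd X (topspace X - X closure_of U - K)"
proof -
  obtain L where L: "compactin X L" "K \<subseteq> L"
    using K unfolding bounded_subset_def by blast
  obtain \<U> where \<U>: "\<U> \<in> end_covers X"
    "\<And>B. B \<in> cover_partition X \<U> \<Longrightarrow>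
       (\<exists>x. B = {x}) \<or> B \<subseteq> U - L \<or> B \<subseteq> topspace X - X closure_of U - L"
    by (rule split_end_cover[OF U L(1)]) (rule that)
  have "e \<U> \<subseteq> U - L \<or> e \<U> \<subseteq> topspace X - X closure_of U - L"
    using \<U>(2)[OF freudenthal_mem_partition[OF end_in_topspace[OF e] \<U>(1)]]
      end_not_singleton[OF e \<U>(1)] by simp
  then have "e \<U> \<subseteq> U - K \<or> e \<U> \<subseteq> topspace X - X closure_of U - K"
    using L(2) by blast
  then show ?thesis
    unfolding end_nbhd_def using end_in_topspace[OF e] \<U>(1) by blast
qed

lemma end_cases:
  assumes e: "e \<in> ends X" and U: "cf_open X U"
  shows "e \<in> end_nbhd X U \<or> e \<in> end_nbhd X (topspace X - X closure_of U)"
  using end_split[OF assms, of "{}"] by simp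

lemma end_nbhd_Compl:
  assumes e: "e \<in> ends X" and K: "bounded_subset X K"
  shows "e \<in> end_nbhd X (topspace X - K)"
  using end_split[OF e cf_open_topspace K] by simp

lemma end_nbhd_topspace: "e \<in> ends X \<Longrightarrow> e \<in> end_nbhd X (topspace X)"
  using end_nbhd_Compl[of e "{}"] by simp

lemma end_nbhd_Diff_bounded:
  assumes e: "e \<in> ends X" and K: "bounded_subset X K" and U: "e \<in> end_nbhd X U"
  shows "e \<in> end_nbhd X (U - K)"
proof -
  have "e \<in> end_nbhd X (U \<inter> (topspace X - K))"
    using U end_nbhd_Compl[OF e K] end_nbhd_Int by blast
  then show ?thesis
    using end_nbhd_mono[of "U \<inter> (topspace X - K)" "U - K"] by blast
qed

lemma end_nbhd_unbounded: "e \<in> ends X \<Longrightarrow> e \<in> end_nbhd X U \<Longrightarrow> \<not> bounded_subset X U"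
  using end_nbhd_Diff_bounded[of e U U] by auto

lemma end_nbhd_not_both: "e \<in> end_nbhd X U \<Longrightarrow> e \<in> end_nbhd X V \<Longrightarrow> U \<inter> V \<noteq> {}"
  using end_nbhd_disjoint by blast

lemma freudenthal_emb_in_end_nbhd:
  assumes x: "x \<in> topspace X" "x \<in> U" shows "freudenthal_emb X x \<in> end_nbhd X U"
proof -
  \<comment> \<open>A cover adapted to the compact set \<open>{x}\<close> has no block through
    \<open>x\<close> other than the singleton.\<close>
  have "compactin X {x}"
    using x by simp
  then obtain \<U> where \<U>: "\<U> \<in> end_covers X"
    "\<And>B. B \<in> cover_partition X \<U> \<Longrightarrow>
       (\<exists>y. B = {y}) \<or> B \<subseteq> topspace X - {x} \<or> B \<subseteq> topspace X - X closure_of (topspace X) - {x}"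
    by (rule split_end_cover[OF cf_open_topspace]) (rule that)
  have "x \<in> freudenthal_emb X x \<U>" "freudenthal_emb X x \<U> \<in> cover_partition X \<U>"
    using freudenthal_emb_block[OF \<U>(1) x(1)] by blast+
  then have "freudenthal_emb X x \<U> = {x}"
    using \<U>(2)[of "freudenthal_emb X x \<U>"] by fastforce
  then have "freudenthal_emb X x \<U> \<subseteq> U"
    using x by simp
  then show ?thesis
    unfolding end_nbhd_def using freudenthal_emb_in_topspace[OF x(1)] \<U>(1) by blast
qed

section \<open>The topology of the compactification\<close>

lemma freudenthal_point_cases:
  assumes "e \<in> topspace (freudenthal X)"
  obtains "e \<in> ends X" | x where "x \<in> topspace X" "e = freudenthal_emb X x"
  using assms unfolding ends_def by blast

text \<open>For one cover, the blocks inside \<open>U\<close> fill \<open>U\<close> except for the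
  finitely many closed blocks that are not contained in \<open>U\<close>; so they form an open set
  of the quotient, and its preimage is open. The union over all covers is the set in
  question.\<close>

lemma openin_end_nbhd:
  assumes U: "openin X U" shows "openin (freudenthal X) (end_nbhd X U)"
proof -
  have op: "openin (freudenthal X) {e \<in> topspace (freudenthal X). e \<U> \<subseteq> U}" if \<U>: "\<U> \<in> end_covers X" for \<U>
  proof -
    let ?W = "{B \<in> cover_partition X \<U>. B \<subseteq> U}"
    let ?F = "{V \<in> snd \<U>. \<not> X closure_of V \<subseteq> U}"
    have "\<Union>?W = U - (\<Union>V\<in>?F. X closure_of V)"
    proof
      show "\<Union>?W \<subseteq> U - (\<Union>V\<in>?F. X closure_of V)"
      proof (rule subsetI, rule DiffI)
        fix x assume "x \<in> \<Union>?W"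
        then obtain B where B: "B \<in> cover_partition X \<U>" "B \<subseteq> U" "x \<in> B" by blast
        then show "x \<in> U" by blast
        show "x \<notin> (\<Union>V\<in>?F. X closure_of V)"
        proof
          assume "x \<in> (\<Union>V\<in>?F. X closure_of V)"
          then obtain V where V: "V \<in> snd \<U>" "\<not> X closure_of V \<subseteq> U" "x \<in> X closure_of V" by blast
          then have "X closure_of V \<in> cover_partition X \<U>"
            unfolding cover_partition_def by blast
          then have "B = X closure_of V"
            by (rule cover_partition_unique[OF \<U> B(1) _ B(3) V(3)])
          with B V show False by simp
        qed
      qed
      show "U - (\<Union>V\<in>?F. X closure_of V) \<subseteq> \<Union>?W"
      proof
        fix x assume x: "x \<in> U - (\<Union>V\<in>?F. X closure_of V)"
        then have "x \<in> topspace X"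
          using openin_subset[OF U] by blast
        then obtain B where B: "B \<in> cover_partition X \<U>" "x \<in> B"
          using Union_cover_partition[OF \<U>] by blast
        then have "B \<subseteq> U"
          using end_cover_blocks[OF B(1)] x by blast
        with B show "x \<in> \<Union>?W" by blast
      qed
    qed
    moreover have "finite ?F"
      using \<U> unfolding end_covers_iff by simp
    then have "closedin X (\<Union>V\<in>?F. X closure_of V)"
      by (intro closedin_Union) auto
    ultimately have "openin X (\<Union>?W)"
      using U by (simp add: openin_diff)
    then have W: "openin (cover_quotient X \<U>) ?W"
      unfolding cover_quotient_def openin_partition_quotient[OF partition_on_cover_partition[OF \<U>]] by blast
    have "continuous_map (freudenthal X) (cover_quotient X \<U>) (\<lambda>e. e \<U>)"
      unfolding freudenthal_def inverse_limit_def
      by (intro continuous_map_from_subtopology continuous_map_product_projection \<U>)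
    from openin_continuous_map_preimage[OF this W]
    have "openin (freudenthal X) {e \<in> topspace (freudenthal X). e \<U> \<in> ?W}" .
    also have "{e \<in> topspace (freudenthal X). e \<U> \<in> ?W} = {e \<in> topspace (freudenthal X). e \<U> \<subseteq> U}"
      using freudenthal_mem_partition[OF _ \<U>] by blast
    finally show ?thesis .
  qed
  have "end_nbhd X U = (\<Union>\<U>\<in>end_covers X. {e \<in> topspace (freudenthal X). e \<U> \<subseteq> U})"
    unfolding end_nbhd_def by blast
  also have "openin (freudenthal X) \<dots>"
    by (intro openin_Union) (use op in blast)
  finally show ?thesis .
qed

lemma end_nbhd_topspace': "e \<in> topspace (freudenthal X) \<Longrightarrow> e \<in> end_nbhd X (topspace X)"
proof (erule freudenthal_point_cases)
qed (auto intro: end_nbhd_topspace freudenthal_emb_in_end_nbhd)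

lemma end_nbhd_Inter:
  assumes "finite \<O>" "e \<in> topspace (freudenthal X)" "\<And>W. W \<in> \<O> \<Longrightarrow> e \<in> end_nbhd X W"
  shows "e \<in> end_nbhd X (topspace X \<inter> \<Inter>\<O>)"
  using assms(1,3)
proof (induction \<O> rule: finite_induct)
  case empty
  then show ?case
    using end_nbhd_topspace'[OF assms(2)] by simp
next
  case (insert W \<O>)
  then have "e \<in> end_nbhd X (W \<inter> (topspace X \<inter> \<Inter>\<O>))"
    unfolding end_nbhd_Int[of W] by simp
  then show ?case
    by (simp add: Int_left_commute)
qed

text \<open>A basic box restricts finitely many coordinates, indexed by \<open>J\<close>;
  \<open>V\<close> is the intersection of the saturated open sets of these restrictions. If some
  coordinate of \<open>d\<close> lies in \<open>V\<close>, a common refinement gives it a point in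
  common with each coordinate in \<open>J\<close>, which is thereby one of the permitted
  blocks.\<close>

lemma freudenthal_base:
  assumes W: "openin (freudenthal X) W" and e: "e \<in> W"
  obtains V where "openin X V" "e \<in> end_nbhd X V" "end_nbhd X V \<subseteq> W"
proof -
  have eF: "e \<in> topspace (freudenthal X)"
    using openin_subset[OF W] e by blast
  define S where "S = {f. \<forall>i\<in>end_covers X. \<forall>j\<in>end_covers X. cover_le X i j \<longrightarrow> cover_bond X i j (f j) = f i}"
  have fr: "freudenthal X = subtopology (product_topology (cover_quotient X) (end_covers X)) S"
    unfolding freudenthal_def inverse_limit_def S_def by (rule refl)
  have FS: "topspace (freudenthal X) \<subseteq> S"
    by (simp add: fr)
  obtain W' where W': "openin (product_topology (cover_quotient X) (end_covers X)) W'" "W = W' \<inter> S"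
    using W unfolding fr openin_subtopology by (elim exE conjE)
  obtain U where U: "finite {\<U> \<in> end_covers X. U \<U> \<noteq> topspace (cover_quotient X \<U>)}"
      "\<And>\<U>. \<U> \<in> end_covers X \<Longrightarrow> openin (cover_quotient X \<U>) (U \<U>)"
      "e \<in> Pi\<^sub>E (end_covers X) U" "Pi\<^sub>E (end_covers X) U \<subseteq> W'"
  proof -
    have "e \<in> W'"
      using W'(2) e by blast
    with W'(1)[unfolded openin_product_topology_alt] have
      "\<exists>U. finite {\<U> \<in> end_covers X. U \<U> \<noteq> topspace (cover_quotient X \<U>)} \<and>
        (\<forall>\<U>\<in>end_covers X. openin (cover_quotient X \<U>) (U \<U>)) \<and>
        e \<in> Pi\<^sub>E (end_covers X) U \<and> Pi\<^sub>E (end_covers X) U \<subseteq> W'"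
      by (rule bspec)
    then show ?thesis
      by (elim exE conjE) (rule that, simp_all)
  qed
  define J where "J = {\<U> \<in> end_covers X. U \<U> \<noteq> topspace (cover_quotient X \<U>)}"
  define V where "V = topspace X \<inter> \<Inter>((\<lambda>\<U>. \<Union>(U \<U>)) ` J)"
  have op: "openin X (\<Union>(U \<U>))" "U \<U> \<subseteq> cover_partition X \<U>" if "\<U> \<in> end_covers X" for \<U>
    using U(2)[OF that] unfolding cover_quotient_def
      openin_partition_quotient[OF partition_on_cover_partition[OF that]] by blast+
  have "openin X V"
  proof -
    have "openin X (\<Inter>(insert (topspace X) ((\<lambda>\<U>. \<Union>(U \<U>)) ` J)))"
    proof (rule openin_Inter)
      show "finite (insert (topspace X) ((\<lambda>\<U>. \<Union>(U \<U>)) ` J))"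
        using U(1) unfolding J_def by blast
      fix Y assume "Y \<in> insert (topspace X) ((\<lambda>\<U>. \<Union>(U \<U>)) ` J)"
      then show "openin X Y"
        using op(1) unfolding J_def by blast
    qed simp
    then show ?thesis
      unfolding V_def by simp
  qed
  moreover have "e \<in> end_nbhd X V"
    unfolding V_def
  proof (rule end_nbhd_Inter[OF _ eF])
    show "finite ((\<lambda>\<U>. \<Union>(U \<U>)) ` J)"
      using U(1) unfolding J_def by blast
    fix Y assume "Y \<in> (\<lambda>\<U>. \<Union>(U \<U>)) ` J"
    then obtain \<U> where \<U>: "\<U> \<in> end_covers X" "Y = \<Union>(U \<U>)"
      unfolding J_def by blast
    then have "e \<U> \<subseteq> Y"
      using PiE_mem[OF U(3) \<U>(1)] by blast
    then show "e \<in> end_nbhd X Y"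
      unfolding end_nbhd_def using eF \<U>(1) by blast
  qed
  moreover have "end_nbhd X V \<subseteq> W"
  proof
    fix d assume d: "d \<in> end_nbhd X V"
    then obtain \<V> where \<V>: "d \<in> topspace (freudenthal X)" "\<V> \<in> end_covers X" "d \<V> \<subseteq> V"
      unfolding end_nbhd_def by blast
    have "d \<U> \<in> U \<U>" if \<U>: "\<U> \<in> end_covers X" for \<U>
    proof (cases "\<U> \<in> J")
      case False
      then have "U \<U> = cover_partition X \<U>"
        using \<U> topspace_cover_quotient[OF \<U>] unfolding J_def by blast
      then show ?thesis
        using freudenthal_mem_partition[OF \<V>(1) \<U>] by simp
    next
      case True
      obtain \<W> where R: "\<W> \<in> end_covers X" "cover_le X \<U> \<W>" "cover_le X \<V> \<W>"
        by (rule end_covers_directed[OF \<U> \<V>(2)])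
      obtain x where x: "x \<in> d \<W>"
        using freudenthal_nonempty[OF \<V>(1) R(1)] by blast
      have xU: "x \<in> d \<U>"
        using freudenthal_antimono[OF \<V>(1) \<U> R(1,2)] x by (rule subsetD)
      have "x \<in> d \<V>"
        using freudenthal_antimono[OF \<V>(1,2) R(1,3)] x by (rule subsetD)
      then have "x \<in> \<Union>(U \<U>)"
        using \<V>(3) True unfolding V_def by blast
      then obtain B where B: "x \<in> B" "B \<in> U \<U>" by blast
      have "d \<U> = B"
        by (rule cover_partition_unique[OF \<U> freudenthal_mem_partition[OF \<V>(1) \<U>] _ xU B(1)])
          (use B op(2)[OF \<U>] in blast)
      with B show ?thesis by simp
    qed
    moreover have "d \<in> extensional (end_covers X)"
      using \<V>(1) unfolding mem_freudenthal by (simp add: PiE_iff)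
    ultimately have "d \<in> Pi\<^sub>E (end_covers X) U"
      by (simp add: PiE_iff)
    then show "d \<in> W"
      using U(4) W'(2) FS \<V>(1) by blast
  qed
  ultimately show ?thesis
    by (rule that)
qed

text \<open>The coordinate of \<open>e\<close> that lies in \<open>W\<close> is the closure of a
  member \<open>V\<close> of the cover. Then \<open>e\<close> does not lie in the exterior of
  \<open>V\<close>, so it lies in \<open>V\<close>.\<close>

lemma end_cf_base:
  assumes e: "e \<in> ends X" and O: "e \<in> end_nbhd X W"
  obtains V where "cf_open X V" "e \<in> end_nbhd X V" "X closure_of V \<subseteq> W"
proof -
  obtain \<U> where \<U>: "\<U> \<in> end_covers X" "e \<U> \<subseteq> W"
    using O unfolding end_nbhd_def by blast
  obtain V where V: "V \<in> snd \<U>" "e \<U> = X closure_of V"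
    by (rule end_block[OF e \<U>(1)])
  have cf: "cf_open X V"
    by (rule end_cover_cf_open(1)[OF \<U>(1) V(1)])
  have "e \<in> end_nbhd X (X closure_of V)"
    using V(2) \<U>(1) end_in_topspace[OF e] unfolding end_nbhd_def by blast
  then have "e \<notin> end_nbhd X (topspace X - X closure_of V)"
    using end_nbhd_not_both[of e "X closure_of V" "topspace X - X closure_of V"] by blast
  then have "e \<in> end_nbhd X V"
    using end_cases[OF e cf] by blast
  moreover have "X closure_of V \<subseteq> W"
    using V(2) \<U>(2) by simp
  ultimately show ?thesis
    by (rule that[OF cf])
qed

lemma ends_separated:
  assumes e: "e \<in> ends X" and d: "d \<in> ends X" and ne: "e \<noteq> d"
  obtains V where "cf_open X V" "e \<in> end_nbhd X V" "d \<in> end_nbhd X (topspace X - X closure_of V)"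
proof -
  have "\<exists>\<U>\<in>end_covers X. e \<U> \<noteq> d \<U>"
  proof (rule ccontr)
    assume "\<not> (\<exists>\<U>\<in>end_covers X. e \<U> \<noteq> d \<U>)"
    then have "e = d"
      using end_in_topspace[OF e] end_in_topspace[OF d] unfolding mem_freudenthal
      by (intro PiE_ext[of e "end_covers X" _ d]) auto
    with ne show False by simp
  qed
  then obtain \<U> where \<U>: "\<U> \<in> end_covers X" "e \<U> \<noteq> d \<U>" by blast
  obtain V where V: "V \<in> snd \<U>" "e \<U> = X closure_of V"
    by (rule end_block[OF e \<U>(1)])
  obtain V' where V': "V' \<in> snd \<U>" "d \<U> = X closure_of V'"
    by (rule end_block[OF d \<U>(1)])
  have cf: "cf_open X V"
    by (rule end_cover_cf_open(1)[OF \<U>(1) V(1)])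
  have VV: "V \<subseteq> X closure_of V"
    by (rule closure_of_subset[OF cf_openD(2)[OF cf]])
  have eV: "e \<in> end_nbhd X (X closure_of V)" and dV: "d \<in> end_nbhd X (X closure_of V')"
    using V(2) V'(2) \<U>(1) end_in_topspace[OF e] end_in_topspace[OF d] unfolding end_nbhd_def by blast+
  have "V \<noteq> V'"
    using V(2) V'(2) \<U>(2) by metis
  then have dj: "X closure_of V \<inter> X closure_of V' = {}"
    using \<U>(1) V(1) V'(1) unfolding end_covers_iff by (auto simp: pairwise_def disjnt_def)
  have "e \<in> end_nbhd X V"
    using end_cases[OF e cf] end_nbhd_not_both[OF eV, of "topspace X - X closure_of V"] by blast
  moreover have "d \<in> end_nbhd X (topspace X - X closure_of V)"
    using end_cases[OF d cf] end_nbhd_not_both[OF dV, of V] dj VV by blast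
  ultimately show ?thesis
    by (rule that[OF cf])
qed

end

section \<open>Long and short ends\<close>

text \<open>The prime ideal theorem relative to \<open>A\<close>: the subsets of \<open>A\<close>
  outside of \<open>I\<close> form an ultrafilter on \<open>A\<close>. \<open>I\<close> is maximal
  among the ideals that contain \<open>J\<close> and not \<open>A\<close>.\<close>

lemma prime_ideal_extension:
  fixes J :: "'a set set"
  assumes J: "{} \<in> J" "\<And>S T. S \<in> J \<Longrightarrow> T \<in> J \<Longrightarrow> S \<union> T \<in> J" "\<And>S T. S \<in> J \<Longrightarrow> T \<subseteq> S \<Longrightarrow> T \<in> J"
    and A: "A \<notin> J"
  obtains I where "J \<subseteq> I" "A \<notin> I"
    "\<And>S T. S \<in> I \<Longrightarrow> T \<in> I \<Longrightarrow> S \<union> T \<in> I" "\<And>S T. S \<in> I \<Longrightarrow> T \<subseteq> S \<Longrightarrow> T \<in> I"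
    "\<And>S. S \<in> I \<or> A - S \<in> I"
proof -
  define \<A> where "\<A> = {I. J \<subseteq> I \<and> A \<notin> I \<and> (\<forall>S\<in>I. \<forall>T\<in>I. S \<union> T \<in> I) \<and> (\<forall>S\<in>I. \<forall>T. T \<subseteq> S \<longrightarrow> T \<in> I)}"
  have "\<exists>M\<in>\<A>. \<forall>I\<in>\<A>. M \<subseteq> I \<longrightarrow> I = M"
  proof (rule subset_Zorn_nonempty)
    have "J \<in> \<A>"
      unfolding \<A>_def by (intro CollectI conjI ballI allI impI order_refl A) (fact J)+
    then show "\<A> \<noteq> {}"
      by (metis empty_iff)
    fix \<C> assume ne: "\<C> \<noteq> {}" and ch: "subset.chain \<A> \<C>"
    then have sub: "\<C> \<subseteq> \<A>" and lin: "\<And>I I'. I \<in> \<C> \<Longrightarrow> I' \<in> \<C> \<Longrightarrow> I \<subseteq> I' \<or> I' \<subseteq> I"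
      unfolding subset_chain_def by blast+
    have mem: "J \<subseteq> I \<and> A \<notin> I \<and> (\<forall>S\<in>I. \<forall>T\<in>I. S \<union> T \<in> I) \<and> (\<forall>S\<in>I. \<forall>T. T \<subseteq> S \<longrightarrow> T \<in> I)"
      if "I \<in> \<C>" for I
      using subsetD[OF sub that] unfolding \<A>_def by (rule CollectD)
    show "\<Union>\<C> \<in> \<A>"
      unfolding \<A>_def
    proof (intro CollectI conjI ballI allI impI)
      obtain I where "I \<in> \<C>"
        using ne by blast
      moreover have "J \<subseteq> I"
        using mem[OF \<open>I \<in> \<C>\<close>] by simp
      ultimately show "J \<subseteq> \<Union>\<C>"
        by blast
      show "A \<notin> \<Union>\<C>"
        using mem by blast
    next
      fix S T assume "S \<in> \<Union>\<C>" "T \<in> \<Union>\<C>"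
      then obtain I I' where I: "I \<in> \<C>" "I' \<in> \<C>" "S \<in> I" "T \<in> I'" by blast
      then obtain H where H: "H \<in> \<C>" "S \<in> H" "T \<in> H"
        using lin[OF I(1,2)] by blast
      then have "S \<union> T \<in> H"
        using mem[OF H(1)] by simp
      with H(1) show "S \<union> T \<in> \<Union>\<C>"
        by blast
    next
      fix S T assume "S \<in> \<Union>\<C>" "T \<subseteq> S"
      then obtain H where H: "H \<in> \<C>" "S \<in> H" by blast
      then have "T \<in> H"
        using mem[OF H(1)] \<open>T \<subseteq> S\<close> by simp
      with H(1) show "T \<in> \<Union>\<C>"
        by blast
    qed
  qed
  then obtain I where I: "I \<in> \<A>" and "\<forall>H\<in>\<A>. I \<subseteq> H \<longrightarrow> H = I"
    by (rule bexE)
  then have max: "H = I" if "H \<in> \<A>" "I \<subseteq> H" for H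
    using that by simp
  have J_I: "J \<subseteq> I" and A_I: "A \<notin> I" and Un: "\<And>S T. S \<in> I \<Longrightarrow> T \<in> I \<Longrightarrow> S \<union> T \<in> I"
    and sub: "\<And>S T. S \<in> I \<Longrightarrow> T \<subseteq> S \<Longrightarrow> T \<in> I"
    using I unfolding \<A>_def mem_Collect_eq by simp_all
  have prime: "S \<in> I \<or> A - S \<in> I" for S
  proof (rule ccontr)
    assume n: "\<not> (S \<in> I \<or> A - S \<in> I)"
    \<comment> \<open>The ideal generated by \<open>I\<close> and \<open>S\<close>. It can contain
      \<open>A\<close> only if \<open>A - S\<close> is already in \<open>I\<close>.\<close>
    define H where "H = {T. \<exists>R\<in>I. T \<subseteq> R \<union> S}"
    have "{} \<in> I"
      using J_I J(1) by blast
    then have "S \<in> H" and IH: "I \<subseteq> H"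
      unfolding H_def by blast+
    have "A \<notin> H"
    proof
      assume "A \<in> H"
      then obtain R where "R \<in> I" "A - S \<subseteq> R"
        unfolding H_def by blast
      then have "A - S \<in> I"
        by (rule sub)
      with n show False
        by simp
    qed
    moreover have "T \<union> T' \<in> H" if T: "T \<in> H" "T' \<in> H" for T T'
    proof -
      obtain R R' where "R \<in> I" "R' \<in> I" "T \<subseteq> R \<union> S" "T' \<subseteq> R' \<union> S"
        using T unfolding H_def by blast
      then have "R \<union> R' \<in> I" "T \<union> T' \<subseteq> (R \<union> R') \<union> S"
        using Un[of R R'] by auto
      then show ?thesis
        unfolding H_def by blast
    qed
    moreover have "T' \<in> H" if "T \<in> H" "T' \<subseteq> T" for T T'
      using that unfolding H_def by blast
    ultimately have "H \<in> \<A>"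
      unfolding \<A>_def mem_Collect_eq using order_trans[OF J_I IH] by simp
    then have "H = I"
      using IH by (rule max)
    then show False
      using \<open>S \<in> H\<close> n by simp
  qed
  show ?thesis
    by (rule that[OF J_I A_I Un sub prime])
qed

text \<open>Relative to the ambient space: the compact set around a countable subset of
  \<open>U\<close> may leave \<open>U\<close>.\<close>

definition omega_bounded :: "'a topology \<Rightarrow> 'a set \<Rightarrow> bool" where
  "omega_bounded X U \<longleftrightarrow> (\<forall>C. countable C \<and> C \<subseteq> U \<longrightarrow> bounded_subset X C)"

context lc_Hausdorff
begin

text \<open>Let a prime ideal \<open>I\<close> contain the bounded sets but not \<open>A\<close>. In
  each end cover exactly one block meets \<open>A\<close> in a set outside of \<open>I\<close>:
  there is one because, up to the bounded distinguished member, finitely many blocks cover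
  \<open>A\<close>, and only one because \<open>I\<close> is prime. These blocks form a thread
  \<open>e\<close>. It is not a point of \<open>X\<close>, as a singleton is bounded.\<close>

lemma ends_cluster:
  assumes A: "A \<subseteq> topspace X" and nb: "\<not> bounded_subset X A"
  obtains e where "e \<in> ends X" "\<And>W. e \<in> end_nbhd X W \<Longrightarrow> \<not> bounded_subset X (A \<inter> W)"
proof -
  obtain I where I: "Collect (bounded_subset X) \<subseteq> I" "A \<notin> I"
    and Un: "\<And>S T. S \<in> I \<Longrightarrow> T \<in> I \<Longrightarrow> S \<union> T \<in> I" and sub: "\<And>S T. S \<in> I \<Longrightarrow> T \<subseteq> S \<Longrightarrow> T \<in> I"
    and prime: "\<And>S. S \<in> I \<or> A - S \<in> I"
  proof (rule prime_ideal_extension[of "Collect (bounded_subset X)" A])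
    fix S T assume "S \<in> Collect (bounded_subset X)" "T \<subseteq> S"
    then show "T \<in> Collect (bounded_subset X)"
      using bounded_subset_mono[of X S T] by simp
  qed (use nb in simp_all)
  have Inonempty: "{} \<in> I"
    using I(1) by auto
  have FUn: "\<Union>\<F> \<in> I" if "finite \<F>" "\<And>S. S \<in> \<F> \<Longrightarrow> S \<in> I" for \<F>
    using that by (induction \<F> rule: finite_induct) (simp_all add: Inonempty Un)
  have ex: "\<exists>B. B \<in> cover_partition X \<U> \<and> A \<inter> B \<notin> I" if \<U>: "\<U> \<in> end_covers X" for \<U>
  proof (rule ccontr)
    assume "\<nexists>B. B \<in> cover_partition X \<U> \<and> A \<inter> B \<notin> I"
    then have B: "A \<inter> B \<in> I" if "B \<in> cover_partition X \<U>" for B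
      using that by blast
    have V: "A \<inter> X closure_of V \<in> I" if "V \<in> snd \<U>" for V
      by (rule B) (use that in \<open>unfold cover_partition_def, blast\<close>)
    have "finite (snd \<U>)" "bounded_subset X (fst \<U>)"
      using \<U> unfolding end_covers_iff by simp_all
    then have "fst \<U> \<in> I" "\<Union>((\<lambda>V. A \<inter> X closure_of V) ` snd \<U>) \<in> I"
      using I(1) V by (blast, intro FUn) auto
    then have "fst \<U> \<union> \<Union>((\<lambda>V. A \<inter> X closure_of V) ` snd \<U>) \<in> I"
      by (rule Un)
    moreover have "A \<subseteq> fst \<U> \<union> \<Union>((\<lambda>V. A \<inter> X closure_of V) ` snd \<U>)"
      using end_cover_cases[OF \<U>] A by blast
    ultimately have "A \<in> I"
      by (rule sub)
    with I(2) show False ..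
  qed
  have uniq: "B = C" if \<U>: "\<U> \<in> end_covers X" and BC: "B \<in> cover_partition X \<U>" "C \<in> cover_partition X \<U>"
      "A \<inter> B \<notin> I" "A \<inter> C \<notin> I" for \<U> B C
  proof (rule ccontr)
    assume "B \<noteq> C"
    then have "B \<inter> C = {}"
      using cover_partition_unique[OF \<U> BC(1,2)] by blast
    then have "A \<inter> C \<subseteq> A - A \<inter> B" by blast
    moreover have "A - A \<inter> B \<in> I"
      using prime[of "A \<inter> B"] BC(3) by simp
    ultimately have "A \<inter> C \<in> I"
      using sub by simp
    with BC(4) show False ..
  qed
  define e where "e = (\<lambda>\<U>\<in>end_covers X. SOME B. B \<in> cover_partition X \<U> \<and> A \<inter> B \<notin> I)"
  have e: "e \<U> \<in> cover_partition X \<U>" "A \<inter> e \<U> \<notin> I" if "\<U> \<in> end_covers X" for \<U>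
    using someI_ex[OF ex[OF that]] that unfolding e_def by simp_all
  have eF: "e \<in> topspace (freudenthal X)"
    unfolding mem_freudenthal
  proof (intro conjI ballI impI PiE_I)
    fix \<U> \<V> assume *: "\<U> \<in> end_covers X" "\<V> \<in> end_covers X" "cover_le X \<U> \<V>"
    then obtain C where C: "C \<in> cover_partition X \<U>" "e \<V> \<subseteq> C"
      using e(1)[OF *(2)] cover_le_iff[OF *(1,2)] by blast
    then have "A \<inter> C \<notin> I"
      using e(2)[OF *(2)] sub[of "A \<inter> C" "A \<inter> e \<V>"] by blast
    then have "C = e \<U>"
      by (rule uniq[OF *(1) C(1) e(1)[OF *(1)] _ e(2)[OF *(1)]])
    with C(2) show "e \<V> \<subseteq> e \<U>"
      by simp
  qed (use e in \<open>simp_all add: e_def\<close>)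
  have clus: "\<not> bounded_subset X (A \<inter> W)" if "e \<in> end_nbhd X W" for W
  proof
    assume "bounded_subset X (A \<inter> W)"
    then have "A \<inter> W \<in> I"
      using I(1) by blast
    moreover obtain \<U> where \<U>: "\<U> \<in> end_covers X" "e \<U> \<subseteq> W"
      using \<open>e \<in> end_nbhd X W\<close> unfolding end_nbhd_def by blast
    moreover have "A \<inter> e \<U> \<subseteq> A \<inter> W"
      using \<U>(2) by blast
    ultimately have "A \<inter> e \<U> \<in> I"
      using sub by simp
    with e(2)[OF \<U>(1)] show False ..
  qed
  have "e \<in> ends X"
    using eF
  proof (cases rule: freudenthal_point_cases)
    case (2 x)
    then have "e \<in> end_nbhd X {x}"
      using freudenthal_emb_in_end_nbhd[of x "{x}"] by simp
    moreover have "bounded_subset X (A \<inter> {x})"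
      using bounded_subset_mono[OF compactin_imp_bounded_subset[of X "{x}"], of "A \<inter> {x}"] 2 by simp
    ultimately show ?thesis
      using clus by blast
  qed
  then show ?thesis
    using clus by (rule that)
qed

text \<open>The dictionary between ends and sets modulo bounded sets. If \<open>U - W\<close> were
  unbounded, it would cluster at an end; this end does not lie in the exterior of \<open>U\<close>,
  so it lies in \<open>U\<close>, yet it cannot lie in \<open>W\<close>.\<close>

lemma end_nbhd_subset_iff:
  assumes U: "cf_open X U"
  shows "ends X \<inter> end_nbhd X U \<subseteq> end_nbhd X W \<longleftrightarrow> bounded_subset X (U - W)"
proof
  assume le: "ends X \<inter> end_nbhd X U \<subseteq> end_nbhd X W"
  show "bounded_subset X (U - W)"
  proof (rule ccontr)
    assume nb: "\<not> bounded_subset X (U - W)"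
    have "U - W \<subseteq> topspace X"
      using cf_openD(2)[OF U] by blast
    obtain e where e: "e \<in> ends X" "\<And>R. e \<in> end_nbhd X R \<Longrightarrow> \<not> bounded_subset X ((U - W) \<inter> R)"
      by (rule ends_cluster[OF \<open>U - W \<subseteq> topspace X\<close> nb]) (rule that)
    have "(U - W) \<inter> (topspace X - X closure_of U) = {}"
      using closure_of_subset[OF cf_openD(2)[OF U]] by blast
    then have "e \<in> end_nbhd X U"
      using end_cases[OF e(1) U] e(2)[of "topspace X - X closure_of U"] by auto
    then have "e \<in> end_nbhd X W"
      using le e(1) by blast
    then have "\<not> bounded_subset X ((U - W) \<inter> W)"
      by (rule e(2))
    moreover have "(U - W) \<inter> W = {}" by blast
    ultimately show False
      by simp
  qed
next
  assume b: "bounded_subset X (U - W)"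
  show "ends X \<inter> end_nbhd X U \<subseteq> end_nbhd X W"
  proof
    fix e assume e: "e \<in> ends X \<inter> end_nbhd X U"
    then have "e \<in> end_nbhd X (U - (U - W))"
      using end_nbhd_Diff_bounded[OF _ b] by blast
    moreover have "U - (U - W) \<subseteq> W" by blast
    ultimately show "e \<in> end_nbhd X W"
      using end_nbhd_mono by blast
  qed
qed

lemma end_nbhd_empty_iff:
  assumes U: "cf_open X U"
  shows "ends X \<inter> end_nbhd X U = {} \<longleftrightarrow> bounded_subset X U"
  using end_nbhd_subset_iff[OF U, of "{}"] by simp

lemma one_end_dichotomy:
  assumes U: "cf_open X U" and one: "ends X \<inter> end_nbhd X U \<subseteq> {e}" and V: "cf_open X V"
  shows "bounded_subset X (U \<inter> V) \<or> bounded_subset X (U - V)"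
proof (cases "e \<in> end_nbhd X V")
  case True
  then have "ends X \<inter> end_nbhd X U \<subseteq> end_nbhd X V"
    using one by blast
  then show ?thesis
    using end_nbhd_subset_iff[OF U] by blast
next
  case False
  then have "ends X \<inter> end_nbhd X (U \<inter> V) = {}"
    using one end_nbhd_Int by blast
  then show ?thesis
    using end_nbhd_empty_iff[OF cf_open_Int[OF U V]] by blast
qed

lemma freudenthal_emb_inject:
  assumes "x \<in> topspace X" "y \<in> topspace X" "freudenthal_emb X x = freudenthal_emb X y"
  shows "x = y"
proof -
  have "freudenthal_emb X y \<in> end_nbhd X {x}"
    using freudenthal_emb_in_end_nbhd[of x "{x}"] assms by simp
  then show ?thesis
    using freudenthal_emb_end_nbhdD[OF assms(2)] by blast
qed

lemma end_ne_freudenthal_emb: "e \<in> ends X \<Longrightarrow> x \<in> topspace X \<Longrightarrow> freudenthal_emb X x \<noteq> e"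
  unfolding ends_def by blast

text \<open>As \<open>e\<close> is not an accumulation point of the image of \<open>C\<close>, some
  neighbourhood \<open>W\<close> of \<open>e\<close> misses \<open>C\<close>. If \<open>C\<close>
  were unbounded, it would cluster at an end in \<open>U\<close>, that is at \<open>e\<close>, and
  so would meet \<open>W\<close>.\<close>

lemma long_end_imp_omega_bounded:
  assumes e: "long_end X e" and U: "cf_open X U" and one: "ends X \<inter> end_nbhd X U \<subseteq> {e}"
  shows "omega_bounded X U"
  unfolding omega_bounded_def
proof (intro allI impI, elim conjE)
  fix C assume C: "countable C" "C \<subseteq> U"
  have eE: "e \<in> ends X"
    using e unfolding long_end_def by blast
  have CX: "C \<subseteq> topspace X"
    using C(2) cf_openD(2)[OF U] by blast
  have "freudenthal_emb X ` C \<subseteq> topspace (freudenthal X)"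
    by (rule image_subsetI, rule freudenthal_emb_in_topspace) (use CX in blast)
  moreover have "countable (freudenthal_emb X ` C)"
    using C(1) by simp
  ultimately have "e \<notin> freudenthal X derived_set_of (freudenthal_emb X ` C)"
    using e unfolding long_end_def by simp
  then obtain T where T: "e \<in> T" "openin (freudenthal X) T" "\<And>y. y \<noteq> e \<Longrightarrow> y \<in> freudenthal_emb X ` C \<Longrightarrow> y \<notin> T"
    using end_in_topspace[OF eE] unfolding derived_set_of_def by blast
  obtain W where W: "openin X W" "e \<in> end_nbhd X W" "end_nbhd X W \<subseteq> T"
    by (rule freudenthal_base[OF T(2,1)])
  have CW: "C \<inter> W = {}"
  proof (rule equals0I)
    fix x assume x: "x \<in> C \<inter> W"
    then have xX: "x \<in> topspace X" and "x \<in> W"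
      using CX by auto
    then have "freudenthal_emb X x \<in> T"
      using freudenthal_emb_in_end_nbhd[of x W] W(3) by blast
    then show False
      using T(3)[of "freudenthal_emb X x"] end_ne_freudenthal_emb[OF eE xX] x by blast
  qed
  show "bounded_subset X C"
  proof (rule ccontr)
    assume nb: "\<not> bounded_subset X C"
    obtain d where d: "d \<in> ends X" "\<And>R. d \<in> end_nbhd X R \<Longrightarrow> \<not> bounded_subset X (C \<inter> R)"
      by (rule ends_cluster[OF CX nb]) (rule that)
    have "C \<inter> (topspace X - X closure_of U) = {}"
      using closure_of_subset[OF cf_openD(2)[OF U]] C(2) by blast
    then have "d \<in> end_nbhd X U"
      using end_cases[OF d(1) U] d(2)[of "topspace X - X closure_of U"] by auto
    then have "d = e"
      using one d(1) by blast
    then show False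
      using d(2)[of W] W(2) CW by simp
  qed
qed

text \<open>The points of \<open>U\<close> whose images are in the countable set \<open>C\<close>
  lie in a compact set \<open>K\<close>. Then \<open>U - K\<close> still extends to a neighbourhood
  of \<open>e\<close>, and it contains neither these points nor another end.\<close>

lemma omega_bounded_imp_long_end:
  assumes e: "e \<in> ends X" and U: "openin X U" "e \<in> end_nbhd X U"
    and one: "ends X \<inter> end_nbhd X U \<subseteq> {e}" and ob: "omega_bounded X U"
  shows "long_end X e"
  unfolding long_end_def
proof (intro conjI e allI impI notI)
  fix C assume C: "C \<subseteq> topspace (freudenthal X) \<and> countable C" and der: "e \<in> freudenthal X derived_set_of C"
  define D where "D = {x \<in> U. freudenthal_emb X x \<in> C}"
  have UX: "U \<subseteq> topspace X"
    by (rule openin_subset[OF U(1)])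
  have "inj_on (freudenthal_emb X) D"
    by (rule inj_onI, rule freudenthal_emb_inject) (use UX in \<open>auto simp: D_def\<close>)
  moreover have "freudenthal_emb X ` D \<subseteq> C"
    unfolding D_def by blast
  ultimately have "countable D"
    using countable_image_inj_on[of "freudenthal_emb X" D] countable_subset[of "freudenthal_emb X ` D" C] C by simp
  then have "bounded_subset X D"
    using ob unfolding omega_bounded_def by (simp add: D_def)
  then obtain K where K: "compactin X K" "D \<subseteq> K"
    unfolding bounded_subset_def by blast
  have op: "openin X (U - K)"
    using U(1) compactin_imp_closedin[OF haus K(1)] by (rule openin_diff)
  have "e \<in> end_nbhd X (U - K)"
    by (rule end_nbhd_Diff_bounded[OF e compactin_imp_bounded_subset[OF K(1)] U(2)])
  then obtain y where y: "y \<noteq> e" "y \<in> C" "y \<in> end_nbhd X (U - K)"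
    using der openin_end_nbhd[OF op] unfolding derived_set_of_def by blast
  have "y \<in> topspace (freudenthal X)"
    using y(2) C by blast
  then show False
  proof (cases rule: freudenthal_point_cases)
    case 1
    then show False
      using y one end_nbhd_mono[of "U - K" U] by blast
  next
    case (2 x)
    have "freudenthal_emb X x \<in> end_nbhd X (U - K)"
      using y(3) 2(2) by simp
    then have "x \<in> U - K"
      by (rule freudenthal_emb_end_nbhdD[OF 2(1)])
    then show False
      using 2 y(2) K(2) unfolding D_def by blast
  qed
qed

text \<open>Each open set from the countable intersection is shrunk to a set with compact frontier.
  A point of \<open>X\<close> common to all of these would have an image in the intersection
  \<open>{e}\<close>, but \<open>e\<close> is not in the image of \<open>X\<close>.\<close>

lemma short_end_nbhds:
  assumes "short_end X e"
  obtains W :: "nat \<Rightarrow> 'a set" where "\<And>n. cf_open X (W n)" "\<And>n. e \<in> end_nbhd X (W n)"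
    "decseq W" "(\<Inter>n. W n) = {}"
proof -
  have e: "e \<in> ends X" and g: "gdelta_in (freudenthal X) {e}"
    using assms unfolding short_end_def by blast+
  obtain C :: "nat \<Rightarrow> _" where C: "\<And>n. openin (freudenthal X) (C n)" "\<Inter>(range C) = {e}"
    using g unfolding gdelta_in_descending by blast
  have "\<exists>V. cf_open X V \<and> e \<in> end_nbhd X V \<and> end_nbhd X V \<subseteq> C n" for n
  proof -
    have eC: "e \<in> C n"
      using C(2) by blast
    obtain U where U: "e \<in> end_nbhd X U" "end_nbhd X U \<subseteq> C n"
      by (rule freudenthal_base[OF C(1) eC])
    obtain V where V: "cf_open X V" "e \<in> end_nbhd X V" "X closure_of V \<subseteq> U"
      by (rule end_cf_base[OF e U(1)])
    have "V \<subseteq> U"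
      using V(3) closure_of_subset[OF cf_openD(2)[OF V(1)]] by blast
    then have "end_nbhd X V \<subseteq> C n"
      using U(2) end_nbhd_mono[of V U X] by blast
    with V(1,2) show ?thesis by blast
  qed
  then obtain V where V: "\<And>n. cf_open X (V n)" "\<And>n. e \<in> end_nbhd X (V n)" "\<And>n. end_nbhd X (V n) \<subseteq> C n"
    by metis
  define W where "W n = (\<Inter>k\<le>n. V k)" for n :: nat
  have W_Suc: "W (Suc n) = V (Suc n) \<inter> W n" for n
    unfolding W_def by (simp add: atMost_Suc)
  have 1: "cf_open X (W n) \<and> e \<in> end_nbhd X (W n)" for n
  proof (induction n)
    case 0
    then show ?case
      using V(1,2) by (simp add: W_def)
  next
    case (Suc n)
    then show ?case
      unfolding W_Suc end_nbhd_Int using V(1,2) by (simp add: cf_open_Int)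
  qed
  have 2: "decseq W"
    by (rule decseq_SucI) (simp add: W_Suc)
  have 3: "(\<Inter>n. W n) = {}"
  proof (rule equals0I)
    fix x assume "x \<in> (\<Inter>n. W n)"
    then have x: "x \<in> V n" for n
      unfolding W_def by blast
    have xX: "x \<in> topspace X"
      using x[of 0] cf_openD(2)[OF V(1)[of 0]] by blast
    have "freudenthal_emb X x \<in> C n" for n
      using freudenthal_emb_in_end_nbhd[OF xX x[of n]] V(3)[of n] by blast
    then have "freudenthal_emb X x = e"
      using C(2) by blast
    then show False
      using end_ne_freudenthal_emb[OF e xX] by blast
  qed
  show ?thesis
    by (rule that[OF _ _ 2 3]) (use 1 in simp_all)
qed

lemma short_endI:
  assumes e: "e \<in> ends X" and \<W>: "countable \<W>" "\<W> \<noteq> {}" "\<And>W. W \<in> \<W> \<Longrightarrow> openin X W" "\<And>W. W \<in> \<W> \<Longrightarrow> e \<in> end_nbhd X W"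
    and "\<Inter>\<W> = {}"
    and one: "\<And>d. d \<in> ends X \<Longrightarrow> d \<noteq> e \<Longrightarrow> \<exists>W\<in>\<W>. d \<notin> end_nbhd X W"
  shows "short_end X e"
  unfolding short_end_def
proof (rule conjI[OF e])
  have "gdelta_in (freudenthal X) (\<Inter>(end_nbhd X ` \<W>))"
    by (rule gdelta_in_Inter) (use \<W>(1,2) in \<open>auto intro!: open_imp_gdelta_in openin_end_nbhd \<W>(3)\<close>)
  moreover have "\<Inter>(end_nbhd X ` \<W>) = {e}"
  proof
    show "{e} \<subseteq> \<Inter>(end_nbhd X ` \<W>)"
      using \<W>(4) by blast
    show "\<Inter>(end_nbhd X ` \<W>) \<subseteq> {e}"
    proof
      fix d assume d: "d \<in> \<Inter>(end_nbhd X ` \<W>)"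
      obtain W where "W \<in> \<W>"
        using \<W>(2) by blast
      then have "d \<in> topspace (freudenthal X)"
        using d end_nbhd_subset[of X W] by blast
      then show "d \<in> {e}"
      proof (cases rule: freudenthal_point_cases)
        case 1
        then show ?thesis
          using one[OF 1] d by blast
      next
        case (2 x)
        then have "x \<in> W" if "W \<in> \<W>" for W
          using d that freudenthal_emb_end_nbhdD[OF 2(1), of W] by blast
        then show ?thesis
          using \<open>\<Inter>\<W> = {}\<close> by blast
      qed
    qed
  qed
  ultimately show "gdelta_in (freudenthal X) {e}"
    by simp
qed

text \<open>Removing from \<open>A\<close> the n-th neighbourhood of each of its finitely many ends
  leaves no end, hence a bounded set. These neighbourhoods shrink to nothing, so the bounded sets
  exhaust \<open>A\<close>.\<close>

lemma short_ends_sigma_compact: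
  assumes A: "cf_open X A" and fin: "finite (ends X \<inter> end_nbhd X A)"
    and sh: "\<And>e. e \<in> ends X \<inter> end_nbhd X A \<Longrightarrow> short_end X e"
  obtains B :: "nat \<Rightarrow> 'a set" where "\<And>n. bounded_subset X (B n)" "A = (\<Union>n. B n)"
proof -
  let ?E = "ends X \<inter> end_nbhd X A"
  have "\<exists>W :: nat \<Rightarrow> 'a set. (\<forall>n. d \<in> end_nbhd X (W n)) \<and> decseq W \<and> (\<Inter>n. W n) = {}" if d: "d \<in> ?E" for d
    by (rule short_end_nbhds[OF sh[OF d]]) blast
  then obtain W :: "_ \<Rightarrow> nat \<Rightarrow> 'a set" where W: "\<And>d n. d \<in> ?E \<Longrightarrow> d \<in> end_nbhd X (W d n)"
    "\<And>d. d \<in> ?E \<Longrightarrow> decseq (W d)" "\<And>d. d \<in> ?E \<Longrightarrow> (\<Inter>n. W d n) = {}"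
    by metis
  define B where "B n = A - (\<Union>d\<in>?E. W d n)" for n
  have bdd: "bounded_subset X (B n)" for n
    unfolding B_def
  proof (rule iffD1[OF end_nbhd_subset_iff[OF A]], rule subsetI)
    fix d assume d: "d \<in> ?E"
    then show "d \<in> end_nbhd X (\<Union>d\<in>?E. W d n)"
      using W(1)[OF d, of n] end_nbhd_mono[of "W d n" "\<Union>d\<in>?E. W d n"] by blast
  qed
  moreover have "A = (\<Union>n. B n)"
  proof
    show "A \<subseteq> (\<Union>n. B n)"
    proof
      fix x assume x: "x \<in> A"
      have "\<exists>n. x \<notin> W d n" if "d \<in> ?E" for d
        using W(3)[OF that] by blast
      then obtain m where m: "\<And>d. d \<in> ?E \<Longrightarrow> x \<notin> W d (m d)"
        by metis
      \<comment> \<open>The sequences \<open>W d\<close> decrease, so the largest index serves all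
        ends at once; the 0 covers the case without ends.\<close>
      define N where "N = Max (insert 0 (m ` ?E))"
      have "x \<notin> W d N" if d: "d \<in> ?E" for d
      proof -
        have "m d \<le> N"
          unfolding N_def by (rule Max_ge) (use fin d in auto)
        then show ?thesis
          using m[OF d] W(2)[OF d] unfolding decseq_def by blast
      qed
      then show "x \<in> (\<Union>n. B n)"
        using x unfolding B_def by blast
    qed
  qed (auto simp: B_def)
  ultimately show ?thesis
    by (rule that)
qed

end

section \<open>Euclidean spaces\<close>

lemma second_countable_Euclidean_space: "second_countable (Euclidean_space n)"
proof -
  obtain B :: "(nat \<Rightarrow> real) set set" where B: "countable B" "topological_basis B"
    using ex_countable_basis by blast
  have "second_countable (euclidean :: (nat \<Rightarrow> real) topology)"
    unfolding second_countable_def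
  proof (intro exI conjI allI impI ballI)
    show "countable B" by (rule B)
    show "openin euclidean V" if "V \<in> B" for V
      using that B(2) by (simp add: topological_basis_open)
    show "\<exists>V\<in>B. x \<in> V \<and> V \<subseteq> U" if "openin euclidean U \<and> x \<in> U" for U x
      using that B(2) topological_basisE[of B U x] by (metis open_openin)
  qed
  then show ?thesis
    unfolding Euclidean_space_def euclidean_product_topology by (rule second_countable_subtopology)
qed

text \<open>A scaled arctangent in each coordinate squeezes the whole space into a box around
  \<open>x\<close>. Openness of the image and continuity of the inverse come from invariance of
  domain.\<close>

lemma Euclidean_space_inner_copy:
  assumes U: "openin (Euclidean_space n) U" and x: "x \<in> U"
  obtains V where "openin (Euclidean_space n) V" "x \<in> V" "V \<subseteq> U"
    "subtopology (Euclidean_space n) V homeomorphic_space Euclidean_space n"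
proof -
  have xE: "x \<in> topspace (Euclidean_space n)"
    using openin_subset[OF U] x by blast
  then have x0: "x i = 0" if "i \<ge> n" for i
    using that by (simp add: topspace_Euclidean_space)
  obtain W where W: "openin (powertop_real UNIV) W" "U = W \<inter> {x. \<forall>i\<ge>n. x i = 0}"
    using U unfolding Euclidean_space_def openin_subtopology by (elim exE conjE)
  have "x \<in> W"
    using W(2) x by blast
  with W(1)[unfolded openin_product_topology_alt] have
    "\<exists>Z. finite {i \<in> UNIV. Z i \<noteq> topspace euclideanreal} \<and> (\<forall>i\<in>UNIV. openin euclideanreal (Z i)) \<and>
       x \<in> Pi\<^sub>E UNIV Z \<and> Pi\<^sub>E UNIV Z \<subseteq> W"
    by (rule bspec)
  then obtain Z where Z: "\<And>i. open (Z i)" "x \<in> Pi\<^sub>E UNIV Z" "Pi\<^sub>E UNIV Z \<subseteq> W"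
    by auto
  have "\<exists>d>0. \<forall>y. \<bar>y - x i\<bar> < d \<longrightarrow> y \<in> Z i" for i
  proof -
    have "x i \<in> Z i"
      using PiE_mem[OF Z(2), of i] by simp
    then obtain d where "d > 0" "ball (x i) d \<subseteq> Z i"
      using Z(1)[of i] open_contains_ball by blast
    then show ?thesis
      by (intro exI[of _ d]) (auto simp: subset_iff dist_real_def abs_minus_commute)
  qed
  then obtain d where d: "\<And>i. d i > 0" "\<And>i y. \<bar>y - x i\<bar> < d i \<Longrightarrow> y \<in> Z i"
    by metis
  \<comment> \<open>Absolute values of \<open>arctan\<close> stay below pi, so coordinate
    \<open>i\<close> moves by less than \<open>d i\<close>; the origin is sent to \<open>x\<close>,
    and coordinates from \<open>n\<close> on remain 0.\<close>
  define f where "f = (\<lambda>z i. if i < n then x i + d i / pi * arctan (z i) else 0 :: real)"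
  have cont: "continuous_map (Euclidean_space n) (Euclidean_space n) f"
    unfolding f_def continuous_map_componentwise_Euclidean_space
  proof (intro allI impI)
    fix i assume "i < n"
    have "continuous_map (Euclidean_space n) euclideanreal (\<lambda>z. z i)"
      unfolding Euclidean_space_def
      by (intro continuous_map_from_subtopology continuous_map_product_projection) simp
    then have "continuous_map (Euclidean_space n) euclideanreal (arctan \<circ> (\<lambda>z. z i))"
      by (rule continuous_map_compose) (auto intro: continuous_intros)
    then have "continuous_map (Euclidean_space n) euclideanreal (\<lambda>z. arctan (z i))"
      by (simp add: o_def)
    then show "continuous_map (Euclidean_space n) euclideanreal (\<lambda>z. x i + d i / pi * arctan (z i))"
      by (intro continuous_intros)
  qed
  have inj: "inj_on f (topspace (Euclidean_space n))"
  proof (rule inj_onI)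
    fix y z assume y: "y \<in> topspace (Euclidean_space n)" and z: "z \<in> topspace (Euclidean_space n)" and eq: "f y = f z"
    show "y = z"
    proof
      fix i
      show "y i = z i"
      proof (cases "i < n")
        case True
        then have "x i + d i / pi * arctan (y i) = x i + d i / pi * arctan (z i)"
          using fun_cong[OF eq, of i] by (simp add: f_def)
        then have "arctan (y i) = arctan (z i)"
          using d(1)[of i] by simp
        then show ?thesis
          by (simp add: arctan_eq_iff)
      next
        case False
        then show ?thesis
          using y z by (simp add: topspace_Euclidean_space)
      qed
    qed
  qed
  let ?V = "f ` topspace (Euclidean_space n)"
  have emb: "embedding_map (Euclidean_space n) (Euclidean_space n) f"
    using invariance_of_domain_Euclidean_space_embedding_map[of n "topspace (Euclidean_space n)" f] cont inj
    by simp
  show ?thesis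
  proof (rule that[of ?V])
    show "openin (Euclidean_space n) ?V"
      using invariance_of_domain_Euclidean_space[of n "topspace (Euclidean_space n)" f] cont inj by simp
    have "f (\<lambda>i. 0) = x"
      unfolding f_def using x0 by (auto simp: fun_eq_iff)
    then show "x \<in> ?V"
      by (intro image_eqI[of _ _ "\<lambda>i. 0"]) (simp_all add: topspace_Euclidean_space)
    show "?V \<subseteq> U"
    proof
      fix v assume "v \<in> ?V"
      then obtain z where z: "v = f z" by blast
      have "v i \<in> Z i" for i
      proof (cases "i < n")
        case True
        have "\<bar>arctan (z i)\<bar> < pi"
          using arctan_bounded[of "z i"] pi_gt_zero by linarith
        then have "d i / pi * \<bar>arctan (z i)\<bar> < d i / pi * pi"
          using d(1)[of i] by (intro mult_strict_left_mono) auto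
        then have "\<bar>d i / pi * arctan (z i)\<bar> < d i"
          using d(1)[of i] by (simp add: abs_mult)
        then show ?thesis
          using True by (intro d(2)) (simp add: z f_def)
      next
        case False
        then show ?thesis
          using d(1)[of i] x0[of i] by (intro d(2)) (simp add: z f_def)
      qed
      then have "v \<in> Pi\<^sub>E UNIV Z"
        by (simp add: PiE_iff)
      moreover have "\<forall>i\<ge>n. v i = 0"
        by (simp add: z f_def)
      ultimately show "v \<in> U"
        using W(2) Z(3) by blast
    qed
    show "subtopology (Euclidean_space n) ?V homeomorphic_space Euclidean_space n"
      using emb homeomorphic_map_imp_homeomorphic_space homeomorphic_space_sym
      unfolding embedding_map_def by blast
  qed
qed

text \<open>Every map to the punctured plane lifts through the squaring map, that is, the double
  covers pulled back from the punctured plane are trivial.\<close>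

definition has_sqrts :: "'a topology \<Rightarrow> bool" where
  "has_sqrts X \<longleftrightarrow> (\<forall>f. continuous_map X euclidean f \<and> (\<forall>x\<in>topspace X. f x \<noteq> (0::complex)) \<longrightarrow>
     (\<exists>g. continuous_map X euclidean g \<and> (\<forall>x\<in>topspace X. (g x)\<^sup>2 = f x)))"

lemma has_sqrts_homeomorphic:
  assumes "X homeomorphic_space Y" and Y: "has_sqrts Y" shows "has_sqrts X"
  unfolding has_sqrts_def
proof (intro allI impI, elim conjE)
  fix f assume f: "continuous_map X euclidean f" "\<forall>x\<in>topspace X. f x \<noteq> (0::complex)"
  obtain h k where hk: "homeomorphic_maps X Y h k"
    using assms(1) unfolding homeomorphic_space_def by blast
  then have h: "continuous_map X Y h" and k: "continuous_map Y X k" and kh: "\<And>x. x \<in> topspace X \<Longrightarrow> k (h x) = x"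
    unfolding homeomorphic_maps_def by blast+
  have "continuous_map Y euclidean (f \<circ> k)"
    using k f(1) by (rule continuous_map_compose)
  moreover have "\<forall>y\<in>topspace Y. (f \<circ> k) y \<noteq> 0"
    using f(2) continuous_map_funspace[OF k] by auto
  ultimately obtain g where g: "continuous_map Y euclidean g" "\<forall>y\<in>topspace Y. (g y)\<^sup>2 = (f \<circ> k) y"
    using Y unfolding has_sqrts_def by blast
  have "continuous_map X euclidean (g \<circ> h)"
    using h g(1) by (rule continuous_map_compose)
  moreover have "((g \<circ> h) x)\<^sup>2 = f x" if "x \<in> topspace X" for x
    using bspec[OF g(2) funcset_mem[OF continuous_map_funspace[OF h] that]] kh[OF that] by simp
  ultimately show "\<exists>g. continuous_map X euclidean g \<and> (\<forall>x\<in>topspace X. (g x)\<^sup>2 = f x)"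
    by blast
qed

text \<open>
  The library has square roots only on contractible subsets of normed spaces, so that
  \<^term>\<open>Euclidean_space n\<close> is first identified with a subspace of the Banach space of bounded
  sequences.
\<close>

lemma has_sqrts_Euclidean_space: "has_sqrts (Euclidean_space n)"
  unfolding has_sqrts_def
proof (intro allI impI, elim conjE)
  fix f assume f: "continuous_map (Euclidean_space n) euclidean f" "\<forall>x\<in>topspace (Euclidean_space n). f x \<noteq> (0::complex)"
  define S where "S = {b :: nat \<Rightarrow>\<^sub>C real. \<forall>i\<ge>n. apply_bcontfun b i = 0}"
  define \<delta> where "\<delta> i = Bcontfun (\<lambda>j::nat. if j = i then 1 else 0 :: real)" for i
  have \<delta>: "apply_bcontfun (\<delta> i) j = (if j = i then 1 else 0)" for i j
  proof -
    have "(\<lambda>j::nat. if j = i then 1 else 0 :: real) \<in> bcontfun"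
      by (rule bcontfun_normI[of _ 1]) auto
    then show ?thesis
      unfolding \<delta>_def by (simp add: Bcontfun_inverse)
  qed
  have "convex S"
    unfolding S_def convex_def by simp
  then have contr: "contractible S"
    by (rule convex_imp_contractible)
  have eval: "continuous_on S (\<lambda>b. apply_bcontfun b i)" for i
    unfolding continuous_on_iff by (metis dist_bounded order_le_less_trans)
  have h: "continuous_map (top_of_set S) (Euclidean_space n) apply_bcontfun"
    unfolding Euclidean_space_def continuous_map_in_subtopology continuous_map_componentwise_UNIV
    using eval by (auto simp: S_def)
  have "continuous_on S (f \<circ> apply_bcontfun)"
    using continuous_map_compose[OF h f(1)] by simp
  moreover have "(f \<circ> apply_bcontfun) b \<noteq> 0" if "b \<in> S" for b
    using that f(2) by (simp add: S_def topspace_Euclidean_space)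
  ultimately obtain g where g: "continuous_on S g" "\<And>b. b \<in> S \<Longrightarrow> (f \<circ> apply_bcontfun) b = (g b)\<^sup>2"
    using continuous_sqrt_on_contractible[OF _ contr] by blast
  define k where "k x = (\<Sum>i<n. x i *\<^sub>R \<delta> i)" for x
  have kj: "apply_bcontfun (k x) j = (if j < n then x j else 0)" for x j
  proof -
    have "apply_bcontfun (\<Sum>i\<in>I. x i *\<^sub>R \<delta> i) j = (\<Sum>i\<in>I. x i * apply_bcontfun (\<delta> i) j)" if "finite I" for I
      using that by (induction I rule: finite_induct) auto
    then have "apply_bcontfun (k x) j = (\<Sum>i<n. x i * (if j = i then 1 else 0))"
      unfolding k_def by (simp add: \<delta>)
    also have "\<dots> = (\<Sum>i<n. if j = i then x i else 0)"
      by (intro sum.cong) auto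
    finally show ?thesis
      by simp
  qed
  have kS: "k x \<in> S" for x
    unfolding S_def by (simp add: kj)
  have proj: "continuous_map (Euclidean_space n) euclidean (\<lambda>x. x i *\<^sub>R \<delta> i)" for i
  proof -
    have "continuous_map (Euclidean_space n) euclideanreal (\<lambda>z. z i)"
      unfolding Euclidean_space_def
      by (intro continuous_map_from_subtopology continuous_map_product_projection) simp
    then have "continuous_map (Euclidean_space n) euclidean ((\<lambda>t. t *\<^sub>R \<delta> i) \<circ> (\<lambda>z. z i))"
      by (rule continuous_map_compose) (auto intro!: continuous_intros)
    then show ?thesis
      by (simp add: o_def)
  qed
  have "continuous_map (Euclidean_space n) euclidean k"
    unfolding k_def using proj by (intro continuous_map_sum) auto
  then have k: "continuous_map (Euclidean_space n) (top_of_set S) k"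
    using kS by (simp add: continuous_map_in_subtopology image_subset_iff)
  show "\<exists>g. continuous_map (Euclidean_space n) euclidean g \<and> (\<forall>x\<in>topspace (Euclidean_space n). (g x)\<^sup>2 = f x)"
  proof (intro exI conjI ballI)
    show "continuous_map (Euclidean_space n) euclidean (g \<circ> k)"
      using continuous_map_compose[OF k, of euclidean g] g(1) by simp
    fix x assume x: "x \<in> topspace (Euclidean_space n)"
    then have "apply_bcontfun (k x) = x"
      by (auto simp: kj fun_eq_iff topspace_Euclidean_space)
    then show "((g \<circ> k) x)\<^sup>2 = f x"
      using g(2)[OF kS, of x] by simp
  qed
qed

text \<open>The transition from a chart of \<open>T\<close> to a chart of \<open>M\<close> is an
  injective continuous map from an open subset of Euclidean space into Euclidean space of the same
  dimension, so invariance of domain applies.\<close>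

lemma openin_if_manifold_of_same_dim:
  assumes M: "manifold_of_dim n M" and T: "manifold_of_dim n (subtopology M T)" "T \<subseteq> topspace M"
  shows "openin M T"
proof (subst openin_subopen, intro ballI)
  fix p assume p: "p \<in> T"
  obtain W where W: "openin M W" "p \<in> W" "subtopology M W homeomorphic_space Euclidean_space n"
    using M p T(2) unfolding manifold_of_dim_def by blast
  obtain V where V: "openin (subtopology M T) V" "p \<in> V"
      "subtopology (subtopology M T) V homeomorphic_space Euclidean_space n"
    using T p unfolding manifold_of_dim_def by auto
  have VT: "V \<subseteq> T"
    using openin_subset[OF V(1)] by auto
  then have "subtopology (subtopology M T) V = subtopology M V"
    by (simp add: subtopology_subtopology inf_absorb2)
  then obtain \<psi> \<psi>' where psi: "homeomorphic_maps (subtopology M V) (Euclidean_space n) \<psi> \<psi>'"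
    using V(3) unfolding homeomorphic_space_def by auto
  obtain \<phi> \<phi>' where phi: "homeomorphic_maps (subtopology M W) (Euclidean_space n) \<phi> \<phi>'"
    using W(3) unfolding homeomorphic_space_def by auto
  have tV: "topspace (subtopology M V) = V" and tW: "topspace (subtopology M W) = W"
    using VT T(2) openin_subset[OF W(1)] by auto
  have VW: "openin (subtopology M V) (V \<inter> W)"
    using W(1) by (simp add: openin_subtopology_Int2)
  let ?U = "\<psi> ` (V \<inter> W)"
  have hm: "homeomorphic_map (subtopology M V) (Euclidean_space n) \<psi>" "homeomorphic_map (subtopology M W) (Euclidean_space n) \<phi>"
    using psi phi homeomorphic_maps_map by blast+
  have U: "openin (Euclidean_space n) ?U"
    using homeomorphic_map_openness_eq[OF hm(1)] VW by blast
  have psi': "\<psi>' (\<psi> x) = x" if "x \<in> V" for x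
    using psi that tV unfolding homeomorphic_maps_def by blast
  have psiU: "\<psi>' ` ?U = V \<inter> W"
    using psi' by force
  have "continuous_map (Euclidean_space n) (subtopology M V) \<psi>'"
    using psi unfolding homeomorphic_maps_def by blast
  then have "continuous_map (subtopology (Euclidean_space n) ?U) M \<psi>'"
    by (intro continuous_map_from_subtopology) (simp add: continuous_map_in_subtopology)
  then have c1: "continuous_map (subtopology (Euclidean_space n) ?U) (subtopology M W) \<psi>'"
    unfolding continuous_map_in_subtopology using psiU openin_subset[OF U] by (auto simp: image_subset_iff)
  have "continuous_map (subtopology M W) (Euclidean_space n) \<phi>"
    using phi unfolding homeomorphic_maps_def by blast
  with c1 have c2: "continuous_map (subtopology (Euclidean_space n) ?U) (Euclidean_space n) (\<phi> \<circ> \<psi>')"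
    by (rule continuous_map_compose)
  have "inj_on \<phi> W"
    using homeomorphic_imp_injective_map[OF hm(2)] tW by simp
  moreover have "inj_on \<psi>' ?U"
    using psi' by (intro inj_onI) auto
  ultimately have "inj_on (\<phi> \<circ> \<psi>') ?U"
    using psiU by (intro comp_inj_on) (auto intro: inj_on_subset)
  then have "openin (Euclidean_space n) ((\<phi> \<circ> \<psi>') ` ?U)"
    by (rule invariance_of_domain_Euclidean_space[OF U c2])
  then have "openin (Euclidean_space n) (\<phi> ` (V \<inter> W))"
    unfolding image_comp[symmetric] psiU .
  then have "openin (subtopology M W) (V \<inter> W)"
    using homeomorphic_map_openness[OF hm(2), of "V \<inter> W"] tW by blast
  then have "openin M (V \<inter> W)"
    using W(1) openin_trans_full by blast
  then show "\<exists>U. openin M U \<and> p \<in> U \<and> U \<subseteq> T"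
    using V(2) W(2) VT by blast
qed

section \<open>Lindelof subsets of manifolds\<close>

definition Lindelof_in :: "'a topology \<Rightarrow> 'a set \<Rightarrow> bool" where
  "Lindelof_in X S \<longleftrightarrow> S \<subseteq> topspace X \<and> Lindelof_space (subtopology X S)"

lemma Lindelof_in_Union:
  "countable \<F> \<Longrightarrow> (\<And>S. S \<in> \<F> \<Longrightarrow> Lindelof_in X S) \<Longrightarrow> Lindelof_in X (\<Union>\<F>)"
  unfolding Lindelof_in_def by (auto intro: Lindelof_space_Union)

lemma Lindelof_in_UN:
  assumes "countable I" "\<And>i. i \<in> I \<Longrightarrow> Lindelof_in X (S i)" shows "Lindelof_in X (\<Union>i\<in>I. S i)"
  by (rule Lindelof_in_Union) (use assms in auto)

lemma Lindelof_in_Un: "Lindelof_in X S \<Longrightarrow> Lindelof_in X T \<Longrightarrow> Lindelof_in X (S \<union> T)"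
  using Lindelof_in_Union[of "{S,T}"] by auto

lemma compactin_imp_Lindelof_in: "compactin X K \<Longrightarrow> Lindelof_in X K"
  unfolding Lindelof_in_def
  by (simp add: compact_imp_Lindelof_space compact_space_subtopology compactin_subset_topspace)

lemma connectedin_subset_openin:
  assumes "connectedin X D" "openin X U" "D \<inter> U \<noteq> {}" "D \<inter> (X closure_of U - U) = {}"
  shows "D \<subseteq> U"
proof (rule ccontr)
  assume "\<not> D \<subseteq> U"
  then have "D \<inter> X frontier_of U \<noteq> {}"
    using connectedin_Int_frontier_of[OF assms(1,3)] by blast
  moreover have "X frontier_of U = X closure_of U - U"
    using assms(2) by (simp add: frontier_of_def interior_of_openin)
  ultimately show False
    using assms(4) by simp
qed

text \<open>Every member contains a point of a countable dense subset of \<open>G\<close>, and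
  disjoint members contain different ones.\<close>

lemma countable_disjoint_openin:
  assumes G: "openin X G" "second_countable (subtopology X G)"
    and op: "\<And>Y. Y \<in> \<Y> \<Longrightarrow> openin X Y" and disj: "\<And>Y Z. Y \<in> \<Y> \<Longrightarrow> Z \<in> \<Y> \<Longrightarrow> Y \<noteq> Z \<Longrightarrow> Y \<inter> Z = {}"
    and meet: "\<And>Y. Y \<in> \<Y> \<Longrightarrow> Y \<inter> G \<noteq> {}"
  shows "countable \<Y>"
proof -
  have "separable_space (subtopology X G)"
    by (rule second_countable_imp_separable_space[OF G(2)])
  then obtain C where C: "countable C" "C \<subseteq> G" "G \<subseteq> X closure_of C"
    unfolding separable_space_def by (auto simp: closure_of_subtopology openin_subset[OF G(1)] inf_absorb2)
  have "\<exists>c\<in>C. c \<in> Y" if Y: "Y \<in> \<Y>" for Y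
  proof -
    have "openin X (Y \<inter> G)"
      using op[OF Y] G(1) by (rule openin_Int)
    moreover obtain y where "y \<in> Y \<inter> G"
      using meet[OF Y] by blast
    moreover have "y \<in> X closure_of C"
      using C(3) \<open>y \<in> Y \<inter> G\<close> by blast
    ultimately show ?thesis
      unfolding in_closure_of by blast
  qed
  then obtain c where c: "\<And>Y. Y \<in> \<Y> \<Longrightarrow> c Y \<in> C" "\<And>Y. Y \<in> \<Y> \<Longrightarrow> c Y \<in> Y"
    by metis
  have "inj_on c \<Y>"
  proof (rule inj_onI, rule ccontr)
    fix Y Z assume YZ: "Y \<in> \<Y>" "Z \<in> \<Y>" "c Y = c Z" "Y \<noteq> Z"
    then have "c Y \<in> Y \<inter> Z"
      using c(2)[OF YZ(1)] c(2)[OF YZ(2)] by simp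
    with disj[OF YZ(1,2,4)] show False by simp
  qed
  moreover have "c ` \<Y> \<subseteq> C"
    using c(1) by blast
  ultimately show ?thesis
    using C(1) countable_image_inj_on[of c \<Y>] countable_subset[of "c ` \<Y>" C] by simp
qed

text \<open>By disjointness, a member that meets \<open>K\<close> must itself occur in every
  subcover of \<open>K\<close>.\<close>

lemma finite_disjoint_openin_compactin:
  assumes K: "compactin X K" "K \<subseteq> \<Union>\<Y>"
    and op: "\<And>Y. Y \<in> \<Y> \<Longrightarrow> openin X Y" and disj: "\<And>Y Z. Y \<in> \<Y> \<Longrightarrow> Z \<in> \<Y> \<Longrightarrow> Y \<noteq> Z \<Longrightarrow> Y \<inter> Z = {}"
  shows "finite {Y \<in> \<Y>. Y \<inter> K \<noteq> {}}"
proof -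
  obtain \<F> where F: "finite \<F>" "\<F> \<subseteq> \<Y>" "K \<subseteq> \<Union>\<F>"
    using K op unfolding compactin_def by meson
  have "{Y \<in> \<Y>. Y \<inter> K \<noteq> {}} \<subseteq> \<F>"
  proof
    fix Y assume Y: "Y \<in> {Y \<in> \<Y>. Y \<inter> K \<noteq> {}}"
    then obtain y Z where "y \<in> Y" "Z \<in> \<F>" "y \<in> Z"
      using F(3) by blast
    then have "Y = Z"
      using disj[of Y Z] Y F(2) by blast
    with \<open>Z \<in> \<F>\<close> show "Y \<in> \<F>" by simp
  qed
  then show ?thesis
    using F(1) finite_subset by blast
qed

lemma second_countable_Union_openin:
  assumes "countable \<W>" "\<And>W. W \<in> \<W> \<Longrightarrow> openin X W" "\<And>W. W \<in> \<W> \<Longrightarrow> second_countable (subtopology X W)"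
  shows "second_countable (subtopology X (\<Union>\<W>))"
proof -
  have "\<forall>W\<in>\<W>. \<exists>\<B>. countable \<B> \<and> (\<forall>V\<in>\<B>. openin (subtopology X W) V) \<and>
      (\<forall>U x. openin (subtopology X W) U \<and> x \<in> U \<longrightarrow> (\<exists>V\<in>\<B>. x \<in> V \<and> V \<subseteq> U))"
    using assms(3) unfolding second_countable_def by blast
  then obtain \<B> where B: "\<And>W. W \<in> \<W> \<Longrightarrow> countable (\<B> W)"
    "\<And>W V. W \<in> \<W> \<Longrightarrow> V \<in> \<B> W \<Longrightarrow> openin (subtopology X W) V"
    "\<And>W U x. W \<in> \<W> \<Longrightarrow> openin (subtopology X W) U \<Longrightarrow> x \<in> U \<Longrightarrow> (\<exists>V\<in>\<B> W. x \<in> V \<and> V \<subseteq> U)"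
    by metis
  show ?thesis
    unfolding second_countable_def
  proof (intro exI conjI ballI allI impI)
    show "countable (\<Union>W\<in>\<W>. \<B> W)"
      using assms(1) B(1) by blast
    fix V assume "V \<in> (\<Union>W\<in>\<W>. \<B> W)"
    then obtain W where W: "W \<in> \<W>" "V \<in> \<B> W" by blast
    then have "openin X V" "V \<subseteq> W"
      using B(2)[OF W] assms(2)[OF W(1)] openin_trans_full openin_subset by (blast, fastforce)
    then show "openin (subtopology X (\<Union>\<W>)) V"
      using W(1) by (intro subset_openin_subtopology) auto
  next
    fix U x assume "openin (subtopology X (\<Union>\<W>)) U \<and> x \<in> U"
    then obtain U' where U: "openin X U'" "U = U' \<inter> \<Union>\<W>" "x \<in> U"
      unfolding openin_subtopology by blast
    then obtain W where W: "W \<in> \<W>" "x \<in> W" by blast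
    have "openin (subtopology X W) (W \<inter> U')"
      using U(1) by (simp add: openin_subtopology_Int2)
    then obtain V where V: "V \<in> \<B> W" "x \<in> V" "V \<subseteq> W \<inter> U'"
      using B(3)[OF W(1), of "W \<inter> U'" x] W(2) U by blast
    then show "\<exists>V\<in>\<Union>W\<in>\<W>. \<B> W. x \<in> V \<and> V \<subseteq> U"
      using W(1) U(2) by blast
  qed
qed

text \<open>Regularity of a successor cardinal, in the form of \<open>cardSuc_UNION\<close> for the
  increasing family of initial segments.\<close>

lemma countable_bounded_omega1:
  assumes "countable I" "I \<subseteq> Field omega1"
  obtains \<beta> where "\<beta> \<in> Field omega1" "\<And>i. i \<in> I \<Longrightarrow> (i, \<beta>) \<in> omega1 \<and> i \<noteq> \<beta>"
proof -
  have co: "Card_order natLeq" and inf: "\<not> finite (Field natLeq)"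
    by (rule natLeq_Card_order, simp add: Field_natLeq)
  have wo: "Well_order omega1"
    unfolding omega1_def by (rule cardSuc_Well_order[OF co])
  then have tr: "trans omega1" and rf: "refl_on (Field omega1) omega1" and as: "antisym omega1"
    unfolding order_on_defs by blast+
  define As where "As i = {j. (j, i) \<in> omega1}" for i
  have "relChain (cardSuc natLeq) As"
    unfolding relChain_def As_def omega1_def[symmetric] using tr by (auto dest: transD)
  moreover have "I \<subseteq> (\<Union>i\<in>Field (cardSuc natLeq). As i)"
    unfolding As_def omega1_def[symmetric] using assms(2) rf by (auto simp: refl_on_def)
  moreover have "|I| \<le>o natLeq"
  proof -
    obtain f :: "_ \<Rightarrow> nat" where "inj_on f I"
      using assms(1) unfolding countable_def by blast
    then have "|I| \<le>o |UNIV :: nat set|"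
      by (rule card_of_ordLeqI) simp
    then show ?thesis
      using card_of_nat by (rule ordLeq_ordIso_trans)
  qed
  ultimately obtain b where b: "b \<in> Field (cardSuc natLeq)" "I \<subseteq> As b"
    using cardSuc_UNION[OF co inf] by blast
  have "\<not> finite (Field omega1)"
    unfolding omega1_def using cardSuc_finite[OF co] inf by simp
  moreover have "Card_order omega1"
    unfolding omega1_def by (rule cardSuc_Card_order[OF co])
  \<comment> \<open>The bound \<open>b\<close> may itself belong to \<open>I\<close>; an infinite
    cardinal is a limit, so there is an element strictly above it.\<close>
  ultimately obtain \<beta> where \<beta>: "\<beta> \<in> Field omega1" "b \<noteq> \<beta>" "(b, \<beta>) \<in> omega1"
    using infinite_Card_order_limit[of omega1 b] b(1) unfolding omega1_def by blast
  have "(i, \<beta>) \<in> omega1 \<and> i \<noteq> \<beta>" if "i \<in> I" for i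
  proof -
    have ib: "(i, b) \<in> omega1"
      using b(2) that unfolding As_def by blast
    then have "(i, \<beta>) \<in> omega1"
      using \<beta>(3) tr by (blast dest: transD)
    moreover have "i \<noteq> \<beta>"
      using antisymD[OF as \<beta>(3)] ib \<beta>(2) by blast
    ultimately show ?thesis by blast
  qed
  with \<beta>(1) show ?thesis
    by (rule that)
qed

lemma type_IE:
  assumes "type_I X"
  obtains A where "\<And>\<alpha>. \<alpha> \<in> Field omega1 \<Longrightarrow> openin X (A \<alpha>)"
    "\<And>\<alpha>. \<alpha> \<in> Field omega1 \<Longrightarrow> Lindelof_in X (A \<alpha>)"
    "topspace X = (\<Union>\<alpha> \<in> Field omega1. A \<alpha>)"
    "\<And>\<alpha> \<beta>. (\<alpha>, \<beta>) \<in> omega1 \<Longrightarrow> \<alpha> \<noteq> \<beta> \<Longrightarrow> X closure_of A \<alpha> \<subseteq> A \<beta>"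
proof -
  obtain A where A: "\<forall>\<alpha> \<in> Field omega1. openin X (A \<alpha>) \<and> Lindelof_space (subtopology X (A \<alpha>))"
      "topspace X = (\<Union>\<alpha> \<in> Field omega1. A \<alpha>)"
      "\<forall>\<alpha> \<beta>. (\<alpha>, \<beta>) \<in> omega1 \<and> \<alpha> \<noteq> \<beta> \<longrightarrow> X closure_of A \<alpha> \<subseteq> A \<beta>"
    using assms unfolding type_I_def by (elim exE conjE) (rule that)
  show ?thesis
  proof (rule that[of A])
    show "openin X (A \<alpha>)" "Lindelof_in X (A \<alpha>)" if "\<alpha> \<in> Field omega1" for \<alpha>
      using bspec[OF A(1) that] openin_subset[of X "A \<alpha>"] unfolding Lindelof_in_def by simp_all
    show "X closure_of A \<alpha> \<subseteq> A \<beta>" if "(\<alpha>, \<beta>) \<in> omega1" "\<alpha> \<noteq> \<beta>" for \<alpha> \<beta>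
      using A(3) that by simp
  qed (rule A(2))
qed

locale n_manifold =
  fixes X :: "'a topology" and n :: nat
  assumes mani: "manifold_of_dim n X"
begin

lemma con: "connected_space X" and Haus: "Hausdorff_space X"
  using mani unfolding manifold_of_dim_def by simp_all

lemma chart:
  assumes "x \<in> topspace X"
  obtains W where "openin X W" "x \<in> W" "subtopology X W homeomorphic_space Euclidean_space n"
  using mani assms unfolding manifold_of_dim_def by blast

lemma locally_compact: "locally_compact_space X"
  unfolding locally_compact_space_def
proof
  fix x assume "x \<in> topspace X"
  then obtain W where W: "openin X W" "x \<in> W" "subtopology X W homeomorphic_space Euclidean_space n"
    by (rule chart)
  have "locally_compact_space (subtopology X W)"
    using homeomorphic_locally_compact_space[OF W(3)] locally_compact_Euclidean_space by blast
  moreover have "x \<in> topspace (subtopology X W)"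
    using W(2) openin_subset[OF W(1)] by auto
  ultimately obtain U K where "openin (subtopology X W) U" "compactin (subtopology X W) K" "x \<in> U" "U \<subseteq> K"
    unfolding locally_compact_space_def by blast
  then have "openin X U \<and> compactin X K \<and> x \<in> U \<and> U \<subseteq> K"
    using openin_trans_full[OF _ W(1)] by (simp add: compactin_subtopology)
  then show "\<exists>U K. openin X U \<and> compactin X K \<and> x \<in> U \<and> U \<subseteq> K"
    by blast
qed

sublocale lc_Hausdorff X
  by unfold_locales (fact locally_compact, fact Haus)

lemma locally_connected: "locally_connected_space X"
  unfolding locally_connected_space
proof (intro allI impI, elim conjE)
  fix V x assume V: "openin X V" "x \<in> V"
  then have "x \<in> topspace X"
    using openin_subset by blast
  then obtain W where W: "openin X W" "x \<in> W" "subtopology X W homeomorphic_space Euclidean_space n"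
    by (rule chart)
  have "locally_connected_space (subtopology X W)"
    using homeomorphic_locally_connected_space[OF W(3)] locally_path_connected_imp_locally_connected_space
      locally_path_connected_Euclidean_space by blast
  moreover have "openin (subtopology X W) (W \<inter> V)"
    using V(1) by (simp add: openin_subtopology_Int2)
  moreover have "x \<in> W \<inter> V"
    using V W by blast
  ultimately have "\<exists>U. openin (subtopology X W) U \<and> connectedin (subtopology X W) U \<and> x \<in> U \<and> U \<subseteq> W \<inter> V"
    unfolding locally_connected_space by (elim allE[of _ "W \<inter> V"] allE[of _ x]) simp
  then obtain U where "openin (subtopology X W) U" "connectedin (subtopology X W) U" "x \<in> U" "U \<subseteq> W \<inter> V"
    by blast
  then have "openin X U \<and> connectedin X U \<and> x \<in> U \<and> U \<subseteq> V"
    using openin_trans_full[OF _ W(1)] by (simp add: connectedin_subtopology)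
  then show "\<exists>U. openin X U \<and> connectedin X U \<and> x \<in> U \<and> U \<subseteq> V"
    by blast
qed

lemma second_countable_nbhd:
  assumes S: "Lindelof_in X S"
  obtains G where "openin X G" "second_countable (subtopology X G)" "S \<subseteq> G"
proof -
  define \<U> where "\<U> = {W. openin X W \<and> second_countable (subtopology X W)}"
  have "\<exists>W\<in>\<U>. x \<in> W" if "x \<in> topspace X" for x
  proof -
    obtain W where W: "openin X W" "x \<in> W" "subtopology X W homeomorphic_space Euclidean_space n"
      by (rule chart[OF \<open>x \<in> topspace X\<close>])
    obtain f where "homeomorphic_map (Euclidean_space n) (subtopology X W) f"
      using W(3) homeomorphic_space_sym homeomorphic_space by blast
    then have "second_countable (subtopology X W)"
      unfolding homeomorphic_eq_everything_map
      by (elim conjE) (rule second_countable_open_map_image[OF _ _ _ second_countable_Euclidean_space])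
    with W(1,2) show ?thesis
      unfolding \<U>_def by blast
  qed
  then have "S \<subseteq> \<Union>\<U>"
    using S unfolding Lindelof_in_def by blast
  moreover have "\<forall>U\<in>\<U>. openin X U"
    unfolding \<U>_def by simp
  ultimately have "\<exists>V. countable V \<and> V \<subseteq> \<U> \<and> S \<subseteq> \<Union>V"
    using S Lindelof_space_subtopology_subset[of S X] unfolding Lindelof_in_def by simp
  then obtain V where V: "countable V" "V \<subseteq> \<U>" "S \<subseteq> \<Union>V"
    by blast
  show ?thesis
  proof (rule that[OF _ _ V(3)])
    show "openin X (\<Union>V)"
      using V(2) unfolding \<U>_def by blast
    show "second_countable (subtopology X (\<Union>V))"
      by (rule second_countable_Union_openin[OF V(1)]) (use V(2) \<U>_def in blast)+
  qed
qed

lemma second_countable_subset: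
  assumes "Lindelof_in X S" "T \<subseteq> S" shows "second_countable (subtopology X T)"
proof -
  obtain G where G: "openin X G" "second_countable (subtopology X G)" "S \<subseteq> G"
    by (rule second_countable_nbhd[OF assms(1)])
  have "second_countable (subtopology (subtopology X G) T)"
    using G(2) by (rule second_countable_subtopology)
  moreover have "subtopology (subtopology X G) T = subtopology X T"
    using G(3) assms(2) by (simp add: subtopology_subtopology inf_absorb2)
  ultimately show ?thesis by simp
qed

text \<open>Arbitrary subsets are allowed, not just closed ones: countably many charts cover a
  Lindelof set, which therefore lies in a second countable open set.\<close>

lemma Lindelof_in_subset:
  assumes "Lindelof_in X S" "T \<subseteq> S" shows "Lindelof_in X T"
  unfolding Lindelof_in_def
  using second_countable_imp_Lindelof_space[OF second_countable_subset[OF assms]] assms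
  by (auto simp: Lindelof_in_def)

lemma bounded_imp_Lindelof_in: "bounded_subset X S \<Longrightarrow> Lindelof_in X S"
  unfolding bounded_subset_def by (elim exE conjE) (rule Lindelof_in_subset[OF compactin_imp_Lindelof_in])

lemma countable_dense_subset:
  assumes S: "Lindelof_in X S"
  obtains C where "countable C" "C \<subseteq> S" "S \<subseteq> X closure_of C"
proof -
  have "separable_space (subtopology X S)"
    by (rule second_countable_imp_separable_space[OF second_countable_subset[OF S order_refl]])
  moreover have "S \<subseteq> topspace X"
    using S unfolding Lindelof_in_def by blast
  ultimately obtain C where "countable C" "C \<subseteq> S" "S \<subseteq> X closure_of C"
    unfolding separable_space_def by (auto simp: closure_of_subtopology inf_absorb2)
  then show ?thesis by (rule that)
qed

text \<open>A countable dense subset of \<open>S\<close> is bounded, and so is its closure, which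
  contains \<open>S\<close>.\<close>

lemma omega_bounded_Lindelof:
  assumes "omega_bounded X U" "S \<subseteq> U" "Lindelof_in X S" shows "bounded_subset X S"
proof -
  obtain C where C: "countable C" "C \<subseteq> S" "S \<subseteq> X closure_of C"
    by (rule countable_dense_subset[OF assms(3)])
  have "C \<subseteq> U"
    using C(2) assms(2) by blast
  then have "bounded_subset X C"
    using assms(1) C(1) unfolding omega_bounded_def by blast
  then show ?thesis
    by (rule bounded_subset_mono[OF bounded_subset_closure_of C(3)])
qed

lemma type_I_Lindelof_subset:
  assumes A: "\<And>\<alpha>. \<alpha> \<in> Field omega1 \<Longrightarrow> openin X (A \<alpha>)" "topspace X = (\<Union>\<alpha> \<in> Field omega1. A \<alpha>)"
    "\<And>\<alpha> \<beta>. (\<alpha>, \<beta>) \<in> omega1 \<Longrightarrow> \<alpha> \<noteq> \<beta> \<Longrightarrow> X closure_of A \<alpha> \<subseteq> A \<beta>"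
    and S: "Lindelof_in X S"
  obtains \<beta> where "\<beta> \<in> Field omega1" "X closure_of S \<subseteq> A \<beta>"
proof -
  have "S \<subseteq> \<Union>(A ` Field omega1)"
    using S A(2) unfolding Lindelof_in_def by blast
  moreover have "\<forall>U\<in>A ` Field omega1. openin X U"
    using A(1) by blast
  moreover have "S \<subseteq> topspace X" "Lindelof_space (subtopology X S)"
    using S unfolding Lindelof_in_def by simp_all
  ultimately have "\<exists>V. countable V \<and> V \<subseteq> A ` Field omega1 \<and> S \<subseteq> \<Union>V"
    using Lindelof_space_subtopology_subset[of S X] by simp
  then obtain V where V: "countable V" "V \<subseteq> A ` Field omega1" "S \<subseteq> \<Union>V"
    by blast
  have "\<exists>I. countable I \<and> I \<subseteq> Field omega1 \<and> V = A ` I"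
    using V(1,2) countable_subset_image[of V A "Field omega1"] by simp
  then obtain I where I: "countable I" "I \<subseteq> Field omega1" "V = A ` I"
    by blast
  obtain \<beta> where \<beta>: "\<beta> \<in> Field omega1" "\<And>i. i \<in> I \<Longrightarrow> (i, \<beta>) \<in> omega1 \<and> i \<noteq> \<beta>"
    by (rule countable_bounded_omega1[OF I(1,2)]) (rule that)
  have "countable {\<beta>}" "{\<beta>} \<subseteq> Field omega1"
    using \<beta>(1) by simp_all
  \<comment> \<open>One more step, because the closure of \<open>A \<beta>\<close> is only known to
    lie in strictly later sets.\<close>
  then obtain \<gamma> where \<gamma>: "\<gamma> \<in> Field omega1" "\<And>i. i \<in> {\<beta>} \<Longrightarrow> (i, \<gamma>) \<in> omega1 \<and> i \<noteq> \<gamma>"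
    by (rule countable_bounded_omega1) (rule that)
  have "A i \<subseteq> A \<beta>" if "i \<in> I" for i
  proof -
    have "X closure_of A i \<subseteq> A \<beta>"
      using A(3)[of i \<beta>] \<beta>(2)[OF that] by simp
    moreover have "A i \<subseteq> X closure_of A i"
      by (rule closure_of_subset[OF openin_subset[OF A(1)]]) (use I(2) that in blast)
    ultimately show ?thesis by simp
  qed
  then have "S \<subseteq> A \<beta>"
    using V(3) I(3) by blast
  then have "X closure_of S \<subseteq> A \<gamma>"
    using A(3)[of \<beta> \<gamma>] \<gamma>(2)[of \<beta>] closure_of_mono[of S "A \<beta>" X] by simp
  with \<gamma>(1) show ?thesis
    by (rule that)
qed

text \<open>Type I confines the closure to a single \<open>A \<beta>\<close>. This fails in general:
  a manifold can be separable without being Lindelof, and then the closure of some countable set is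
  not Lindelof.\<close>

lemma type_I_Lindelof_closure:
  assumes "type_I X" "Lindelof_in X S" shows "Lindelof_in X (X closure_of S)"
proof -
  obtain A where A: "\<And>\<alpha>. \<alpha> \<in> Field omega1 \<Longrightarrow> openin X (A \<alpha>)"
    "\<And>\<alpha>. \<alpha> \<in> Field omega1 \<Longrightarrow> Lindelof_in X (A \<alpha>)"
    "topspace X = (\<Union>\<alpha> \<in> Field omega1. A \<alpha>)"
    "\<And>\<alpha> \<beta>. (\<alpha>, \<beta>) \<in> omega1 \<Longrightarrow> \<alpha> \<noteq> \<beta> \<Longrightarrow> X closure_of A \<alpha> \<subseteq> A \<beta>"
    by (rule type_IE[OF assms(1)]) (rule that)
  obtain \<beta> where \<beta>: "\<beta> \<in> Field omega1" "X closure_of S \<subseteq> A \<beta>"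
    by (rule type_I_Lindelof_subset[of A S, OF A(1,3,4) assms(2)]) 
  show ?thesis
    by (rule Lindelof_in_subset[OF A(2)[OF \<beta>(1)] \<beta>(2)])
qed

text \<open>A chart of \<open>X\<close> restricted to \<open>T\<close> has only an open subset of
  Euclidean space as its image, while the definition asks for a full copy;
  \<open>Euclidean_space_inner_copy\<close> provides one around the image of
  \<open>x\<close>.\<close>

lemma open_submanifold:
  assumes T: "openin X T" "connectedin X T"
  shows "manifold_of_dim n (subtopology X T)"
  unfolding manifold_of_dim_def
proof (intro conjI ballI)
  show "1 \<le> n"
    using mani unfolding manifold_of_dim_def by simp
  show "connected_space (subtopology X T)"
    using T(2) connectedin_def by blast
  show "Hausdorff_space (subtopology X T)"
    using Haus by (rule Hausdorff_space_subtopology)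
  fix x assume "x \<in> topspace (subtopology X T)"
  then have x: "x \<in> T" "x \<in> topspace X" by auto
  obtain W where W: "openin X W" "x \<in> W" "subtopology X W homeomorphic_space Euclidean_space n"
    by (rule chart[OF x(2)])
  then obtain f where f: "homeomorphic_map (subtopology X W) (Euclidean_space n) f"
    unfolding homeomorphic_space by blast
  have tW: "topspace (subtopology X W) = W"
    using openin_subset[OF W(1)] by auto
  have "openin (subtopology X W) (W \<inter> T)"
    using T(1) by (simp add: openin_subtopology_Int2)
  then have "openin (Euclidean_space n) (f ` (W \<inter> T))"
    using homeomorphic_map_openness_eq[OF f] by blast
  moreover have "f x \<in> f ` (W \<inter> T)"
    using W(2) x(1) by blast
  ultimately obtain V where V: "openin (Euclidean_space n) V" "f x \<in> V" "V \<subseteq> f ` (W \<inter> T)"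
    "subtopology (Euclidean_space n) V homeomorphic_space Euclidean_space n"
    by (rule Euclidean_space_inner_copy)
  define U where "U = {y \<in> W. f y \<in> V}"
  have inj: "inj_on f W"
    using homeomorphic_imp_injective_map[OF f] tW by simp
  have UT: "U \<subseteq> W \<inter> T"
  proof
    fix y assume "y \<in> U"
    then have y: "y \<in> W" "f y \<in> f ` (W \<inter> T)"
      using V(3) unfolding U_def by blast+
    then obtain z where "z \<in> W \<inter> T" "f y = f z" by blast
    then show "y \<in> W \<inter> T"
      using inj_onD[OF inj] y(1) by blast
  qed
  have fU: "f ` U = V"
    using V(3) unfolding U_def by blast
  have "openin (subtopology X W) U"
  proof (rule iffD1[OF homeomorphic_map_openness[OF f]])
    show "U \<subseteq> topspace (subtopology X W)"
      using UT tW by blast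
  qed (use V(1) fU in simp)
  then have opU: "openin X U"
    using W(1) openin_trans_full by blast
  have "homeomorphic_map (subtopology (subtopology X W) U) (subtopology (Euclidean_space n) V) f"
    by (rule homeomorphic_map_subtopologies[OF f]) (use UT tW fU openin_subset[OF V(1)] in \<open>auto simp: inf_absorb2\<close>)
  moreover have "subtopology (subtopology X W) U = subtopology X U"
    "subtopology (subtopology X T) U = subtopology X U"
    using UT by (simp_all add: subtopology_subtopology inf_absorb2)
  ultimately have "subtopology (subtopology X T) U homeomorphic_space subtopology (Euclidean_space n) V"
    using homeomorphic_map_imp_homeomorphic_space by metis
  then have "subtopology (subtopology X T) U homeomorphic_space Euclidean_space n"
    using V(4) homeomorphic_space_trans by blast
  moreover have "openin (subtopology X T) U"
    using opU UT by (intro subset_openin_subtopology) auto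
  moreover have "x \<in> U"
    unfolding U_def using W(2) V(2) by blast
  ultimately show "\<exists>U. openin (subtopology X T) U \<and> x \<in> U \<and>
      subtopology (subtopology X T) U homeomorphic_space Euclidean_space n"
    by blast
qed

lemma open_subset_type_I:
  assumes "type_I X" and T: "openin X T"
  shows "type_I (subtopology X T)"
proof -
  obtain A where A: "\<And>\<alpha>. \<alpha> \<in> Field omega1 \<Longrightarrow> openin X (A \<alpha>)"
    "\<And>\<alpha>. \<alpha> \<in> Field omega1 \<Longrightarrow> Lindelof_in X (A \<alpha>)"
    "topspace X = (\<Union>\<alpha> \<in> Field omega1. A \<alpha>)"
    "\<And>\<alpha> \<beta>. (\<alpha>, \<beta>) \<in> omega1 \<Longrightarrow> \<alpha> \<noteq> \<beta> \<Longrightarrow> X closure_of A \<alpha> \<subseteq> A \<beta>"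
    by (rule type_IE[OF assms(1)]) (rule that)
  show ?thesis
    unfolding type_I_def
  proof (intro exI[of _ "\<lambda>\<alpha>. T \<inter> A \<alpha>"] conjI ballI allI impI)
    fix \<alpha> assume \<alpha>: "\<alpha> \<in> Field omega1"
    show "openin (subtopology X T) (T \<inter> A \<alpha>)"
      using A(1)[OF \<alpha>] by (simp add: openin_subtopology_Int2)
    have "Lindelof_in X (A \<alpha>)"
      by (rule A(2)[OF \<alpha>])
    then have "Lindelof_in X (T \<inter> A \<alpha>)"
      by (rule Lindelof_in_subset) blast
    then show "Lindelof_space (subtopology (subtopology X T) (T \<inter> A \<alpha>))"
      unfolding Lindelof_in_def by (simp add: subtopology_subtopology)
  next
    show "topspace (subtopology X T) = (\<Union>\<alpha>\<in>Field omega1. T \<inter> A \<alpha>)"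
      unfolding topspace_subtopology A(3) by blast
  next
    fix \<alpha> \<beta> assume "(\<alpha>, \<beta>) \<in> omega1 \<and> \<alpha> \<noteq> \<beta>"
    then have "X closure_of A \<alpha> \<subseteq> A \<beta>"
      using A(4) by simp
    then show "subtopology X T closure_of (T \<inter> A \<alpha>) \<subseteq> T \<inter> A \<beta>"
      using closure_of_mono[of "T \<inter> A \<alpha>" "A \<alpha>" X] by (auto simp: closure_of_subtopology)
  qed
qed

end

section \<open>Components of complements of closed sets\<close>

text \<open>At most one end, expressed without ends: the ends of \<open>X\<close> and of a subspace
  are threads over different families of covers, whereas this condition can be transferred. Bounded
  sets satisfy it.\<close>

definition one_ended :: "'a topology \<Rightarrow> 'a set \<Rightarrow> bool" where
  "one_ended X U \<longleftrightarrow> (\<forall>V. cf_open X V \<longrightarrow> bounded_subset X (U \<inter> V) \<or> bounded_subset X (U - V))"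

abbreviation components_off :: "'a topology \<Rightarrow> 'a set \<Rightarrow> 'a set set" where
  "components_off X C \<equiv> connected_components_of (subtopology X (topspace X - C))"

context lc_Hausdorff
begin

lemma one_endedI:
  "cf_open X U \<Longrightarrow> ends X \<inter> end_nbhd X U \<subseteq> {e} \<Longrightarrow> one_ended X U"
  unfolding one_ended_def using one_end_dichotomy by blast

lemma one_ended_unique:
  assumes U: "one_ended X U" and e: "e \<in> ends X" "e \<in> end_nbhd X U" and d: "d \<in> ends X" "d \<in> end_nbhd X U"
  shows "d = e"
proof (rule ccontr)
  assume "d \<noteq> e"
  then obtain V where V: "cf_open X V" "d \<in> end_nbhd X V" "e \<in> end_nbhd X (topspace X - X closure_of V)"
    by (rule ends_separated[OF d(1) e(1)])
  have "d \<in> end_nbhd X (U \<inter> V)" "e \<in> end_nbhd X (U \<inter> (topspace X - X closure_of V))"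
    using V(2,3) e(2) d(2) by (simp_all add: end_nbhd_Int)
  then have nb: "\<not> bounded_subset X (U \<inter> V)" "\<not> bounded_subset X (U \<inter> (topspace X - X closure_of V))"
    using end_nbhd_unbounded[OF d(1)] end_nbhd_unbounded[OF e(1)] by simp_all
  have "U \<inter> (topspace X - X closure_of V) \<subseteq> U - V"
    using closure_of_subset[OF cf_openD(2)[OF V(1)]] by blast
  then have "\<not> bounded_subset X (U - V)"
    using nb(2) bounded_subset_mono by blast
  with nb(1) show False
    using U V(1) unfolding one_ended_def by blast
qed

text \<open>Sets that differ by bounded sets contain the same ends, so representatives of all
  classes of sets with compact frontier already give a base of the end space.\<close>

lemma second_countable_end_space:
  assumes D: "countable \<D>" "\<And>D. D \<in> \<D> \<Longrightarrow> cf_open X D"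
    and ex: "\<And>V. cf_open X V \<Longrightarrow> \<exists>D\<in>\<D>. bounded_subset X (V - D) \<and> bounded_subset X (D - V)"
  shows "second_countable (end_space X)"
  unfolding second_countable_def
proof (intro exI conjI ballI allI impI)
  show "countable ((\<lambda>D. ends X \<inter> end_nbhd X D) ` \<D>)"
    using D(1) by simp
  fix W assume "W \<in> (\<lambda>D. ends X \<inter> end_nbhd X D) ` \<D>"
  then obtain D where "D \<in> \<D>" "W = ends X \<inter> end_nbhd X D" by blast
  then show "openin (end_space X) W"
    unfolding end_space_def using openin_end_nbhd[OF cf_openD(1)[OF D(2)]] by (simp add: openin_subtopology_Int2)
next
  fix W e assume "openin (end_space X) W \<and> e \<in> W"
  then obtain W' where W': "openin (freudenthal X) W'" "W = W' \<inter> ends X" "e \<in> W"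
    unfolding end_space_def openin_subtopology by blast
  then have e: "e \<in> ends X" "e \<in> W'" by blast+
  obtain V where V: "openin X V" "e \<in> end_nbhd X V" "end_nbhd X V \<subseteq> W'"
    by (rule freudenthal_base[OF W'(1) e(2)])
  obtain O' where O': "cf_open X O'" "e \<in> end_nbhd X O'" "X closure_of O' \<subseteq> V"
    by (rule end_cf_base[OF e(1) V(2)])
  obtain D where D': "D \<in> \<D>" "bounded_subset X (O' - D)" "bounded_subset X (D - O')"
    using ex[OF O'(1)] by blast
  have "O' \<subseteq> V"
    using O'(3) closure_of_subset[OF cf_openD(2)[OF O'(1)]] by blast
  then have "end_nbhd X O' \<subseteq> end_nbhd X V"
    by (rule end_nbhd_mono)
  moreover have "ends X \<inter> end_nbhd X O' \<subseteq> end_nbhd X D" "ends X \<inter> end_nbhd X D \<subseteq> end_nbhd X O'"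
    using end_nbhd_subset_iff[OF O'(1)] end_nbhd_subset_iff[OF D(2)[OF D'(1)]] D'(2,3) by simp_all
  ultimately have "e \<in> ends X \<inter> end_nbhd X D" "ends X \<inter> end_nbhd X D \<subseteq> W"
    using e(1) O'(2) V(3) W'(2) by blast+
  with D'(1) show "\<exists>B\<in>(\<lambda>D. ends X \<inter> end_nbhd X D) ` \<D>. e \<in> B \<and> B \<subseteq> W"
    by blast
qed

end

context n_manifold
begin

lemma connected_nbhd:
  assumes "openin X V" "x \<in> V"
  obtains D where "openin X D" "connectedin X D" "x \<in> D" "D \<subseteq> V"
proof -
  have "\<exists>U. openin X U \<and> connectedin X U \<and> x \<in> U \<and> U \<subseteq> V"
    using locally_connected assms unfolding locally_connected_space by simp
  then show ?thesis
    using that by blast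
qed

text \<open>The points that a compact connected set joins to \<open>x0\<close> form a clopen set,
  hence all of \<open>X\<close>. Cover \<open>S\<close> by finitely many small sets with compact
  connected closures and join each of these to \<open>x0\<close>.\<close>

lemma compact_connected_superset:
  assumes S: "compactin X S" and x0: "x0 \<in> topspace X"
  obtains Z where "compactin X Z" "connectedin X Z" "S \<subseteq> Z" "x0 \<in> Z"
proof -
  have "\<exists>N. openin X N \<and> connectedin X (X closure_of N) \<and> compactin X (X closure_of N) \<and> x \<in> N" if x: "x \<in> topspace X" for x
  proof -
    have "compactin X {x}"
      using x by simp
    then obtain U where U: "openin X U" "{x} \<subseteq> U" "compactin X (X closure_of U)"
      by (rule compact_nbhd)
    have "x \<in> U"
      using U(2) by simp
    then obtain N where N: "openin X N" "connectedin X N" "x \<in> N" "N \<subseteq> U"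
      by (rule connected_nbhd[OF U(1)])
    have "compactin X (X closure_of N)"
      by (rule closed_compactin[OF U(3) closure_of_mono[OF N(4)] closedin_closure_of])
    moreover have "connectedin X (X closure_of N)"
      using N(2) by (rule connectedin_closure_of)
    ultimately show ?thesis
      using N by blast
  qed
  then obtain N where N: "\<And>x. x \<in> topspace X \<Longrightarrow> openin X (N x)" "\<And>x. x \<in> topspace X \<Longrightarrow> connectedin X (X closure_of N x)"
    "\<And>x. x \<in> topspace X \<Longrightarrow> compactin X (X closure_of N x)" "\<And>x. x \<in> topspace X \<Longrightarrow> x \<in> N x"
    by metis
  have Ncl: "N x \<subseteq> X closure_of N x" if "x \<in> topspace X" for x
    by (rule closure_of_subset[OF openin_subset[OF N(1)[OF that]]])
  define A where "A = {x \<in> topspace X. \<exists>C. compactin X C \<and> connectedin X C \<and> x0 \<in> C \<and> x \<in> C}"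
  have step: "y \<in> A" if xz: "x \<in> A" "z \<in> topspace X" "x \<in> N z" "y \<in> N z" for x y z
  proof -
    obtain C where C: "compactin X C" "connectedin X C" "x0 \<in> C" "x \<in> C"
      using xz(1) unfolding A_def by blast
    have "x \<in> X closure_of N z" "y \<in> X closure_of N z"
      using Ncl[OF xz(2)] xz(3,4) by blast+
    then have "connectedin X (C \<union> X closure_of N z)" "compactin X (C \<union> X closure_of N z)"
      using C N(2,3)[OF xz(2)] by (auto intro!: connectedin_Un compactin_Un)
    moreover have "y \<in> topspace X"
      using xz(4) openin_subset[OF N(1)[OF xz(2)]] by blast
    ultimately show ?thesis
      unfolding A_def using C(3) \<open>y \<in> X closure_of N z\<close> by blast
  qed
  have AX: "A \<subseteq> topspace X"
    unfolding A_def by blast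
  have "openin X A"
  proof (subst openin_subopen, intro ballI)
    fix x assume x: "x \<in> A"
    then have xX: "x \<in> topspace X"
      using AX by blast
    show "\<exists>T. openin X T \<and> x \<in> T \<and> T \<subseteq> A"
      by (intro exI[of _ "N x"] conjI N(1)[OF xX] N(4)[OF xX] subsetI step[OF x xX N(4)[OF xX]])
  qed
  moreover have "openin X (topspace X - A)"
  proof (subst openin_subopen, intro ballI)
    fix x assume x: "x \<in> topspace X - A"
    then have xX: "x \<in> topspace X" by blast
    have "y \<notin> A" if "y \<in> N x" for y
    proof
      assume "y \<in> A"
      then have "x \<in> A"
        by (rule step[OF _ xX that N(4)[OF xX]])
      with x show False by simp
    qed
    then have "N x \<subseteq> topspace X - A"
      using openin_subset[OF N(1)[OF xX]] by blast
    then show "\<exists>T. openin X T \<and> x \<in> T \<and> T \<subseteq> topspace X - A"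
      using N(1)[OF xX] N(4)[OF xX] by blast
  qed
  then have "closedin X A"
    using AX unfolding closedin_def by blast
  ultimately have "A = {} \<or> A = topspace X"
    using con unfolding connected_space_clopen_in by simp
  moreover have "x0 \<in> A"
    unfolding A_def using x0 by (auto intro!: exI[of _ "{x0}"])
  ultimately have A: "A = topspace X"
    by blast
  have SX: "S \<subseteq> topspace X"
    by (rule compactin_subset_topspace[OF S])
  have "\<forall>U\<in>N ` S. openin X U" "S \<subseteq> \<Union>(N ` S)"
    using N(1,4) SX by blast+
  then obtain F where F: "finite F" "F \<subseteq> N ` S" "S \<subseteq> \<Union>F"
    using S unfolding compactin_def by meson
  obtain P where P: "P \<subseteq> S" "finite P" "F = N ` P"
    using finite_subset_image[OF F(1,2)] by auto
  have "\<exists>C. compactin X C \<and> connectedin X C \<and> x0 \<in> C \<and> x \<in> C" if "x \<in> P" for x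
    using that P(1) SX A unfolding A_def by blast
  then obtain C where C: "\<And>x. x \<in> P \<Longrightarrow> compactin X (C x)" "\<And>x. x \<in> P \<Longrightarrow> connectedin X (C x)"
    "\<And>x. x \<in> P \<Longrightarrow> x0 \<in> C x" "\<And>x. x \<in> P \<Longrightarrow> x \<in> C x"
    by metis
  define Z where "Z = \<Union>(insert {x0} ((\<lambda>x. C x \<union> X closure_of N x) ` P))"
  have PX: "x \<in> topspace X" if "x \<in> P" for x
    using that P(1) SX by blast
  have "compactin X Z"
    unfolding Z_def
  proof (rule compactin_Union)
    show "finite (insert {x0} ((\<lambda>x. C x \<union> X closure_of N x) ` P))"
      using P(2) by simp
    fix D assume "D \<in> insert {x0} ((\<lambda>x. C x \<union> X closure_of N x) ` P)"
    then show "compactin X D"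
      using x0 C(1) N(3)[OF PX] by (auto intro!: compactin_Un)
  qed
  moreover have "connectedin X Z"
    unfolding Z_def
  proof (rule connectedin_Union)
    fix D assume "D \<in> insert {x0} ((\<lambda>x. C x \<union> X closure_of N x) ` P)"
    then consider "D = {x0}" | x where "x \<in> P" "D = C x \<union> X closure_of N x"
      by blast
    then show "connectedin X D"
    proof cases
      case 1
      then show ?thesis
        using x0 by simp
    next
      case 2
      have "x \<in> C x \<inter> X closure_of N x"
        using C(4)[OF 2(1)] N(4)[OF PX[OF 2(1)]] Ncl[OF PX[OF 2(1)]] by blast
      then show ?thesis
        unfolding 2(2) by (intro connectedin_Un C(2)[OF 2(1)] N(2)[OF PX[OF 2(1)]]) blast
    qed
  next
    have "x0 \<in> \<Inter>(insert {x0} ((\<lambda>x. C x \<union> X closure_of N x) ` P))"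
      by (rule InterI) (use C(3) in \<open>elim insertE imageE; simp\<close>)
    then show "\<Inter>(insert {x0} ((\<lambda>x. C x \<union> X closure_of N x) ` P)) \<noteq> {}"
      by blast
  qed
  moreover have "S \<subseteq> Z"
  proof
    fix s assume "s \<in> S"
    then obtain x where "x \<in> P" "s \<in> N x"
      using F(3) P(3) by blast
    then have "s \<in> X closure_of N x"
      using Ncl[OF PX] by blast
    with \<open>x \<in> P\<close> show "s \<in> Z"
      unfolding Z_def by blast
  qed
  moreover have "x0 \<in> Z"
    unfolding Z_def by blast
  ultimately show ?thesis
    by (rule that)
qed

lemma components_off_cover: "topspace X - C = \<Union>(components_off X C)"
  unfolding Union_connected_components_of by auto

lemma components_off_disjoint:
  "Y \<in> components_off X C \<Longrightarrow> Z \<in> components_off X C \<Longrightarrow> Y \<noteq> Z \<Longrightarrow> Y \<inter> Z = {}"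
  using pairwise_disjoint_connected_components_of[of "subtopology X (topspace X - C)"]
  by (auto simp: pairwise_def disjnt_def)

text \<open>The last clause rests on the connectedness of \<open>X\<close>: a component whose
  closure misses \<open>C\<close> would be clopen, hence all of \<open>X\<close>.\<close>

lemma components_offD:
  assumes C: "closedin X C" and Y: "Y \<in> components_off X C"
  shows "openin X Y" "connectedin X Y" "Y \<noteq> {}" "Y \<subseteq> topspace X - C" "X closure_of Y - Y \<subseteq> C"
    "C \<noteq> {} \<Longrightarrow> X closure_of Y \<inter> C \<noteq> {}"
proof -
  have op: "openin X (topspace X - C)"
    using C by blast
  have opc: "openin X Z" if "Z \<in> components_off X C" for Z
    by (rule locally_connected[unfolded locally_connected_space_open_connected_components, rule_format, OF conjI[OF op that]])
  show o: "openin X Y"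
    by (rule opc[OF Y])
  show "connectedin X Y"
    using connectedin_connected_components_of[OF Y] by (simp add: connectedin_subtopology)
  show ne: "Y \<noteq> {}"
    by (rule nonempty_connected_components_of[OF Y])
  show sub: "Y \<subseteq> topspace X - C"
    using components_off_cover[of C] Y by blast
  show fr: "X closure_of Y - Y \<subseteq> C"
  proof (rule subsetI, rule ccontr)
    fix p assume p: "p \<in> X closure_of Y - Y" "p \<notin> C"
    then have "p \<in> topspace X - C"
      using closure_of_subset_topspace[of X Y] by blast
    then obtain Z where Z: "Z \<in> components_off X C" "p \<in> Z"
      using components_off_cover[of C] by blast
    have "p \<in> X closure_of Y"
      using p(1) by simp
    then have "\<exists>y. y \<in> Y \<and> y \<in> Z"
      unfolding in_closure_of using opc[OF Z(1)] Z(2) by simp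
    then have "Z \<inter> Y \<noteq> {}"
      by blast
    then have "Z = Y"
      using components_off_disjoint[OF Z(1) Y] by blast
    with p Z(2) show False by blast
  qed
  show "X closure_of Y \<inter> C \<noteq> {}" if "C \<noteq> {}"
  proof
    assume "X closure_of Y \<inter> C = {}"
    then have "X closure_of Y \<subseteq> Y"
      using fr by blast
    then have "closedin X Y"
      using closure_of_subset[OF openin_subset[OF o]] closedin_closure_of[of X Y] by simp
    then have "Y = topspace X"
      using con[unfolded connected_space_clopen_in, rule_format, OF conjI[OF o \<open>closedin X Y\<close>]] ne by simp
    then show False
      using sub that closedin_subset[OF C] by simp blast
  qed
qed

lemma components_off_meet:
  assumes C: "closedin X C" "C \<noteq> {}" and G: "openin X G" "C \<subseteq> G" and Y: "Y \<in> components_off X C"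
  shows "Y \<inter> G \<noteq> {}"
proof -
  obtain p where "p \<in> X closure_of Y" "p \<in> G"
    using components_offD(6)[OF C(1) Y C(2)] G(2) by blast
  then have "\<exists>y. y \<in> Y \<and> y \<in> G"
    unfolding in_closure_of using G(1) by simp
  then show ?thesis
    by blast
qed

lemma countable_components_off:
  assumes C: "closedin X C" "C \<noteq> {}" and G: "openin X G" "second_countable (subtopology X G)" "C \<subseteq> G"
  shows "countable (components_off X C)"
proof (rule countable_disjoint_openin[OF G(1,2)])
qed (rule components_offD(1)[OF C(1)] components_off_disjoint components_off_meet[OF C G(1,3)]; assumption)+

text \<open>A component that leaves \<open>N\<close> also meets \<open>N\<close>, near
  \<open>K\<close>, and is connected; so it meets the compact frontier of \<open>N\<close>, and only
  finitely many disjoint open sets covering that frontier can do so.\<close>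

lemma finite_components_off:
  assumes K: "compactin X K" "K \<noteq> {}" and N: "openin X N" "K \<subseteq> N" "compactin X (X closure_of N)"
  shows "finite {Y \<in> components_off X K. \<not> Y \<subseteq> N}"
proof -
  have cK: "closedin X K"
    using Haus K(1) by (rule compactin_imp_closedin)
  have NN: "N \<subseteq> X closure_of N"
    by (rule closure_of_subset[OF openin_subset[OF N(1)]])
  have fr: "compactin X (X closure_of N - N)"
    by (rule closed_compactin[OF N(3)]) (auto simp: N(1) closedin_diff)
  have "finite {Y \<in> components_off X K. Y \<inter> (X closure_of N - N) \<noteq> {}}"
  proof (rule finite_disjoint_openin_compactin[OF fr])
    show "X closure_of N - N \<subseteq> \<Union>(components_off X K)"
      using components_off_cover[of K] N(2) closure_of_subset_topspace[of X N] by blast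
  qed (rule components_offD(1)[OF cK] components_off_disjoint; assumption)+
  moreover have "{Y \<in> components_off X K. \<not> Y \<subseteq> N} \<subseteq> {Y \<in> components_off X K. Y \<inter> (X closure_of N - N) \<noteq> {}}"
  proof (intro subsetI CollectI conjI)
    fix Y assume "Y \<in> {Y \<in> components_off X K. \<not> Y \<subseteq> N}"
    then have Y: "Y \<in> components_off X K" "\<not> Y \<subseteq> N" by blast+
    show "Y \<in> components_off X K" by (rule Y)
    show "Y \<inter> (X closure_of N - N) \<noteq> {}"
      using connectedin_subset_openin[OF components_offD(2)[OF cK Y(1)] N(1) components_off_meet[OF cK K(2) N(1,2) Y(1)]] Y(2)
      by blast
  qed
  ultimately show ?thesis
    using finite_subset by blast
qed

lemma compact_exhaustion:
  assumes G: "openin X G" "second_countable (subtopology X G)"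
  obtains \<G> where "countable \<G>" "\<And>N. N \<in> \<G> \<Longrightarrow> openin X N" "\<And>N. N \<in> \<G> \<Longrightarrow> compactin X (X closure_of N)"
    "\<And>N. N \<in> \<G> \<Longrightarrow> X closure_of N \<subseteq> G" "\<And>K. compactin X K \<Longrightarrow> K \<subseteq> G \<Longrightarrow> \<exists>N\<in>\<G>. K \<subseteq> N"
proof -
  obtain \<B> where B0: "countable \<B> \<and> (\<forall>V\<in>\<B>. openin (subtopology X G) V) \<and>
      (\<forall>U x. openin (subtopology X G) U \<and> x \<in> U \<longrightarrow> (\<exists>V\<in>\<B>. x \<in> V \<and> V \<subseteq> U))"
    using G(2) unfolding second_countable_def by (elim exE) (rule that)
  have B: "countable \<B>" "\<And>V. V \<in> \<B> \<Longrightarrow> openin (subtopology X G) V"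
    "\<And>U x. openin (subtopology X G) U \<Longrightarrow> x \<in> U \<Longrightarrow> \<exists>V\<in>\<B>. x \<in> V \<and> V \<subseteq> U"
    using B0 by simp_all
  define \<C> where "\<C> = {V \<in> \<B>. compactin X (X closure_of V) \<and> X closure_of V \<subseteq> G}"
  define \<G> where "\<G> = Union ` {F. finite F \<and> F \<subseteq> \<C>}"
  have opC: "openin X V" if "V \<in> \<C>" for V
    using B(2)[of V] openin_trans_full[OF _ G(1)] that unfolding \<C>_def by simp
  have "countable \<C>"
    unfolding \<C>_def using B(1) by simp
  then have "countable \<G>"
    unfolding \<G>_def by (intro countable_image countable_Collect_finite_subset)
  moreover have "openin X N" if "N \<in> \<G>" for N
    using that opC unfolding \<G>_def by (auto intro: openin_Union)
  moreover have "compactin X (X closure_of N) \<and> X closure_of N \<subseteq> G" if N: "N \<in> \<G>" for N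
  proof -
    obtain F where F: "finite F" "F \<subseteq> \<C>" "N = \<Union>F"
      using N unfolding \<G>_def by blast
    have "X closure_of N = \<Union>((\<lambda>V. X closure_of V) ` F)"
      using F(1,3) by (simp add: closure_of_Union)
    moreover have "compactin X (\<Union>((\<lambda>V. X closure_of V) ` F))"
      by (rule compactin_Union) (use F(1,2) in \<open>auto simp: \<C>_def\<close>)
    moreover have "\<Union>((\<lambda>V. X closure_of V) ` F) \<subseteq> G"
      using F(2) unfolding \<C>_def by blast
    ultimately show ?thesis by simp
  qed
  moreover have "\<exists>N\<in>\<G>. K \<subseteq> N" if K: "compactin X K" "K \<subseteq> G" for K
  proof -
    have "\<exists>V\<in>\<C>. x \<in> V" if x: "x \<in> K" for x
    proof -
      have x1: "compactin X {x}" "{x} \<subseteq> G"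
        using x K compactin_subset_topspace[OF K(1)] by auto
      obtain W where W: "openin X W" "{x} \<subseteq> W" "compactin X (X closure_of W)" "X closure_of W \<subseteq> G"
        by (rule compact_nbhd_in[OF x1(1) G(1) x1(2)])
      have WG: "W \<subseteq> G"
        using W(4) closure_of_subset[OF openin_subset[OF W(1)]] by blast
      then have "openin (subtopology X G) W"
        using W(1) by (intro subset_openin_subtopology) auto
      moreover have "x \<in> W"
        using W(2) by simp
      ultimately obtain V where V: "V \<in> \<B>" "x \<in> V" "V \<subseteq> W"
        using B(3)[of W x] by blast
      have VW: "X closure_of V \<subseteq> X closure_of W"
        using V(3) by (rule closure_of_mono)
      have "V \<in> \<C>"
        unfolding \<C>_def using V(1) VW W(4) closed_compactin[OF W(3) VW closedin_closure_of] by blast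
      with V(2) show ?thesis by blast
    qed
    then have "K \<subseteq> \<Union>\<C>" "\<forall>V\<in>\<C>. openin X V"
      using opC by blast+
    then obtain F where "finite F" "F \<subseteq> \<C>" "K \<subseteq> \<Union>F"
      using K(1) unfolding compactin_def by meson
    then show ?thesis
      unfolding \<G>_def by blast
  qed
  ultimately show ?thesis
    by (intro that[of \<G>]) simp_all
qed

end

section \<open>Trunks determine the ends\<close>

context lc_Hausdorff
begin

lemma openin_Diff_closure_Un:
  assumes "finite F" "\<And>i. i \<in> F \<Longrightarrow> openin X (U i)" "openin X V" "F' \<subseteq> F"
  shows "openin X ((V - (\<Union>i\<in>F. X closure_of U i)) \<union> (\<Union>i\<in>F'. U i))"
  using assms by (intro openin_Un openin_diff openin_Union closedin_Union) auto

lemma ends_isolating_nbhd: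
  assumes "finite F" "e \<in> ends X" "F \<subseteq> ends X - {e}"
  obtains V where "cf_open X V" "e \<in> end_nbhd X V" "F \<inter> end_nbhd X V = {}"
proof -
  have "\<exists>V. cf_open X V \<and> e \<in> end_nbhd X V \<and> F \<inter> end_nbhd X V = {}"
    using assms(1,3)
  proof (induction F rule: finite_induct)
    case empty
    then show ?case
      using cf_open_topspace end_nbhd_topspace[OF assms(2)] by blast
  next
    case (insert d F)
    then obtain U where U: "cf_open X U" "e \<in> end_nbhd X U" "F \<inter> end_nbhd X U = {}"
      by blast
    have d: "d \<in> ends X" "e \<noteq> d"
      using insert(4) by auto
    obtain V where V: "cf_open X V" "e \<in> end_nbhd X V" "d \<in> end_nbhd X (topspace X - X closure_of V)"
      by (rule ends_separated[OF assms(2) d])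
    have "V \<inter> (topspace X - X closure_of V) = {}"
      using closure_of_subset[OF cf_openD(2)[OF V(1)]] by blast
    then have "d \<notin> end_nbhd X V"
      using end_nbhd_not_both[OF _ V(3)] by blast
    then have "cf_open X (U \<inter> V)" "e \<in> end_nbhd X (U \<inter> V)" "insert d F \<inter> end_nbhd X (U \<inter> V) = {}"
      using U V(1,2) by (simp_all add: cf_open_Int end_nbhd_Int) blast
    then show ?case by blast
  qed
  then show ?thesis
    using that by blast
qed

end

section \<open>Sets with compact frontier modulo bounded sets\<close>

context n_manifold
begin

text \<open>Up to bounded sets, \<open>V\<close> either contains or misses the one-ended set
  \<open>U i\<close>. So \<open>V'\<close> drops the closures of all \<open>U i\<close> and takes
  back, in \<open>F'\<close>, those that \<open>V\<close> almost contains. This moves the part of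
  the frontier inside the sets \<open>U i\<close> to their frontiers, which lie in
  \<open>G\<close>.\<close>

lemma cf_open_replace:
  assumes V: "cf_open X V" and F: "finite F" "\<And>i. i \<in> F \<Longrightarrow> cf_open X (U i)" "\<And>i. i \<in> F \<Longrightarrow> one_ended X (U i)"
    and fr: "\<And>i. i \<in> F \<Longrightarrow> X closure_of U i - U i \<subseteq> G"
    and VG: "X closure_of V - V \<subseteq> G \<union> (\<Union>i\<in>F. U i)"
  obtains V' K where "openin X V'" "bounded_subset X (V - V')" "bounded_subset X (V' - V)"
    "compactin X K" "K \<subseteq> G" "X closure_of V' - V' \<subseteq> K"
proof -
  define F' where "F' = {i \<in> F. bounded_subset X (U i - V)}"
  define V' where "V' = (V - (\<Union>i\<in>F. X closure_of U i)) \<union> (\<Union>i\<in>F'. U i)"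
  define K where "K = (X closure_of V - V - (\<Union>i\<in>F. U i)) \<union> (\<Union>i\<in>F. X closure_of U i - U i)"
  have F'F: "F' \<subseteq> F" and finF': "finite F'"
    unfolding F'_def using F(1) by auto
  have op: "openin X (U i)" if "i \<in> F" for i
    by (rule cf_openD(1)[OF F(2)[OF that]])
  have UU: "U i \<subseteq> X closure_of U i" if "i \<in> F" for i
    by (rule closure_of_subset[OF cf_openD(2)[OF F(2)[OF that]]])
  have opV': "openin X V'"
    unfolding V'_def by (rule openin_Diff_closure_Un[OF F(1) op cf_openD(1)[OF V] F'F])
  have "bounded_subset X (\<Union>((\<lambda>i. X closure_of U i - U i) ` F) \<union> \<Union>((\<lambda>i. U i \<inter> V) ` (F - F')))"
    unfolding bounded_subset_Un
  proof (intro conjI bounded_subset_Union)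
    fix S assume "S \<in> (\<lambda>i. X closure_of U i - U i) ` F"
    then show "bounded_subset X S"
      using F(2) unfolding cf_open_def by auto
  next
    fix S assume "S \<in> (\<lambda>i. U i \<inter> V) ` (F - F')"
    then obtain i where i: "i \<in> F" "i \<notin> F'" "S = U i \<inter> V" by blast
    then have "\<not> bounded_subset X (U i - V)"
      unfolding F'_def by simp
    then show "bounded_subset X S"
      using F(3)[OF i(1)] V i(3) unfolding one_ended_def by blast
  qed (use F(1) in simp_all)
  moreover have "V - V' \<subseteq> \<Union>((\<lambda>i. X closure_of U i - U i) ` F) \<union> \<Union>((\<lambda>i. U i \<inter> V) ` (F - F'))"
    unfolding V'_def by blast
  ultimately have b1: "bounded_subset X (V - V')"
    by (rule bounded_subset_mono)
  have "bounded_subset X (\<Union>((\<lambda>i. U i - V) ` F'))"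
    by (rule bounded_subset_Union) (use finF' in \<open>auto simp: F'_def\<close>)
  moreover have "V' - V \<subseteq> \<Union>((\<lambda>i. U i - V) ` F')"
    unfolding V'_def by blast
  ultimately have b2: "bounded_subset X (V' - V)"
    by (rule bounded_subset_mono)
  have "compactin X (X closure_of V - V - (\<Union>i\<in>F. U i))"
  proof (rule closed_compactin[OF compact_frontier[OF V]])
    have "openin X (\<Union>i\<in>F. U i)"
      using op by (intro openin_Union) auto
    then show "closedin X (X closure_of V - V - (\<Union>i\<in>F. U i))"
      by (intro closedin_diff closedin_closure_of cf_openD(1)[OF V])
  qed blast
  moreover have "compactin X (\<Union>i\<in>F. X closure_of U i - U i)"
    by (rule compactin_Union) (use F(1) compact_frontier[OF F(2)] in auto)
  ultimately have cK: "compactin X K"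
    unfolding K_def by (rule compactin_Un)
  have KG: "K \<subseteq> G"
    unfolding K_def using VG fr by blast
  have "X closure_of V' - V' \<subseteq> K"
  proof
    fix p assume p: "p \<in> X closure_of V' - V'"
    have clV': "X closure_of V' = X closure_of (V - (\<Union>i\<in>F. X closure_of U i)) \<union> \<Union>((\<lambda>i. X closure_of U i) ` F')"
    proof -
      have "X closure_of \<Union>(U ` F') = \<Union>((\<lambda>S. X closure_of S) ` (U ` F'))"
        using finF' by (simp add: closure_of_Union)
      then show ?thesis
        unfolding V'_def closure_of_Un by (simp add: image_image)
    qed
    show "p \<in> K"
    proof (cases "\<exists>i\<in>F. p \<in> X closure_of U i - U i")
      case True
      then show ?thesis
        unfolding K_def by blast
    next
      case False
      have "p \<notin> X closure_of U i" if "i \<in> F'" for i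
        using False p that F'F unfolding V'_def by blast
      then have p1: "p \<in> X closure_of (V - (\<Union>i\<in>F. X closure_of U i))"
        using p clV' by blast
      have "p \<notin> U i" if i: "i \<in> F" for i
      proof -
        have "U i \<inter> (V - (\<Union>i\<in>F. X closure_of U i)) = {}"
          using UU[OF i] i by blast
        from openin_Int_closure_of_empty[OF op[OF i] this] p1 show ?thesis by blast
      qed
      then have pU: "p \<notin> (\<Union>i\<in>F. X closure_of U i)" "p \<notin> (\<Union>i\<in>F. U i)"
        using False by blast+
      have "p \<in> X closure_of V"
        using p1 closure_of_mono[of "V - (\<Union>i\<in>F. X closure_of U i)" V X] by blast
      moreover have "p \<notin> V"
        using p pU(1) unfolding V'_def by blast
      ultimately show ?thesis
        unfolding K_def using pU(2) by blast
    qed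
  qed
  then show ?thesis
    by (rule that[OF opV' b1 b2 cK KG])
qed

text \<open>The frontier of \<open>V\<close> lies in \<open>N\<close>, so a component off the
  closure of \<open>N\<close> lies in \<open>V\<close> or misses it. There may be infinitely many
  components, but only finitely many leave the larger set \<open>N'\<close>, and the others are
  absorbed by its compact closure.\<close>

lemma cf_open_by_components:
  assumes V: "openin X V" and N: "openin X N" "compactin X (X closure_of N)" "N \<noteq> {}" "X closure_of V - V \<subseteq> N"
    and N': "openin X N'" "compactin X (X closure_of N')" "X closure_of N \<subseteq> N'"
  obtains S where "finite S" "S \<subseteq> components_off X (X closure_of N)"
    "bounded_subset X (V - \<Union>S)" "\<Union>S \<subseteq> V"
proof -
  let ?C = "X closure_of N"
  have cN: "closedin X ?C" by simp
  have NN: "N \<subseteq> ?C"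
    by (rule closure_of_subset[OF openin_subset[OF N(1)]])
  then have ne: "?C \<noteq> {}"
    using N(3) by blast
  define S where "S = {Y \<in> components_off X ?C. Y \<subseteq> V \<and> \<not> Y \<subseteq> N'}"
  have "finite {Y \<in> components_off X ?C. \<not> Y \<subseteq> N'}"
    by (rule finite_components_off[OF N(2) ne N'(1,3,2)])
  then have "finite S"
    unfolding S_def by (rule finite_subset[rotated]) blast
  moreover have "S \<subseteq> components_off X ?C" "\<Union>S \<subseteq> V"
    unfolding S_def by blast+
  moreover have "V - \<Union>S \<subseteq> N'"
  proof (rule subsetI, rule ccontr)
    fix x assume x: "x \<in> V - \<Union>S" "x \<notin> N'"
    then have "x \<in> topspace X - ?C"
      using openin_subset[OF V] N'(3) by blast
    then obtain Y where Y: "Y \<in> components_off X ?C" "x \<in> Y"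
      using components_off_cover[of ?C] by blast
    have "Y \<subseteq> V"
    proof (rule connectedin_subset_openin[OF components_offD(2)[OF cN Y(1)] V])
      show "Y \<inter> V \<noteq> {}"
        using x(1) Y(2) by blast
      show "Y \<inter> (X closure_of V - V) = {}"
        using components_offD(4)[OF cN Y(1)] N(4) NN by blast
    qed
    then have "Y \<in> S"
      unfolding S_def using Y x(2) by blast
    with x(1) Y(2) show False by blast
  qed
  then have "bounded_subset X (V - \<Union>S)"
    using bounded_subset_mono[OF compactin_imp_bounded_subset[OF N'(2)]]
      closure_of_subset[OF openin_subset[OF N'(1)]] by simp
  ultimately show ?thesis
    by (intro that[of S])
qed

lemma countable_cf_open_classes:
  assumes U: "\<And>i. i \<in> I \<Longrightarrow> cf_open X (U i)" "\<And>i. i \<in> I \<Longrightarrow> one_ended X (U i)"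
    and G: "openin X G" "second_countable (subtopology X G)" "G \<noteq> {}"
    and fr: "\<And>i. i \<in> I \<Longrightarrow> X closure_of U i - U i \<subseteq> G"
    and cover: "topspace X \<subseteq> G \<union> (\<Union>i\<in>I. U i)"
  obtains \<D> where "countable \<D>" "\<And>D. D \<in> \<D> \<Longrightarrow> cf_open X D"
    "\<And>V. cf_open X V \<Longrightarrow> \<exists>D\<in>\<D>. bounded_subset X (V - D) \<and> bounded_subset X (D - V)"
proof -
  obtain \<G> where \<G>: "countable \<G>" "\<And>N. N \<in> \<G> \<Longrightarrow> openin X N" "\<And>N. N \<in> \<G> \<Longrightarrow> compactin X (X closure_of N)"
    "\<And>N. N \<in> \<G> \<Longrightarrow> X closure_of N \<subseteq> G" "\<And>K. compactin X K \<Longrightarrow> K \<subseteq> G \<Longrightarrow> \<exists>N\<in>\<G>. K \<subseteq> N"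
    by (rule compact_exhaustion[OF G(1,2)]) (rule that)
  obtain x0 where x0: "x0 \<in> G"
    using G(3) by blast
  have x0X: "x0 \<in> topspace X"
    using x0 openin_subset[OF G(1)] by blast
  \<comment> \<open>The point \<open>x0\<close> keeps the closure of \<open>N\<close> nonempty; then
    each component off it comes close to it and meets \<open>G\<close>, which leaves countably
    many.\<close>
  define \<H> where "\<H> = {N \<in> \<G>. x0 \<in> N}"
  define \<D> where "\<D> = (\<Union>N\<in>\<H>. Union ` {S. finite S \<and> S \<subseteq> components_off X (X closure_of N)})"
  have NN: "N \<subseteq> X closure_of N" if "N \<in> \<G>" for N
    by (rule closure_of_subset[OF openin_subset[OF \<G>(2)[OF that]]])
  have ne: "X closure_of N \<noteq> {}" if "N \<in> \<H>" for N
    using that NN[of N] unfolding \<H>_def by blast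
  have \<H>\<G>: "N \<in> \<G>" if "N \<in> \<H>" for N
    using that unfolding \<H>_def by blast
  have "countable \<D>"
    unfolding \<D>_def
  proof (rule countable_UN)
    show "countable \<H>"
      unfolding \<H>_def using \<G>(1) by simp
    fix N assume N: "N \<in> \<H>"
    have "countable (components_off X (X closure_of N))"
      by (rule countable_components_off[OF closedin_closure_of ne[OF N] G(1,2) \<G>(4)[OF \<H>\<G>[OF N]]])
    then show "countable (Union ` {S. finite S \<and> S \<subseteq> components_off X (X closure_of N)})"
      by (intro countable_image countable_Collect_finite_subset)
  qed
  moreover have "cf_open X D" if D: "D \<in> \<D>" for D
  proof -
    obtain N S where N: "N \<in> \<H>" and S: "finite S" "S \<subseteq> components_off X (X closure_of N)" "D = \<Union>S"
      using D unfolding \<D>_def by blast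
    have "cf_open X Y" if "Y \<in> S" for Y
    proof -
      have Y: "Y \<in> components_off X (X closure_of N)"
        using that S(2) by blast
      show ?thesis
        by (rule cf_openI[OF components_offD(1)[OF closedin_closure_of Y]
              compactin_imp_bounded_subset[OF \<G>(3)[OF \<H>\<G>[OF N]]] components_offD(5)[OF closedin_closure_of Y]])
    qed
    then show ?thesis
      unfolding S(3) by (rule cf_open_Union[OF S(1)])
  qed
  moreover have "\<exists>D\<in>\<D>. bounded_subset X (V - D) \<and> bounded_subset X (D - V)" if V: "cf_open X V" for V
  proof -
    have cV: "compactin X (X closure_of V - V)"
      by (rule compact_frontier[OF V])
    have "\<forall>W\<in>insert G (U ` I). openin X W" "X closure_of V - V \<subseteq> \<Union>(insert G (U ` I))"
      using G(1) cf_openD(1)[OF U(1)] cover closure_of_subset_topspace[of X V] by (blast, auto)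
    then obtain \<F> where \<F>: "finite \<F>" "\<F> \<subseteq> insert G (U ` I)" "X closure_of V - V \<subseteq> \<Union>\<F>"
      using cV unfolding compactin_def by meson
    have "finite (\<F> - {G})" "\<F> - {G} \<subseteq> U ` I"
      using \<F>(1,2) by auto
    then obtain F where F: "F \<subseteq> I" "finite F" "\<F> - {G} = U ` F"
      using finite_subset_image[of "\<F> - {G}" U I] by auto
    have "X closure_of V - V \<subseteq> G \<union> (\<Union>i\<in>F. U i)"
      using \<F>(3) F(3) by blast
    moreover have "cf_open X (U i)" "one_ended X (U i)" "X closure_of U i - U i \<subseteq> G" if "i \<in> F" for i
      using U(1)[of i] U(2)[of i] fr[of i] that F(1) by blast+
    ultimately obtain V' K where V': "openin X V'" "bounded_subset X (V - V')" "bounded_subset X (V' - V)"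
      and K: "compactin X K" "K \<subseteq> G" "X closure_of V' - V' \<subseteq> K"
      using cf_open_replace[OF V F(2), of U G] by metis
    have "compactin X (insert x0 K)" "insert x0 K \<subseteq> G"
      using K(1,2) x0 x0X by (auto intro: finite_imp_compactin_eq[THEN iffD2] compactin_Un[of X "{x0}" K, simplified])
    then obtain N where N: "N \<in> \<G>" "insert x0 K \<subseteq> N"
      using \<G>(5) by blast
    have NH: "N \<in> \<H>"
      unfolding \<H>_def using N by simp
    obtain N' where N': "N' \<in> \<G>" "X closure_of N \<subseteq> N'"
      using \<G>(5)[OF \<G>(3)[OF N(1)] \<G>(4)[OF N(1)]] by blast
    have "N \<noteq> {}" "X closure_of V' - V' \<subseteq> N"
      using N(2) K(3) by blast+
    then obtain S where S: "finite S" "S \<subseteq> components_off X (X closure_of N)"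
      "bounded_subset X (V' - \<Union>S)" "\<Union>S \<subseteq> V'"
      by (rule cf_open_by_components[OF V'(1) \<G>(2)[OF N(1)] \<G>(3)[OF N(1)] _ _ \<G>(2)[OF N'(1)] \<G>(3)[OF N'(1)] N'(2)])
    have "\<Union>S \<in> \<D>"
      unfolding \<D>_def using NH S(1,2) by blast
    moreover have "bounded_subset X (V - \<Union>S)"
    proof (rule bounded_subset_mono)
      show "bounded_subset X ((V - V') \<union> (V' - \<Union>S))"
        using V'(2) S(3) by simp
    qed blast
    moreover have "bounded_subset X (\<Union>S - V)"
      by (rule bounded_subset_mono[OF V'(3)]) (use S(4) in blast)
    ultimately show ?thesis by blast
  qed
  ultimately show ?thesis
    by (rule that)
qed

text \<open>An end in some \<open>U i\<close> is the only one there and is long by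
  omega-boundedness. For an end in no \<open>U i\<close>, all exteriors of the sets
  \<open>U i\<close> are neighbourhoods, and together with the countable family of
  \<open>countable_cf_open_classes\<close> they exhibit it as a countable intersection of open
  sets.\<close>

lemma second_countable_ends_and_dichotomy:
  assumes tI: "type_I X" and I: "countable I"
    and U: "\<And>i. i \<in> I \<Longrightarrow> cf_open X (U i)" "\<And>i. i \<in> I \<Longrightarrow> one_ended X (U i)"
      "\<And>i. i \<in> I \<Longrightarrow> omega_bounded X (U i)"
    and L: "Lindelof_in X L" "topspace X - L \<subseteq> (\<Union>i\<in>I. U i)" "\<And>i. i \<in> I \<Longrightarrow> X closure_of U i - U i \<subseteq> L"
    and x0: "x0 \<in> topspace X"
  shows "second_countable (end_space X) \<and> end_dichotomy X"
proof -
  have "Lindelof_in X (L \<union> {x0})"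
    by (rule Lindelof_in_Un[OF L(1) compactin_imp_Lindelof_in]) (use x0 in simp)
  then obtain G where G: "openin X G" "second_countable (subtopology X G)" "L \<union> {x0} \<subseteq> G"
    by (rule second_countable_nbhd)
  have Gne: "G \<noteq> {}"
    using G(3) by blast
  have fr: "X closure_of U i - U i \<subseteq> G" if "i \<in> I" for i
    using L(3)[OF that] G(3) by blast
  have cover: "topspace X \<subseteq> G \<union> (\<Union>i\<in>I. U i)"
    using L(2) G(3) by blast
  obtain \<D> where D: "countable \<D>" "\<And>D. D \<in> \<D> \<Longrightarrow> cf_open X D"
    "\<And>V. cf_open X V \<Longrightarrow> \<exists>D\<in>\<D>. bounded_subset X (V - D) \<and> bounded_subset X (D - V)"
    by (rule countable_cf_open_classes[OF U(1,2) G(1,2) Gne fr cover]) (assumption+, rule that)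
  obtain \<G> where \<G>: "countable \<G>" "\<And>N. N \<in> \<G> \<Longrightarrow> openin X N" "\<And>N. N \<in> \<G> \<Longrightarrow> compactin X (X closure_of N)"
    "\<And>N. N \<in> \<G> \<Longrightarrow> X closure_of N \<subseteq> G" "\<And>K. compactin X K \<Longrightarrow> K \<subseteq> G \<Longrightarrow> \<exists>N\<in>\<G>. K \<subseteq> N"
    by (rule compact_exhaustion[OF G(1,2)]) (rule that)
  have "long_end X e \<or> short_end X e" if e: "e \<in> ends X" for e
  proof (cases "\<exists>i\<in>I. e \<in> end_nbhd X (U i)")
    case True
    then obtain i where i: "i \<in> I" "e \<in> end_nbhd X (U i)" by blast
    have "ends X \<inter> end_nbhd X (U i) \<subseteq> {e}"
      using one_ended_unique[OF U(2)[OF i(1)] e i(2)] by blast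
    then have "long_end X e"
      by (rule omega_bounded_imp_long_end[OF e cf_openD(1)[OF U(1)[OF i(1)]] i(2) _ U(3)[OF i(1)]])
    then show ?thesis ..
  next
    case False
    \<comment> \<open>The first family separates \<open>e\<close> from the other ends. The second
      and third remove the points of the sets \<open>U i\<close> and of \<open>G\<close>, which
      cover \<open>X\<close>, so that no point of \<open>X\<close> is left in the
      intersection.\<close>
    define \<W> where "\<W> = {D \<in> \<D>. e \<in> end_nbhd X D} \<union> (\<lambda>i. topspace X - X closure_of U i) ` I
      \<union> (\<lambda>N. topspace X - X closure_of N) ` \<G> \<union> {topspace X}"
    have "short_end X e"
    proof (rule short_endI[OF e, of \<W>])
      show "countable \<W>"
        unfolding \<W>_def using D(1) I \<G>(1) by simp
      show "\<W> \<noteq> {}"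
        unfolding \<W>_def by blast
      show "openin X W" if "W \<in> \<W>" for W
        using that cf_openD(1)[OF D(2)] unfolding \<W>_def by (elim UnE) (auto intro: openin_diff)
      show "e \<in> end_nbhd X W" if W: "W \<in> \<W>" for W
      proof -
        consider "e \<in> end_nbhd X W" | i where "i \<in> I" "W = topspace X - X closure_of U i"
          | N where "N \<in> \<G>" "W = topspace X - X closure_of N" | "W = topspace X"
          using W unfolding \<W>_def by blast
        then show ?thesis
        proof cases
          case (2 i)
          then show ?thesis
            using end_cases[OF e U(1)[OF 2(1)]] False by blast
        next
          case (3 N)
          then show ?thesis
            using end_nbhd_Compl[OF e compactin_imp_bounded_subset[OF \<G>(3)[OF 3(1)]]] by simp
        next
          case 4
          then show ?thesis
            using end_nbhd_topspace[OF e] by simp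
        qed
      qed
      show "\<Inter>\<W> = {}"
      proof (rule equals0I)
        fix x assume x: "x \<in> \<Inter>\<W>"
        then have xX: "x \<in> topspace X"
          unfolding \<W>_def by blast
        show False
        proof (cases "x \<in> G")
          case True
          then have "compactin X {x}" "{x} \<subseteq> G"
            using xX by simp_all
          then obtain N where N: "N \<in> \<G>" "{x} \<subseteq> N"
            using \<G>(5) by blast
          then have "x \<in> X closure_of N"
            using closure_of_subset[OF openin_subset[OF \<G>(2)[OF N(1)]]] by blast
          moreover have "topspace X - X closure_of N \<in> \<W>"
            unfolding \<W>_def using N(1) by blast
          ultimately show False
            using x by blast
        next
          case False
          then obtain i where i: "i \<in> I" "x \<in> U i"
            using cover xX by blast
          then have "x \<in> X closure_of U i"
            using closure_of_subset[OF cf_openD(2)[OF U(1)[OF i(1)]]] by blast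
          moreover have "topspace X - X closure_of U i \<in> \<W>"
            unfolding \<W>_def using i(1) by blast
          ultimately show False
            using x by blast
        qed
      qed
      show "\<exists>W\<in>\<W>. d \<notin> end_nbhd X W" if d: "d \<in> ends X" "d \<noteq> e" for d
      proof -
        obtain V where V: "cf_open X V" "e \<in> end_nbhd X V" "d \<in> end_nbhd X (topspace X - X closure_of V)"
          by (rule ends_separated[OF e d(1)]) (use d(2) in simp, rule that)
        obtain D' where D': "D' \<in> \<D>" "bounded_subset X (V - D')" "bounded_subset X (D' - V)"
          using D(3)[OF V(1)] by blast
        have eq: "ends X \<inter> end_nbhd X V \<subseteq> end_nbhd X D'" "ends X \<inter> end_nbhd X D' \<subseteq> end_nbhd X V"
          using end_nbhd_subset_iff[OF V(1)] end_nbhd_subset_iff[OF D(2)[OF D'(1)]] D'(2,3) by simp_all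
        have "V \<inter> (topspace X - X closure_of V) = {}"
          using closure_of_subset[OF cf_openD(2)[OF V(1)]] by blast
        then have "d \<notin> end_nbhd X V"
          using end_nbhd_not_both[OF _ V(3)] by blast
        then have "d \<notin> end_nbhd X D'"
          using eq(2) d(1) by blast
        moreover have "D' \<in> \<W>"
          unfolding \<W>_def using D'(1) eq(1) e V(2) by blast
        ultimately show ?thesis by blast
      qed
    qed
    then show ?thesis ..
  qed
  then have "end_dichotomy X"
    unfolding end_dichotomy_def by blast
  with second_countable_end_space[OF D] show ?thesis
    by blast
qed

text \<open>The ends in the exterior of an isolating neighbourhood \<open>U\<close> of the long end
  are finitely many and short, so the exterior is a countable union of bounded sets; only the
  compact frontier has to be added.\<close>

lemma long_trunk_core:
  assumes fin: "finite (ends X)" and edp: "end_dichotomy X" and one: "\<exists>!e. long_end X e"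
  obtains U where "cf_open X U" "omega_bounded X U" "one_ended X U" "Lindelof_in X (topspace X - U)"
proof -
  obtain e where e: "long_end X e" and uniq: "\<And>d. long_end X d \<Longrightarrow> d = e"
    using one by blast
  have eE: "e \<in> ends X"
    using e unfolding long_end_def by blast
  obtain U where U: "cf_open X U" "e \<in> end_nbhd X U" "(ends X - {e}) \<inter> end_nbhd X U = {}"
    by (rule ends_isolating_nbhd[OF _ eE order_refl]) (use fin in simp)
  have o: "ends X \<inter> end_nbhd X U \<subseteq> {e}"
    using U(3) by blast
  let ?A = "topspace X - X closure_of U"
  have cfA: "cf_open X ?A"
    by (rule cf_open_Compl[OF U(1)])
  have UU: "U \<subseteq> X closure_of U"
    by (rule closure_of_subset[OF cf_openD(2)[OF U(1)]])
  have "U \<inter> ?A = {}"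
    using UU by blast
  then have eA: "e \<notin> end_nbhd X ?A"
    using end_nbhd_not_both[OF U(2), of ?A] by blast
  have sh: "short_end X d" if "d \<in> ends X \<inter> end_nbhd X ?A" for d
  proof -
    have "d \<noteq> e" "d \<in> ends X"
      using that eA by blast+
    then show ?thesis
      using edp uniq unfolding end_dichotomy_def by blast
  qed
  obtain B :: "nat \<Rightarrow> 'a set" where B: "\<And>n. bounded_subset X (B n)" "?A = (\<Union>n. B n)"
    by (rule short_ends_sigma_compact[OF cfA _ sh]) (use fin in simp, assumption, rule that)
  have "Lindelof_in X (\<Union>n. B n)"
    by (rule Lindelof_in_UN) (simp_all add: bounded_imp_Lindelof_in[OF B(1)])
  then have "Lindelof_in X (?A \<union> (X closure_of U - U))"
    unfolding B(2) by (rule Lindelof_in_Un[OF _ compactin_imp_Lindelof_in[OF compact_frontier[OF U(1)]]])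
  then have "Lindelof_in X (topspace X - U)"
    by (rule Lindelof_in_subset) blast
  then show ?thesis
    using that[OF U(1) long_end_imp_omega_bounded[OF e U(1) o] one_endedI[OF U(1) o]] by simp
qed

end

section \<open>From a trunk to the ambient manifold\<close>

lemma bounded_subset_subtopology:
  "bounded_subset (subtopology X T) S \<Longrightarrow> bounded_subset X S"
  unfolding bounded_subset_def by (auto simp: compactin_subtopology)

context n_manifold
begin

text \<open>Near a point \<open>p\<close> of the closure, \<open>U\<close> has a countable dense
  subset. It lies in a compact subset of \<open>T\<close>, which is closed in \<open>X\<close> and
  therefore contains \<open>p\<close>.\<close>

lemma closure_of_omega_bounded:
  assumes ob: "omega_bounded (subtopology X T) U" and U: "U \<subseteq> T" "T \<subseteq> topspace X"
  shows "X closure_of U \<subseteq> T"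
proof
  fix p assume p: "p \<in> X closure_of U"
  then have "p \<in> topspace X"
    using closure_of_subset_topspace[of X U] by blast
  then have "Lindelof_in X {p}"
    by (intro compactin_imp_Lindelof_in) simp
  then obtain G where G: "openin X G" "second_countable (subtopology X G)" "{p} \<subseteq> G"
    by (rule second_countable_nbhd)
  have "Lindelof_in X G"
    unfolding Lindelof_in_def using G(1,2) openin_subset second_countable_imp_Lindelof_space by blast
  then have "Lindelof_in X (U \<inter> G)"
    by (rule Lindelof_in_subset) blast
  then obtain C where C: "countable C" "C \<subseteq> U \<inter> G" "U \<inter> G \<subseteq> X closure_of C"
    by (rule countable_dense_subset)
  have "bounded_subset (subtopology X T) C"
    using ob C(1,2) unfolding omega_bounded_def by simp
  then obtain K where K: "compactin X K" "K \<subseteq> T" "C \<subseteq> K"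
    unfolding bounded_subset_def by (auto simp: compactin_subtopology)
  have "p \<in> X closure_of (U \<inter> G)"
    using p G(1,3) openin_Int_closure_of_subset[of X G U] by (auto simp: Int_commute)
  also have "\<dots> \<subseteq> X closure_of C"
    using closure_of_minimal[OF C(3) closedin_closure_of] .
  also have "\<dots> \<subseteq> K"
    by (rule closure_of_minimal[OF K(3) compactin_imp_closedin[OF Haus K(1)]])
  finally show "p \<in> T"
    using K(2) by blast
qed

text \<open>By \<open>closure_of_omega_bounded\<close> the closure of \<open>U\<close> is the same
  in \<open>T\<close> and in \<open>X\<close>, and so is its frontier. For one-endedness a test set
  \<open>V\<close> of \<open>X\<close> is replaced by \<open>U \<inter> V\<close>, whose closure
  stays in \<open>T\<close>.\<close>

lemma trunk_core_transfer:
  assumes T: "openin X T" and U: "cf_open (subtopology X T) U" "omega_bounded (subtopology X T) U"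
    "one_ended (subtopology X T) U"
  shows "cf_open X U" "omega_bounded X U" "one_ended X U"
proof -
  let ?Y = "subtopology X T"
  have TX: "T \<subseteq> topspace X"
    by (rule openin_subset[OF T])
  have UT: "U \<subseteq> T"
    using cf_openD(2)[OF U(1)] by auto
  have clT: "X closure_of U \<subseteq> T"
    by (rule closure_of_omega_bounded[OF U(2) UT TX])
  have cl: "?Y closure_of U = X closure_of U"
    unfolding closure_of_subtopology using clT UT by (simp add: inf_absorb2)
  have op: "openin X U"
    using cf_openD(1)[OF U(1)] T by (rule openin_trans_full)
  show "cf_open X U"
    unfolding cf_open_def
  proof (rule conjI[OF op], rule bounded_subset_subtopology)
    show "bounded_subset ?Y (X closure_of U - U)"
      using U(1) unfolding cf_open_def cl by blast
  qed
  show "omega_bounded X U"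
    using U(2) bounded_subset_subtopology[of X T] unfolding omega_bounded_def by simp
  show "one_ended X U"
    unfolding one_ended_def
  proof (intro allI impI)
    fix V assume V: "cf_open X V"
    have "cf_open ?Y (U \<inter> V)"
      unfolding cf_open_def
    proof
      show "openin ?Y (U \<inter> V)"
        using op cf_openD(1)[OF V] UT by (intro subset_openin_subtopology) auto
      have "compactin X (X closure_of (U \<inter> V) - U \<inter> V)"
      proof (rule closed_compactin)
        show "compactin X ((X closure_of U - U) \<union> (X closure_of V - V))"
          using compact_frontier[OF \<open>cf_open X U\<close>] compact_frontier[OF V] by (rule compactin_Un)
        show "X closure_of (U \<inter> V) - U \<inter> V \<subseteq> (X closure_of U - U) \<union> (X closure_of V - V)"
          using closure_of_mono[of "U \<inter> V" U X] closure_of_mono[of "U \<inter> V" V X] by blast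
        show "closedin X (X closure_of (U \<inter> V) - U \<inter> V)"
          using op cf_openD(1)[OF V] by (intro closedin_diff closedin_closure_of openin_Int)
      qed
      moreover have sub: "X closure_of (U \<inter> V) \<subseteq> T"
        using clT closure_of_mono[of "U \<inter> V" U X] by blast
      ultimately have "compactin ?Y (X closure_of (U \<inter> V) - U \<inter> V)"
        unfolding compactin_subtopology by blast
      moreover have "?Y closure_of (U \<inter> V) = X closure_of (U \<inter> V)"
        unfolding closure_of_subtopology using sub UT by (simp add: inf_absorb2 le_infI1)
      ultimately show "bounded_subset ?Y (?Y closure_of (U \<inter> V) - U \<inter> V)"
        using compactin_imp_bounded_subset by simp
    qed
    then have "bounded_subset ?Y (U \<inter> (U \<inter> V)) \<or> bounded_subset ?Y (U - U \<inter> V)"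
      using U(3) unfolding one_ended_def by blast
    moreover have "U \<inter> (U \<inter> V) = U \<inter> V" "U - U \<inter> V = U - V"
      by blast+
    ultimately show "bounded_subset X (U \<inter> V) \<or> bounded_subset X (U - V)"
      using bounded_subset_subtopology by metis
  qed
qed

text \<open>Trunks may accumulate, so a point in the closure of their union need not be near any
  particular one. But off \<open>X closure_of S\<close> a point has a connected neighbourhood that
  meets some \<open>T i\<close>, hence \<open>U i\<close>, without meeting the frontier of
  \<open>U i\<close>; so it lies in \<open>U i\<close>.\<close>

theorem trunks_imp_second_countable_ends:
  assumes tI: "type_I X" and I: "countable I"
    and T: "\<And>i. i \<in> I \<Longrightarrow> embedded_long_trunk X (T i)"
    and L: "Lindelof_space (subtopology X (topspace X - X closure_of (\<Union>i\<in>I. T i)))"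
  shows "second_countable (end_space X) \<and> end_dichotomy X"
proof (cases "topspace X = {}")
  \<comment> \<open>\<open>connected_space\<close> admits the empty space. It has no ends, because
    no end lies in a bounded set.\<close>
  case True
  have "ends X = {}"
  proof (rule equals0I)
    fix e assume e: "e \<in> ends X"
    show False
      using end_nbhd_unbounded[OF e end_nbhd_topspace[OF e]] True by simp
  qed
  then have "end_dichotomy X" "topspace (end_space X) = {}"
    unfolding end_dichotomy_def end_space_def by simp_all
  moreover from this(2) have "second_countable (end_space X)"
    unfolding second_countable_def by (intro exI[of _ "{}"]) (auto dest: openin_subset)
  ultimately show ?thesis by blast
next
  case False
  have "\<exists>U. openin X (T i) \<and> U \<subseteq> T i \<and> cf_open X U \<and> omega_bounded X U \<and> one_ended X U \<and> Lindelof_in X (T i - U)"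
    if i: "i \<in> I" for i
  proof -
    let ?Y = "subtopology X (T i)"
    have TX: "T i \<subseteq> topspace X" and lt: "long_trunk ?Y"
      and "\<exists>m. manifold_of_dim m X \<and> manifold_of_dim m ?Y"
      using T[OF i] unfolding embedded_long_trunk_def by blast+
    then obtain m where m: "manifold_of_dim m X" "manifold_of_dim m ?Y" by blast
    have op: "openin X (T i)"
      by (rule openin_if_manifold_of_same_dim[OF m TX])
    interpret Y: n_manifold ?Y m
      by unfold_locales (rule m(2))
    have tY: "topspace ?Y = T i"
      using TX by auto
    obtain U where U: "cf_open ?Y U" "omega_bounded ?Y U" "one_ended ?Y U" "Lindelof_in ?Y (topspace ?Y - U)"
      by (rule Y.long_trunk_core) (use lt in \<open>unfold long_trunk_def, blast+\<close>)
    have UT: "U \<subseteq> T i"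
      using cf_openD(2)[OF U(1)] tY by simp
    have "Lindelof_in X (T i - U)"
      using U(4) TX unfolding Lindelof_in_def tY by (auto simp: subtopology_subtopology inf_absorb2)
    then show ?thesis
      using op UT trunk_core_transfer[OF op U(1-3)] by blast
  qed
  then have "\<forall>i\<in>I. \<exists>U. openin X (T i) \<and> U \<subseteq> T i \<and> cf_open X U \<and> omega_bounded X U \<and> one_ended X U \<and> Lindelof_in X (T i - U)"
    by (rule ballI)
  from bchoice[OF this] obtain U where
    *: "\<forall>i\<in>I. openin X (T i) \<and> U i \<subseteq> T i \<and> cf_open X (U i) \<and> omega_bounded X (U i) \<and> one_ended X (U i) \<and> Lindelof_in X (T i - U i)"
    by (elim exE) (rule that)
  have U: "\<And>i. i \<in> I \<Longrightarrow> openin X (T i)" "\<And>i. i \<in> I \<Longrightarrow> U i \<subseteq> T i" "\<And>i. i \<in> I \<Longrightarrow> cf_open X (U i)"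
    "\<And>i. i \<in> I \<Longrightarrow> omega_bounded X (U i)" "\<And>i. i \<in> I \<Longrightarrow> one_ended X (U i)" "\<And>i. i \<in> I \<Longrightarrow> Lindelof_in X (T i - U i)"
    using * by simp_all
  define S where "S = (topspace X - X closure_of (\<Union>i\<in>I. T i)) \<union> (\<Union>i\<in>I. T i - U i) \<union> (\<Union>i\<in>I. X closure_of U i - U i)"
  have "Lindelof_in X S"
    unfolding S_def
  proof (intro Lindelof_in_Un Lindelof_in_UN I)
    show "Lindelof_in X (topspace X - X closure_of (\<Union>i\<in>I. T i))"
      unfolding Lindelof_in_def using L by blast
    show "Lindelof_in X (T i - U i)" if "i \<in> I" for i
      by (rule U(6)[OF that])
    show "Lindelof_in X (X closure_of U i - U i)" if "i \<in> I" for i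
      by (rule compactin_imp_Lindelof_in[OF compact_frontier[OF U(3)[OF that]]])
  qed
  then have LL: "Lindelof_in X (X closure_of S)"
    by (rule type_I_Lindelof_closure[OF tI])
  have SX: "S \<subseteq> X closure_of S"
    by (rule closure_of_subset) (use \<open>Lindelof_in X S\<close> in \<open>simp add: Lindelof_in_def\<close>)
  have cover: "topspace X - X closure_of S \<subseteq> (\<Union>i\<in>I. U i)"
  proof
    fix x assume x: "x \<in> topspace X - X closure_of S"
    have op: "openin X (topspace X - X closure_of S)"
      by (intro openin_diff openin_topspace closedin_closure_of)
    obtain D where D: "openin X D" "connectedin X D" "x \<in> D" "D \<subseteq> topspace X - X closure_of S"
      by (rule connected_nbhd[OF op x])
    have "x \<in> X closure_of (\<Union>i\<in>I. T i)"
      using x SX unfolding S_def by blast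
    then have "\<exists>y. y \<in> (\<Union>i\<in>I. T i) \<and> y \<in> D"
      unfolding in_closure_of using D(1,3) by simp
    then obtain i y where y: "i \<in> I" "y \<in> T i" "y \<in> D" by blast
    have "y \<in> U i"
      using y D(4) SX unfolding S_def by blast
    have "D \<subseteq> U i"
    proof (rule connectedin_subset_openin[OF D(2) cf_openD(1)[OF U(3)[OF y(1)]]])
      show "D \<inter> U i \<noteq> {}"
        using y(3) \<open>y \<in> U i\<close> by blast
      show "D \<inter> (X closure_of U i - U i) = {}"
        using D(4) SX y(1) unfolding S_def by blast
    qed
    with D(3) y(1) show "x \<in> (\<Union>i\<in>I. U i)"
      by blast
  qed
  have fr: "X closure_of U i - U i \<subseteq> X closure_of S" if "i \<in> I" for i
    using SX that unfolding S_def by blast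
  obtain x0 where x0: "x0 \<in> topspace X"
    using False by blast
  show ?thesis
    by (rule second_countable_ends_and_dichotomy[OF tI I U(3,5,4) LL cover fr x0]) assumption+
qed

end

section \<open>Finiteness of the number of ends at a compact set\<close>

lemma continuous_map_complex_mult:
  fixes f g :: "'a \<Rightarrow> complex"
  assumes "continuous_map X euclidean f" "continuous_map X euclidean g"
  shows "continuous_map X euclidean (\<lambda>x. f x * g x)"
  using assms by (simp add: continuous_map_atin tendsto_mult)

lemma continuous_map_exp_compose:
  fixes a :: complex
  assumes "continuous_map X euclideanreal \<phi>"
  shows "continuous_map X euclidean (\<lambda>x. exp (a * of_real (\<phi> x - 1)))"
proof -
  have "continuous_map euclideanreal euclidean (\<lambda>t::real. exp (a * of_real (t - 1)))"
    by (auto intro!: continuous_intros)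
  from continuous_map_compose[OF assms this] show ?thesis
    by (simp add: o_def)
qed

lemma connectedin_finite_image_constant:
  fixes g :: "'a \<Rightarrow> complex"
  assumes Y: "connectedin X Y" and g: "continuous_map (subtopology X Y) euclidean g"
    and fin: "finite A" "\<And>y. y \<in> Y \<Longrightarrow> g y \<in> A" and xy: "x \<in> Y" "y \<in> Y"
  shows "g x = g y"
proof -
  have YX: "Y \<subseteq> topspace X"
    by (rule connectedin_subset_topspace[OF Y])
  have "connectedin (subtopology X Y) Y"
    using Y by (simp add: connectedin_subtopology)
  then have "connectedin euclidean (g ` Y)"
    by (rule connectedin_continuous_map_image[OF g])
  then have "connected (g ` Y)"
    by simp
  moreover have "finite (g ` Y)"
    by (rule finite_subset[OF _ fin(1)]) (use fin(2) in blast)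
  ultimately have "g ` Y = {} \<or> (\<exists>a. g ` Y = {a})"
    using connected_finite_iff_sing by blast
  moreover have "g x \<in> g ` Y" "g y \<in> g ` Y"
    using xy by simp_all
  ultimately show ?thesis
    by (metis empty_iff singletonD)
qed

lemma continuous_map_if_openin:
  assumes V: "openin X V" and f: "continuous_map X Y f" and g: "continuous_map X Y g"
    and eq: "\<And>x. x \<in> X closure_of V - V \<Longrightarrow> f x = g x"
  shows "continuous_map X Y (\<lambda>x. if x \<in> V then f x else g x)"
proof (rule continuous_map_cases)
  show "f x = g x" if "x \<in> X frontier_of {x. x \<in> V}" for x
    by (rule eq) (use that V in \<open>simp add: frontier_of_def interior_of_openin\<close>)
qed (intro continuous_map_from_subtopology f g)+

text \<open>
  The sign patterns on finitely many overlaps of charts play the role of a finite first cohomology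
  group with coefficients \<open>\<int>/2\<close>: functions with the same pattern have a product with a
  square root on all of \<open>Q\<close>.
\<close>

context n_manifold
begin

lemma chart_sqrt:
  assumes "x \<in> topspace X"
  obtains W where "openin X W" "x \<in> W" "has_sqrts (subtopology X W)"
  by (rule chart[OF assms]) (rule that, assumption+, rule has_sqrts_homeomorphic[OF _ has_sqrts_Euclidean_space])

lemma finite_sqrt_classes:
  assumes Q: "compactin X Q"
  shows "\<exists>m::nat. \<forall>(\<J> :: 'j set) f. finite \<J> \<and> m < card \<J> \<and>
      (\<forall>J\<in>\<J>. continuous_map X euclidean (f J) \<and> (\<forall>x\<in>topspace X. f J x \<noteq> (0::complex))) \<longrightarrow>
      (\<exists>J\<in>\<J>. \<exists>J'\<in>\<J>. J \<noteq> J' \<and>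
        (\<exists>s. continuous_map (subtopology X Q) euclidean s \<and> (\<forall>x\<in>Q. (s x)\<^sup>2 = f J x * f J' x)))"
proof -
  have QX: "Q \<subseteq> topspace X"
    by (rule compactin_subset_topspace[OF Q])
  have "\<exists>W N. openin X W \<and> has_sqrts (subtopology X W) \<and> openin X N \<and> q \<in> N \<and>
      compactin X (X closure_of N) \<and> X closure_of N \<subseteq> W" if q: "q \<in> topspace X" for q
  proof -
    obtain W where W: "openin X W" "q \<in> W" "has_sqrts (subtopology X W)"
      by (rule chart_sqrt[OF q])
    have "compactin X {q}" "{q} \<subseteq> W"
      using q W(2) by simp_all
    then obtain N where "openin X N" "{q} \<subseteq> N" "compactin X (X closure_of N)" "X closure_of N \<subseteq> W"
      by (rule compact_nbhd_in[OF _ W(1)])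
    with W show ?thesis by blast
  qed
  then obtain W N where WN: "\<And>q. q \<in> topspace X \<Longrightarrow> openin X (W q)" "\<And>q. q \<in> topspace X \<Longrightarrow> has_sqrts (subtopology X (W q))"
    "\<And>q. q \<in> topspace X \<Longrightarrow> openin X (N q)" "\<And>q. q \<in> topspace X \<Longrightarrow> q \<in> N q"
    "\<And>q. q \<in> topspace X \<Longrightarrow> X closure_of N q \<subseteq> W q"
    by metis
  have "\<forall>U\<in>N ` Q. openin X U" "Q \<subseteq> \<Union>(N ` Q)"
    using WN(3,4) QX by blast+
  then obtain \<F> where "finite \<F>" "\<F> \<subseteq> N ` Q" "Q \<subseteq> \<Union>\<F>"
    using Q unfolding compactin_def by meson
  then obtain P where P: "P \<subseteq> Q" "finite P" "Q \<subseteq> \<Union>(N ` P)"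
    using finite_subset_image[of \<F> N Q] by auto
  have PX: "p \<in> topspace X" if "p \<in> P" for p
    using that P(1) QX by blast
  \<comment> \<open>Closed pieces of \<open>Q\<close>, each inside a chart: functions on finitely
    many closed sets can be pasted, and the overlaps are compact.\<close>
  define R where "R p = Q \<inter> X closure_of N p" for p
  have clQ: "closedin X Q"
    by (rule compactin_imp_closedin[OF Haus Q])
  have RW: "R p \<subseteq> W p" if "p \<in> P" for p
    using WN(5)[OF PX[OF that]] unfolding R_def by blast
  have RQ: "R p \<subseteq> Q" for p
    unfolding R_def by blast
  have clR: "closedin X (R p)" for p
    unfolding R_def using clQ by (intro closedin_Int) auto
  have QR: "Q \<subseteq> \<Union>(R ` P)"
  proof
    fix x assume x: "x \<in> Q"
    then obtain p where p: "p \<in> P" "x \<in> N p"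
      using P(3) by blast
    then have "x \<in> X closure_of N p"
      using closure_of_subset[OF openin_subset[OF WN(3)[OF PX[OF p(1)]]]] by blast
    with p(1) x show "x \<in> \<Union>(R ` P)"
      unfolding R_def by blast
  qed
  define C where "C p q = connected_components_of (subtopology X (W p \<inter> W q))" for p q
  have C: "openin X Y \<and> connectedin X Y \<and> Y \<noteq> {} \<and> Y \<subseteq> W p \<inter> W q" if pq: "p \<in> P" "q \<in> P" and Y: "Y \<in> C p q" for p q Y
  proof -
    have op: "openin X (W p \<inter> W q)"
      using WN(1)[OF PX[OF pq(1)]] WN(1)[OF PX[OF pq(2)]] by (rule openin_Int)
    have "openin X Y"
      by (rule locally_connected[unfolded locally_connected_space_open_connected_components, rule_format,
            OF conjI[OF op Y[unfolded C_def]]])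
    moreover have "connectedin X Y"
      using connectedin_connected_components_of[OF Y[unfolded C_def]] by (simp add: connectedin_subtopology)
    moreover have "Y \<noteq> {}"
      by (rule nonempty_connected_components_of[OF Y[unfolded C_def]])
    moreover have "Y \<subseteq> W p \<inter> W q"
      using connected_components_of_subset[OF Y[unfolded C_def]] by simp
    ultimately show ?thesis by blast
  qed
  have UC: "\<Union>(C p q) = W p \<inter> W q" if "p \<in> P" "q \<in> P" for p q
    unfolding C_def Union_connected_components_of
    using openin_subset[OF WN(1)[OF PX[OF that(1)]]] by auto
  \<comment> \<open>An overlap of two charts may have infinitely many components, but only finitely
    many of them meet the compact set \<open>R p \<inter> R q\<close>.\<close>
  define H where "H p q = {Y \<in> C p q. Y \<inter> (R p \<inter> R q) \<noteq> {}}" for p q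
  have finH: "finite (H p q)" if pq: "p \<in> P" "q \<in> P" for p q
    unfolding H_def
  proof (rule finite_disjoint_openin_compactin)
    show "compactin X (R p \<inter> R q)"
      by (rule closed_compactin[OF Q]) (use clR RQ in \<open>auto intro: closedin_Int\<close>)
    show "R p \<inter> R q \<subseteq> \<Union>(C p q)"
      unfolding UC[OF pq] using RW pq by blast
    show "openin X Y" if "Y \<in> C p q" for Y
      using C[OF pq that] by blast
    show "Y \<inter> Z = {}" if "Y \<in> C p q" "Z \<in> C p q" "Y \<noteq> Z" for Y Z
      using pairwise_disjoint_connected_components_of[of "subtopology X (W p \<inter> W q)"] that
      unfolding C_def by (auto simp: pairwise_def disjnt_def)
  qed
  define S where "S = (SIGMA p:P. SIGMA q:P. H p q)"
  have finS: "finite S"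
    unfolding S_def using P(2) finH by (intro finite_SigmaI) auto
  show ?thesis
  \<comment> \<open>\<open>S\<close> lists the relevant overlap components and a sign pattern is a
    subset of \<open>S\<close>; with more than \<open>2 ^ card S\<close> functions, two of them
    share a pattern.\<close>
  proof (intro exI[of _ "2 ^ card S"] allI impI)
    fix \<J> :: "'j set" and f :: "'j \<Rightarrow> 'a \<Rightarrow> complex"
    assume A: "finite \<J> \<and> 2 ^ card S < card \<J> \<and>
      (\<forall>J\<in>\<J>. continuous_map X euclidean (f J) \<and> (\<forall>x\<in>topspace X. f J x \<noteq> 0))"
    then have J: "finite \<J>" "2 ^ card S < card \<J>"
      and cont: "\<And>J. J \<in> \<J> \<Longrightarrow> continuous_map X euclidean (f J)"
      and nz: "\<And>J x. J \<in> \<J> \<Longrightarrow> x \<in> topspace X \<Longrightarrow> f J x \<noteq> 0"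
      by simp_all
    have "\<exists>g. continuous_map (subtopology X (W p)) euclidean g \<and> (\<forall>x\<in>W p. (g x)\<^sup>2 = f J x)"
      if "J \<in> \<J>" "p \<in> P" for J p
    proof -
      have t: "topspace (subtopology X (W p)) = W p"
        using openin_subset[OF WN(1)[OF PX[OF that(2)]]] by auto
      have "continuous_map (subtopology X (W p)) euclidean (f J)"
        by (rule continuous_map_from_subtopology[OF cont[OF that(1)]])
      moreover have "\<forall>x\<in>topspace (subtopology X (W p)). f J x \<noteq> 0"
        using nz[OF that(1)] by simp
      ultimately show ?thesis
        using WN(2)[OF PX[OF that(2)]] unfolding has_sqrts_def t by blast
    qed
    then have "\<forall>J\<in>\<J>. \<forall>p\<in>P. \<exists>g. continuous_map (subtopology X (W p)) euclidean g \<and> (\<forall>x\<in>W p. (g x)\<^sup>2 = f J x)"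
      by blast
    then obtain r where r: "\<And>J p. J \<in> \<J> \<Longrightarrow> p \<in> P \<Longrightarrow> continuous_map (subtopology X (W p)) euclidean (r J p)"
      "\<And>J p x. J \<in> \<J> \<Longrightarrow> p \<in> P \<Longrightarrow> x \<in> W p \<Longrightarrow> (r J p x)\<^sup>2 = f J x"
      by metis
    define \<sigma> where "\<sigma> J = {(p, q, Y) \<in> S. \<forall>y\<in>Y. r J p y = r J q y}" for J
    \<comment> \<open>The quotient of the two roots has values 1 and -1 only, so it is constant on
      the connected set \<open>Y\<close>: one disagreement forces opposite signs everywhere.\<close>
    have alt: "\<forall>y\<in>Y. r J p y = - r J q y" if J: "J \<in> \<J>" and pqY: "(p, q, Y) \<in> S" and n: "(p, q, Y) \<notin> \<sigma> J" for J p q Y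
    proof
      fix y assume y: "y \<in> Y"
      have pq: "p \<in> P" "q \<in> P" "Y \<in> C p q"
        using pqY unfolding S_def H_def by auto
      have Y: "connectedin X Y" "Y \<subseteq> W p" "Y \<subseteq> W q" "openin X Y"
        using C[OF pq] by auto
      have YX: "Y \<subseteq> topspace X"
        by (rule openin_subset[OF Y(4)])
      have cp: "continuous_map (subtopology X Y) euclidean (r J p)" "continuous_map (subtopology X Y) euclidean (r J q)"
        using continuous_map_from_subtopology_mono[OF r(1)[OF J pq(1)] Y(2)]
          continuous_map_from_subtopology_mono[OF r(1)[OF J pq(2)] Y(3)] by simp_all
      have sq: "r J p z = r J q z \<or> r J p z = - r J q z" "r J q z \<noteq> 0" if z: "z \<in> Y" for z
      proof -
        have "(r J p z)\<^sup>2 = f J z" "(r J q z)\<^sup>2 = f J z"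
          using r(2)[OF J pq(1)] r(2)[OF J pq(2)] Y z by blast+
        moreover have "f J z \<noteq> 0"
          using nz[OF J] YX z by blast
        ultimately show "r J p z = r J q z \<or> r J p z = - r J q z" "r J q z \<noteq> 0"
          by (metis power2_eq_iff, force)
      qed
      have "continuous_map (subtopology X Y) euclidean (\<lambda>z. r J p z / r J q z)"
        using cp sq(2) by (simp add: continuous_map_atin tendsto_divide)
      moreover have "r J p z / r J q z \<in> {1, -1}" if "z \<in> Y" for z
        using sq[OF that] by auto
      ultimately have const: "r J p z / r J q z = r J p y / r J q y" if "z \<in> Y" for z
        using connectedin_finite_image_constant[OF Y(1), of "\<lambda>z. r J p z / r J q z" "{1, -1}" z y] that y by blast
      obtain z where z: "z \<in> Y" "r J p z \<noteq> r J q z"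
        using n pqY unfolding \<sigma>_def by blast
      then have "r J p z / r J q z = -1"
        using sq[OF z(1)] by auto
      then have "r J p y / r J q y = -1"
        using const[OF z(1)] by simp
      then show "r J p y = - r J q y"
        using sq(2)[OF y] by (simp add: field_simps)
    qed
    have "\<not> inj_on \<sigma> \<J>"
    proof
      assume "inj_on \<sigma> \<J>"
      then have "card \<J> \<le> card (Pow S)"
        by (rule card_inj_on_le) (use finS in \<open>auto simp: \<sigma>_def\<close>)
      with J(2) show False
        by (simp add: card_Pow finS)
    qed
    then obtain J J' where JJ: "J \<in> \<J>" "J' \<in> \<J>" "J \<noteq> J'" "\<sigma> J = \<sigma> J'"
      unfolding inj_on_def by blast
    \<comment> \<open>Passing from chart \<open>p\<close> to chart \<open>q\<close> changes the
      roots of both functions by the same sign, so their product does not change.\<close>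
    have agree: "r J p x * r J' p x = r J q x * r J' q x" if pq: "p \<in> P" "q \<in> P" and x: "x \<in> R p" "x \<in> R q" for p q x
    proof -
      have "x \<in> W p \<inter> W q"
        using RW pq x by blast
      then obtain Y where Y: "Y \<in> C p q" "x \<in> Y"
        using UC[OF pq] by blast
      then have mem: "(p, q, Y) \<in> S"
        unfolding S_def H_def using pq x by auto
      show ?thesis
      proof (cases "(p, q, Y) \<in> \<sigma> J")
        case True
        then have "\<forall>y\<in>Y. r J p y = r J q y" "\<forall>y\<in>Y. r J' p y = r J' q y"
        proof -
          have "(p, q, Y) \<in> \<sigma> J'"
            using True JJ(4) by simp
          with True show "\<forall>y\<in>Y. r J p y = r J q y" "\<forall>y\<in>Y. r J' p y = r J' q y"
            unfolding \<sigma>_def by simp_all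
        qed
        with Y(2) show ?thesis by simp
      next
        case False
        then have "r J p x = - r J q x" "r J' p x = - r J' q x"
          using alt[OF JJ(1) mem] alt[OF JJ(2) mem] JJ(4) Y(2) by auto
        then show ?thesis by simp
      qed
    qed
    let ?XQ = "subtopology X Q"
    have tQ: "topspace ?XQ = Q"
      using QX by auto
    obtain s where s: "continuous_map ?XQ euclidean s"
      "\<And>x p. p \<in> P \<Longrightarrow> x \<in> topspace ?XQ \<inter> R p \<Longrightarrow> s x = r J p x * r J' p x"
    proof (rule pasting_lemma_exists_closed[of P ?XQ R euclidean "\<lambda>p x. r J p x * r J' p x"])
      show "finite P" by (rule P)
      show "topspace ?XQ \<subseteq> \<Union>(R ` P)"
        unfolding tQ by (rule QR)
      show "closedin ?XQ (R p)" if "p \<in> P" for p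
        using clR RQ by (intro closedin_subset_topspace) auto
      show "continuous_map (subtopology ?XQ (R p)) euclidean (\<lambda>x. r J p x * r J' p x)" if p: "p \<in> P" for p
      proof -
        have "subtopology ?XQ (R p) = subtopology X (R p)"
          using RQ[of p] by (simp add: subtopology_subtopology inf_absorb2)
        moreover have "continuous_map (subtopology X (R p)) euclidean (r J p)" "continuous_map (subtopology X (R p)) euclidean (r J' p)"
          by (rule continuous_map_from_subtopology_mono[OF r(1)[OF _ p] RW[OF p]], rule JJ)+
        ultimately show ?thesis
          using continuous_map_complex_mult by simp
      qed
      show "r J p x * r J' p x = r J q x * r J' q x" if "p \<in> P" "q \<in> P" "x \<in> topspace ?XQ \<inter> R p \<inter> R q" for p q x
        using agree[OF that(1,2)] that(3) by blast
    qed (rule that)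
    have "(s x)\<^sup>2 = f J x * f J' x" if x: "x \<in> Q" for x
    proof -
      obtain p where p: "p \<in> P" "x \<in> R p"
        using QR x by blast
      then have "s x = r J p x * r J' p x"
        using s(2)[OF p(1)] x tQ by blast
      moreover have "x \<in> W p"
        using RW p by blast
      ultimately show ?thesis
        using r(2)[OF JJ(1) p(1)] r(2)[OF JJ(2) p(1)] by (simp add: power_mult_distrib)
    qed
    with s(1) JJ show "\<exists>J\<in>\<J>. \<exists>J'\<in>\<J>. J \<noteq> J' \<and>
        (\<exists>s. continuous_map (subtopology X Q) euclidean s \<and> (\<forall>x\<in>Q. (s x)\<^sup>2 = f J x * f J' x))"
      by blast
  qed
qed

text \<open>
  A cut function winds once around the circle across each of the chosen ends \<open>V i\<close> of \<open>T\<close> at \<open>Z\<close>.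
  If two different choices had the same sign pattern, the square root of the product of their cut
  functions would change sign along one end and not along another, although \<open>Z\<close> and \<open>T\<close> are connected.
\<close>

lemma finitely_many_ends_at_compact:
  assumes Z: "compactin X Z" "connectedin X Z"
    and T: "openin X T" "connectedin X T" "T \<noteq> {}" "T \<inter> Z = {}" "X closure_of T - T \<subseteq> Z"
    and N: "openin X N" "Z \<subseteq> N" "compactin X (X closure_of N)"
  shows "\<exists>m::nat. \<forall>k W (V :: nat \<Rightarrow> 'a set) U. openin X W \<and> Z \<subseteq> W \<and> W \<subseteq> N \<and>
      (\<forall>i\<le>k. openin X (V i) \<and> V i \<subseteq> T \<and> X closure_of V i \<inter> Z \<noteq> {} \<and> V i \<inter> U = {}) \<and>
      (\<forall>i\<le>k. \<forall>j\<le>k. i \<noteq> j \<longrightarrow> V i \<inter> V j = {}) \<and>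
      openin X U \<and> W \<inter> T \<subseteq> U \<union> (\<Union>i\<le>k. V i) \<longrightarrow> k \<le> m"
proof -
  have clZ: "closedin X Z"
    by (rule compactin_imp_closedin[OF Haus Z(1)])
  have TX: "T \<subseteq> topspace X"
    by (rule openin_subset[OF T(1)])
  have NN: "N \<subseteq> X closure_of N"
    by (rule closure_of_subset[OF openin_subset[OF N(1)]])
  let ?Y = "subtopology X T"
  have tY: "topspace ?Y = T"
    using TX by auto
  interpret Y: n_manifold ?Y n
    by unfold_locales (rule open_submanifold[OF T(1,2)])
  obtain x0 where x0: "x0 \<in> T"
    using T(3) by blast
  have "compactin X ((X closure_of T - N) \<inter> X closure_of N)"
    by (rule closed_compactin[OF N(3)]) (auto intro!: closedin_Int closedin_diff N(1))
  moreover have sub: "(X closure_of T - N) \<inter> X closure_of N \<subseteq> T"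
    using T(5) N(2) by blast
  ultimately have "compactin ?Y ((X closure_of T - N) \<inter> X closure_of N)"
    by (simp add: compactin_subtopology)
  \<comment> \<open>\<open>F\<close> is a compact connected subset of \<open>T\<close> that contains
    the part of \<open>T\<close> on the frontier of \<open>N\<close>. A sign on
    \<open>T \<inter> Q\<close> is constant on \<open>F\<close>, and can therefore be continued from
    \<open>N\<close> to all of \<open>T\<close> by that constant.\<close>
  then obtain F where F: "compactin ?Y F" "connectedin ?Y F" "(X closure_of T - N) \<inter> X closure_of N \<subseteq> F" "x0 \<in> F"
    by (rule Y.compact_connected_superset) (use x0 tY in simp, rule that)
  have FT: "F \<subseteq> T" "compactin X F" "connectedin X F"
    using F(1,2) by (simp_all add: compactin_subtopology connectedin_subtopology)
  define Q where "Q = X closure_of N \<union> F"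
  have Q: "compactin X Q"
    unfolding Q_def by (rule compactin_Un[OF N(3) FT(2)])
  have QX: "Q \<subseteq> topspace X"
    by (rule compactin_subset_topspace[OF Q])
  have ZQ: "Z \<subseteq> Q"
    unfolding Q_def using N(2) NN by blast
  obtain m :: nat where m: "\<forall>(\<J> :: nat set set) f. finite \<J> \<and> m < card \<J> \<and>
      (\<forall>J\<in>\<J>. continuous_map X euclidean (f J) \<and> (\<forall>x\<in>topspace X. f J x \<noteq> (0::complex))) \<longrightarrow>
      (\<exists>J\<in>\<J>. \<exists>J'\<in>\<J>. J \<noteq> J' \<and>
        (\<exists>s. continuous_map (subtopology X Q) euclidean s \<and> (\<forall>x\<in>Q. (s x)\<^sup>2 = f J x * f J' x)))"
    using finite_sqrt_classes[OF Q] by (rule exE)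
  show ?thesis
  proof (intro exI[of _ m] allI impI, rule ccontr)
    fix k :: nat and W U and V :: "nat \<Rightarrow> 'a set"
    assume A: "openin X W \<and> Z \<subseteq> W \<and> W \<subseteq> N \<and>
      (\<forall>i\<le>k. openin X (V i) \<and> V i \<subseteq> T \<and> X closure_of V i \<inter> Z \<noteq> {} \<and> V i \<inter> U = {}) \<and>
      (\<forall>i\<le>k. \<forall>j\<le>k. i \<noteq> j \<longrightarrow> V i \<inter> V j = {}) \<and>
      openin X U \<and> W \<inter> T \<subseteq> U \<union> (\<Union>i\<le>k. V i)" and "\<not> k \<le> m"
    have W: "openin X W" "Z \<subseteq> W" "W \<subseteq> N"
      and V: "\<And>i. i \<le> k \<Longrightarrow> openin X (V i) \<and> V i \<subseteq> T \<and> X closure_of V i \<inter> Z \<noteq> {} \<and> V i \<inter> U = {}"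
      and dj: "\<And>i j. i \<le> k \<Longrightarrow> j \<le> k \<Longrightarrow> i \<noteq> j \<Longrightarrow> V i \<inter> V j = {}"
      and U: "openin X U" "W \<inter> T \<subseteq> U \<union> (\<Union>i\<le>k. V i)"
      using A by simp_all
    have cr: "completely_regular_space X"
      using locally_compact_regular_imp_completely_regular_space locally_compact Haus by blast
    have cW: "closedin X (topspace X - W)" "disjnt Z (topspace X - W)"
      using W(1,2) by (auto simp: disjnt_def)
    obtain \<phi> where \<phi>: "continuous_map X euclideanreal \<phi>" "\<phi> ` Z \<subseteq> {0}" "\<phi> ` (topspace X - W) \<subseteq> {1}"
      by (rule Urysohn_completely_regular_compact_closed_alt[OF cr Z(1) cW])
    have V_op: "openin X (V i)" and VT: "V i \<subseteq> T" and VZ: "X closure_of V i \<inter> Z \<noteq> {}" and VU: "V i \<inter> U = {}"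
      if "i \<le> k" for i
      using V[OF that] by simp_all
    have kJ: "i \<le> k" if "J \<subseteq> {..<k}" "i \<in> J" for i J
      using that by auto
    define B where "B J = (\<Union>i\<in>J. V i)" for J
    have opB: "openin X (B J)" and BT: "B J \<subseteq> T" if "J \<subseteq> {..<k}" for J
    proof -
      show "openin X (B J)"
        unfolding B_def
      proof (rule openin_Union, elim imageE)
        fix S i assume "S = V i" "i \<in> J"
        then show "openin X S"
          using V_op[OF kJ[OF that]] by simp
      qed
      show "B J \<subseteq> T"
        unfolding B_def
      proof (rule UN_least)
        fix i assume "i \<in> J"
        then show "V i \<subseteq> T"
          by (rule VT[OF kJ[OF that]])
      qed
    qed
    \<comment> \<open>Inside \<open>W \<inter> T\<close> the sets \<open>U\<close> and
      \<open>V i\<close> are disjoint, open and cover everything, so \<open>B J\<close> has no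
      frontier there.\<close>
    have frB: "x \<in> Z \<or> (x \<in> T \<and> x \<notin> W)" if J: "J \<subseteq> {..<k}" and x: "x \<in> X closure_of B J - B J" for J x
    proof (cases "x \<in> Z")
      case False
      have "x \<in> X closure_of T"
        using x closure_of_mono[OF BT[OF J], of X] by blast
      then have xT: "x \<in> T"
        using T(5) False by blast
      have "x \<notin> W"
      proof
        assume "x \<in> W"
        then consider "x \<in> U" | i where "i \<le> k" "x \<in> V i"
          using U(2) xT by blast
        then show False
        proof cases
          case 1
          have "U \<inter> V j = {}" if "j \<in> J" for j
            using VU[OF kJ[OF J that]] by blast
          then have "U \<inter> B J = {}"
            unfolding B_def by blast
          from openin_Int_closure_of_empty[OF U(1) this] 1 x show False by blast
        next
          case (2 i)
          then have "i \<notin> J"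
            using x unfolding B_def by blast
          then have "V i \<inter> V j = {}" if "j \<in> J" for j
          proof -
            have "j \<le> k" "i \<noteq> j"
              using kJ[OF J that] that \<open>i \<notin> J\<close> by auto
            then show ?thesis
              using dj[OF 2(1), of j] by simp
          qed
          then have "V i \<inter> B J = {}"
            unfolding B_def by blast
          from openin_Int_closure_of_empty[OF V_op[OF 2(1)] this] 2(2) x show False by blast
        qed
      qed
      with xT show ?thesis by blast
    qed simp
    have \<phi>1: "\<phi> x = 1" if "x \<in> topspace X" "x \<notin> W" for x
      using \<phi>(3) that by blast
    have \<phi>0: "\<phi> x = 0" if "x \<in> Z" for x
      using \<phi>(2) that by blast
    define E where "E a x = exp ((a::complex) * of_real (\<phi> x - 1))" for a x
    \<comment> \<open>With the shift by 1 in \<open>E\<close>, the value is 1 where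
      \<open>\<phi>\<close> is 1 and also, after a full turn, where \<open>\<phi>\<close> is 0. By
      \<open>frB\<close> the frontier of \<open>B J\<close> has no other points, so
      \<open>f J\<close> is continuous on all of \<open>X\<close>.\<close>
    define f where "f J x = (if x \<in> B J then E (2 * of_real pi * \<i>) x else 1)" for J x
    \<comment> \<open>An explicit square root of \<open>f J\<close> for \<open>c = 1\<close>, and
      its inverse for \<open>c = -1\<close>. It is continuous only on \<open>T\<close>, where the
      frontier of \<open>B J\<close> has \<open>\<phi>\<close> equal to 1; towards \<open>Z\<close>
      it jumps between -1 and 1.\<close>
    define \<rho> where "\<rho> c J x = (if x \<in> B J then E (c * of_real pi * \<i>) x else 1)" for c J x
    have E: "continuous_map X euclidean (E a)" for a
      unfolding E_def by (rule continuous_map_exp_compose[OF \<phi>(1)])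
    have E1: "E a x = 1" if "\<phi> x = 1" for a x
      using that by (simp add: E_def)
    have f_cont: "continuous_map X euclidean (f J)" if J: "J \<subseteq> {..<k}" for J
      unfolding f_def
    proof (rule continuous_map_if_openin[OF opB[OF J] E])
      fix x assume x: "x \<in> X closure_of B J - B J"
      then have "x \<in> topspace X"
        using closure_of_subset_topspace[of X "B J"] by blast
      with frB[OF J x] have "\<phi> x = 0 \<or> \<phi> x = 1"
        using \<phi>0 \<phi>1 by blast
      then show "E (2 * of_real pi * \<i>) x = 1"
        by (auto simp: E_def exp_minus)
    qed simp
    have f_nz: "f J x \<noteq> 0" for J x
      unfolding f_def E_def by simp
    have \<rho>_cont: "continuous_map ?Y euclidean (\<rho> c J)" if J: "J \<subseteq> {..<k}" for c J
      unfolding \<rho>_def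
    proof (rule continuous_map_if_openin[OF _ continuous_map_from_subtopology[OF E]])
      show "openin ?Y (B J)"
        using opB[OF J] BT[OF J] by (intro subset_openin_subtopology)
      fix x assume x: "x \<in> ?Y closure_of B J - B J"
      then have "x \<in> X closure_of B J - B J" "x \<in> T"
        by (auto simp: closure_of_subtopology dest: closure_of_mono[THEN subsetD, rotated])
      then have "x \<notin> W" "x \<in> topspace X"
        using frB[OF J] T(4) TX by blast+
      then show "E (c * of_real pi * \<i>) x = 1"
        by (intro E1 \<phi>1)
    qed simp
    have \<rho>_sq: "(\<rho> c J x)\<^sup>2 = f J x" if "c = 1" for c J x
      unfolding \<rho>_def f_def E_def that by (simp add: exp_double[symmetric] algebra_simps)
    have \<rho>_inv: "\<rho> (-1) J x * \<rho> 1 J x = 1" for J x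
      unfolding \<rho>_def E_def by (simp add: exp_add[symmetric])
    \<comment> \<open>The cut functions are indexed by the subsets of \<open>{..<k}\<close>;
      \<open>V k\<close> belongs to none of them and serves as the reference end.\<close>
    have "k < 2 ^ k"
      by (rule less_exp)
    with \<open>\<not> k \<le> m\<close> have "m < 2 ^ k"
      by linarith
    then have "m < card (Pow {..<k})"
      by (simp add: card_Pow)
    then have "\<exists>J\<in>Pow {..<k}. \<exists>J'\<in>Pow {..<k}. J \<noteq> J' \<and>
        (\<exists>s. continuous_map (subtopology X Q) euclidean s \<and> (\<forall>x\<in>Q. (s x)\<^sup>2 = f J x * f J' x))"
      by (intro m[rule_format, of "Pow {..<k}" f]) (use f_cont f_nz in simp)
    then obtain J J' s where J: "J \<subseteq> {..<k}" and J': "J' \<subseteq> {..<k}" and ne: "J \<noteq> J'"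
      and s: "continuous_map (subtopology X Q) euclidean s" "\<And>x. x \<in> Q \<Longrightarrow> (s x)\<^sup>2 = f J x * f J' x"
      by blast
    \<comment> \<open>The quotient of two square roots of the same function on
      \<open>T \<inter> Q\<close>: the one provided by the coincidence of sign patterns and the
      explicit one.\<close>
    define t where "t x = s x * (\<rho> (-1) J x * \<rho> (-1) J' x)" for x
    have t_sq: "t x \<in> {1, -1}" if "x \<in> Q" for x
    proof -
      have "(t x)\<^sup>2 = (s x)\<^sup>2 * ((\<rho> (-1) J x)\<^sup>2 * (\<rho> (-1) J' x)\<^sup>2)"
        unfolding t_def by (simp add: power_mult_distrib)
      also have "\<dots> = (\<rho> (-1) J x * \<rho> 1 J x)\<^sup>2 * (\<rho> (-1) J' x * \<rho> 1 J' x)\<^sup>2"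
        unfolding s(2)[OF that] \<rho>_sq[OF refl, symmetric] by (simp add: power_mult_distrib mult_ac)
      finally have "(t x)\<^sup>2 = 1"
        by (simp add: \<rho>_inv)
      then show ?thesis
        by (simp add: power2_eq_1_iff)
    qed
    have t_cont: "continuous_map (subtopology X (T \<inter> Q)) euclidean t"
    proof -
      have "continuous_map (subtopology X (T \<inter> Q)) euclidean s"
        by (rule continuous_map_from_subtopology_mono[OF s(1)]) blast
      moreover have "continuous_map (subtopology X (T \<inter> Q)) euclidean (\<rho> (-1) J)"
        "continuous_map (subtopology X (T \<inter> Q)) euclidean (\<rho> (-1) J')"
        using continuous_map_from_subtopology_mono[OF \<rho>_cont[OF J]] continuous_map_from_subtopology_mono[OF \<rho>_cont[OF J']]
        by simp_all
      ultimately show ?thesis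
        unfolding t_def by (intro continuous_map_complex_mult)
    qed
    define c where "c = t x0"
    have x0Q: "x0 \<in> Q"
      unfolding Q_def using F(4) by blast
    have tF: "t x = c" if "x \<in> F" for x
      unfolding c_def
    proof (rule connectedin_finite_image_constant[OF FT(3) _ _ _ that F(4)])
      show "continuous_map (subtopology X F) euclidean t"
        by (rule continuous_map_from_subtopology_mono[OF t_cont]) (use FT(1) in \<open>auto simp: Q_def\<close>)
      show "t y \<in> {1, -1}" if "y \<in> F" for y
        by (rule t_sq) (use that in \<open>simp add: Q_def\<close>)
    qed simp
    \<comment> \<open>On \<open>F\<close>, hence where \<open>T\<close> crosses the frontier of
      \<open>N\<close>, \<open>t\<close> equals \<open>c\<close>. So \<open>u\<close> is a
      continuous sign on the connected set \<open>T\<close>, and \<open>t\<close> equals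
      \<open>c\<close> on all of \<open>T \<inter> N\<close>.\<close>
    define u where "u x = (if x \<in> N then t x else c)" for x
    have u_cont: "continuous_map ?Y euclidean u"
      unfolding u_def
    proof (rule continuous_map_cases)
      have clN: "?Y closure_of {x. x \<in> N} \<subseteq> X closure_of N"
        using closure_of_subtopology[of X T N] closure_of_mono[of "T \<inter> N" N X] by auto
      have clNT: "?Y closure_of {x. x \<in> N} \<subseteq> T"
        using closure_of_subset_topspace[of ?Y "{x. x \<in> N}"] tY by simp
      have "subtopology ?Y (?Y closure_of {x. x \<in> N}) = subtopology X (?Y closure_of {x. x \<in> N})"
        using clNT by (simp add: subtopology_subtopology inf_absorb2)
      moreover have "continuous_map (subtopology X (?Y closure_of {x. x \<in> N})) euclidean t"
        by (rule continuous_map_from_subtopology_mono[OF t_cont]) (use clN clNT in \<open>auto simp: Q_def\<close>)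
      ultimately show "continuous_map (subtopology ?Y (?Y closure_of {x. x \<in> N})) euclidean t"
        by simp
      show "continuous_map (subtopology ?Y (?Y closure_of {x. x \<notin> N})) euclidean (\<lambda>x. c)"
        by simp
      fix x assume x: "x \<in> ?Y frontier_of {x. x \<in> N}"
      then have xN: "x \<in> ?Y closure_of {x. x \<in> N}"
        unfolding frontier_of_def by blast
      have "x \<notin> ?Y interior_of (T \<inter> N)"
        using x unfolding frontier_of_def interior_of_restrict[of ?Y "{x. x \<in> N}"] tY by simp
      moreover have "openin ?Y (T \<inter> N)"
        using N(1) by (simp add: openin_subtopology_Int2)
      ultimately have "x \<notin> T \<inter> N"
        by (simp add: interior_of_openin)
      then have "x \<in> (X closure_of T - N) \<inter> X closure_of N"
        using xN clN clNT closure_of_subset[OF TX] by blast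
      then show "t x = c"
        using F(3) tF by blast
    qed
    have uc: "u x = c" if x: "x \<in> T" for x
    proof -
      have "u x = u x0"
      proof (rule connectedin_finite_image_constant[OF T(2) u_cont _ _ x x0])
        show "u y \<in> {1, -1}" if "y \<in> T" for y
          using t_sq[of y] t_sq[OF x0Q] NN unfolding u_def c_def Q_def by auto
      qed simp
      then show ?thesis
        unfolding u_def c_def by simp
    qed
    have tc: "t x = c" if "x \<in> T" "x \<in> N" for x
      using uc[OF that(1)] that(2) unfolding u_def by simp
    have c2: "c \<noteq> 0"
      using t_sq[OF x0Q] unfolding c_def by auto
    have sc: "s x = c * (\<rho> 1 J x * \<rho> 1 J' x)" if x: "x \<in> T" "x \<in> N" for x
    proof -
      have "t x * (\<rho> 1 J x * \<rho> 1 J' x) = s x * ((\<rho> (-1) J x * \<rho> 1 J x) * (\<rho> (-1) J' x * \<rho> 1 J' x))"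
        unfolding t_def by (simp add: mult_ac)
      then show ?thesis
        using tc[OF x] by (simp add: \<rho>_inv)
    qed
    have ZB: "x \<notin> B J" "x \<notin> B J'" if "x \<in> Z" for x
      using that BT[OF J] BT[OF J'] T(4) by blast+
    \<comment> \<open>When \<open>z\<close> is approached through \<open>V i\<close>, the explicit
      root tends to its value at \<open>\<phi>\<close> = 0, where a half turn contributes -1 for
      each of \<open>J\<close> and \<open>J'\<close> that contains \<open>i\<close>.\<close>
    have lim: "s z = c * (if i \<in> J then -1 else 1) * (if i \<in> J' then -1 else 1)"
      if i: "i \<le> k" and z: "z \<in> Z" "z \<in> X closure_of V i" for i z
    proof -
      define g where "g x = c * ((if i \<in> J then E (of_real pi * \<i>) x else 1) * (if i \<in> J' then E (of_real pi * \<i>) x else 1))" for x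
      have "continuous_map X euclidean g"
        unfolding g_def by (intro continuous_map_complex_mult) (auto simp: E)
      then have g: "continuous_map (subtopology X Q) euclidean g"
        by (rule continuous_map_from_subtopology)
      have "closedin (subtopology X Q) {x \<in> topspace (subtopology X Q). s x = g x}"
        by (rule closedin_continuous_maps_eq[OF _ s(1) g]) simp
      moreover have "{x \<in> topspace (subtopology X Q). s x = g x} = {x \<in> Q. s x = g x}"
        using QX by auto
      ultimately have cl: "closedin X {x \<in> Q. s x = g x}"
        using closedin_trans_full compactin_imp_closedin[OF Haus Q] by metis
      have "V i \<inter> N \<subseteq> {x \<in> Q. s x = g x}"
      proof (intro subsetI CollectI conjI)
        fix x assume x: "x \<in> V i \<inter> N"
        then show "x \<in> Q"
          unfolding Q_def using NN by blast
        have xT: "x \<in> T"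
          using VT[OF i] x by blast
        have "x \<in> B J \<longleftrightarrow> i \<in> J" if J: "J \<subseteq> {..<k}" for J
        proof
          assume "x \<in> B J"
          then obtain j where j: "j \<in> J" "x \<in> V j"
            unfolding B_def by blast
          have "j = i"
          proof (rule ccontr)
            assume "j \<noteq> i"
            moreover have "j \<le> k"
              by (rule kJ[OF J j(1)])
            ultimately have "V i \<inter> V j = {}"
              using dj[OF i, of j] by simp
            with x j(2) show False by blast
          qed
          with j show "i \<in> J" by simp
        qed (use x in \<open>auto simp: B_def\<close>)
        then show "s x = g x"
          using sc[OF xT] x J J' unfolding g_def \<rho>_def by simp
      qed
      then have "X closure_of (V i \<inter> N) \<subseteq> {x \<in> Q. s x = g x}"
        using cl by (rule closure_of_minimal)
      moreover have "z \<in> X closure_of (V i \<inter> N)"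
        using openin_Int_closure_of_subset[OF N(1), of "V i"] z N(2) by (auto simp: Int_commute)
      ultimately have "s z = g z" by blast
      moreover have "E (of_real pi * \<i>) z = -1"
        unfolding E_def using \<phi>0[OF z(1)] by (simp add: exp_minus exp_pi_i')
      ultimately show ?thesis
        unfolding g_def by simp
    qed
    \<comment> \<open>\<open>V i\<close> is in exactly one of the two choices and forces
      \<open>s\<close> to be \<open>-c\<close> at a point of \<open>Z\<close>, while
      \<open>V k\<close> forces \<open>c\<close>. But \<open>s\<close> squares to 1 on the connected
      set \<open>Z\<close>, so it is constant there.\<close>
    obtain i where i: "i < k" "i \<in> J \<longleftrightarrow> i \<notin> J'"
      using ne J J' by blast
    obtain z where z: "z \<in> Z" "z \<in> X closure_of V i"
      using VZ[of i] i(1) by (metis IntE ex_in_conv less_imp_le)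
    obtain z' where z': "z' \<in> Z" "z' \<in> X closure_of V k"
      using VZ[of k] by (metis IntE ex_in_conv order_refl)
    have "k \<notin> J" "k \<notin> J'"
      using J J' by blast+
    then have 1: "s z' = c"
      using lim[OF _ z'] by simp
    have 2: "s z = - c"
      using lim[OF _ z] i by auto
    have "s z = s z'"
    proof (rule connectedin_finite_image_constant[OF Z(2) _ _ _ z(1) z'(1)])
      show "continuous_map (subtopology X Z) euclidean s"
        by (rule continuous_map_from_subtopology_mono[OF s(1) ZQ])
      show "s y \<in> {1, -1}" if "y \<in> Z" for y
      proof -
        have "(s y)\<^sup>2 = 1"
          using s(2)[of y] ZQ that ZB[OF that] unfolding f_def by auto
        then show ?thesis
          by (simp add: power2_eq_1_iff)
      qed
    qed simp
    with 1 2 c2 show False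
      by simp
  qed
qed

end

section \<open>Trunks from long ends\<close>

lemma cf_open_Inter:
  "finite \<F> \<Longrightarrow> (\<And>S. S \<in> \<F> \<Longrightarrow> cf_open X S) \<Longrightarrow> cf_open X (topspace X \<inter> \<Inter>\<F>)"
proof (induction \<F> rule: finite_induct)
  case (insert S \<F>)
  have "cf_open X S"
    using insert.prems by simp
  moreover have "cf_open X (topspace X \<inter> \<Inter>\<F>)"
    by (rule insert.IH) (use insert.prems in simp)
  ultimately have "cf_open X (S \<inter> (topspace X \<inter> \<Inter>\<F>))"
    by (rule cf_open_Int)
  then show ?case
    by (simp add: Int_left_commute)
qed simp

context lc_Hausdorff
begin

text \<open>A new end gets a neighbourhood \<open>W\<close> without the previous ends; these lie in
  the exterior of \<open>W\<close>, to which their neighbourhoods are cut back.\<close>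

lemma ends_disjoint_nbhds:
  assumes "finite F" "F \<subseteq> ends X"
  shows "\<exists>V. (\<forall>d\<in>F. cf_open X (V d) \<and> d \<in> end_nbhd X (V d)) \<and> (\<forall>c\<in>F. \<forall>d\<in>F. c \<noteq> d \<longrightarrow> V c \<inter> V d = {})"
  using assms
proof (induction F rule: finite_induct)
  case (insert d F)
  have "\<exists>V. (\<forall>d\<in>F. cf_open X (V d) \<and> d \<in> end_nbhd X (V d)) \<and> (\<forall>c\<in>F. \<forall>d\<in>F. c \<noteq> d \<longrightarrow> V c \<inter> V d = {})"
    by (rule insert.IH) (use insert.prems in simp)
  then obtain V where V0: "(\<forall>d\<in>F. cf_open X (V d) \<and> d \<in> end_nbhd X (V d)) \<and> (\<forall>c\<in>F. \<forall>d\<in>F. c \<noteq> d \<longrightarrow> V c \<inter> V d = {})"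
    by (rule exE)
  have V: "\<And>c. c \<in> F \<Longrightarrow> cf_open X (V c)" "\<And>c. c \<in> F \<Longrightarrow> c \<in> end_nbhd X (V c)"
    "\<And>b c. b \<in> F \<Longrightarrow> c \<in> F \<Longrightarrow> b \<noteq> c \<Longrightarrow> V b \<inter> V c = {}"
    using V0 by simp_all
  have dE: "d \<in> ends X" "F \<subseteq> ends X - {d}"
    using insert by auto
  obtain W where W: "cf_open X W" "d \<in> end_nbhd X W" "F \<inter> end_nbhd X W = {}"
    by (rule ends_isolating_nbhd[OF insert(1) dE])
  have FW: "c \<in> end_nbhd X (topspace X - X closure_of W)" if "c \<in> F" for c
    using end_cases[OF _ W(1), of c] W(3) dE(2) that by blast
  have WW: "W \<subseteq> X closure_of W"
    by (rule closure_of_subset[OF cf_openD(2)[OF W(1)]])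
  define V' where "V' c = (if c = d then W else V c \<inter> (topspace X - X closure_of W))" for c
  have "cf_open X (V' c) \<and> c \<in> end_nbhd X (V' c)" if "c \<in> insert d F" for c
  proof (cases "c = d")
    case True
    then show ?thesis
      using W by (simp add: V'_def)
  next
    case False
    then have c: "c \<in> F"
      using that by simp
    then show ?thesis
      using False V(1,2)[OF c] FW[OF c] cf_open_Compl[OF W(1)] by (simp add: V'_def cf_open_Int end_nbhd_Int)
  qed
  moreover have "V' b \<inter> V' c = {}" if bc: "b \<in> insert d F" "c \<in> insert d F" "b \<noteq> c" for b c
  proof -
    consider "b = d" "c \<noteq> d" | "c = d" "b \<noteq> d" | "b \<noteq> d" "c \<noteq> d"
      using bc(3) by blast
    then show ?thesis
    proof cases
      case 3
      then have "V b \<inter> V c = {}"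
        using V(3)[of b c] bc by simp
      with 3 show ?thesis
        unfolding V'_def by auto
    qed (use WW in \<open>auto simp: V'_def\<close>)
  qed
  ultimately show ?case
    by (intro exI[of _ V'] conjI ballI impI) simp_all
qed simp

end

lemma Lindelof_in_subtopology:
  "T \<subseteq> topspace X \<Longrightarrow> Lindelof_in (subtopology X T) S \<longleftrightarrow> S \<subseteq> T \<and> Lindelof_in X S"
  unfolding Lindelof_in_def by (auto simp: subtopology_subtopology inf_absorb2)

context n_manifold
begin

text \<open>Outside of \<open>N\<close>, finitely many components off \<open>Z\<close> fill
  \<open>U\<close>, so one of them is unbounded, and one-endedness makes the rest of
  \<open>U\<close> bounded. The point \<open>x0\<close> keeps \<open>Z\<close> nonempty, as
  \<open>finite_components_off\<close> requires.\<close>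

lemma unbounded_component:
  assumes U: "cf_open X U" "one_ended X U" "\<not> bounded_subset X U"
  obtains Z N T where "compactin X Z" "connectedin X Z" "openin X N" "Z \<subseteq> N" "compactin X (X closure_of N)"
    "T \<in> components_off X Z" "T \<subseteq> U" "\<not> bounded_subset X T" "bounded_subset X (U - T)"
proof -
  have "U \<noteq> {}"
    using U(3) by auto
  then obtain x0 where x0: "x0 \<in> U" by blast
  have x0X: "x0 \<in> topspace X"
    using x0 cf_openD(2)[OF U(1)] by blast
  obtain Z where Z: "compactin X Z" "connectedin X Z" "X closure_of U - U \<subseteq> Z" "x0 \<in> Z"
    by (rule compact_connected_superset[OF compact_frontier[OF U(1)] x0X])
  obtain N where N: "openin X N" "Z \<subseteq> N" "compactin X (X closure_of N)"
    by (rule compact_nbhd[OF Z(1)])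
  have NN: "N \<subseteq> X closure_of N"
    by (rule closure_of_subset[OF openin_subset[OF N(1)]])
  have clZ: "closedin X Z"
    by (rule compactin_imp_closedin[OF Haus Z(1)])
  have Zne: "Z \<noteq> {}"
    using Z(4) by blast
  define S where "S = {Y \<in> components_off X Z. Y \<subseteq> U \<and> \<not> Y \<subseteq> N}"
  have "finite S"
    unfolding S_def by (rule finite_subset[OF _ finite_components_off[OF Z(1) Zne N]]) blast
  have UNS: "U - N \<subseteq> \<Union>S"
  proof
    fix x assume x: "x \<in> U - N"
    then have "x \<in> topspace X - Z"
      using N(2) cf_openD(2)[OF U(1)] by blast
    then obtain Y where Y: "Y \<in> components_off X Z" "x \<in> Y"
      using components_off_cover[of Z] by blast
    have "Y \<subseteq> U"
    proof (rule connectedin_subset_openin[OF components_offD(2)[OF clZ Y(1)] cf_openD(1)[OF U(1)]])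
      show "Y \<inter> U \<noteq> {}"
        using Y(2) x by blast
      show "Y \<inter> (X closure_of U - U) = {}"
        using Z(3) components_offD(4)[OF clZ Y(1)] by blast
    qed
    then show "x \<in> \<Union>S"
      unfolding S_def using Y x by blast
  qed
  have "\<exists>T\<in>S. \<not> bounded_subset X T"
  proof (rule ccontr)
    assume "\<not> (\<exists>T\<in>S. \<not> bounded_subset X T)"
    then have "bounded_subset X (\<Union>S)"
      by (intro bounded_subset_Union[OF \<open>finite S\<close>]) blast
    then have "bounded_subset X (\<Union>S \<union> X closure_of N)"
      using compactin_imp_bounded_subset[OF N(3)] by simp
    then have "bounded_subset X U"
      by (rule bounded_subset_mono) (use UNS NN in blast)
    with U(3) show False ..
  qed
  then obtain T where T: "T \<in> components_off X Z" "T \<subseteq> U" "\<not> bounded_subset X T"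
    unfolding S_def by blast
  have cfT: "cf_open X T"
    by (rule cf_openI[OF components_offD(1)[OF clZ T(1)] compactin_imp_bounded_subset[OF Z(1)] components_offD(5)[OF clZ T(1)]])
  have "U \<inter> T = T"
    using T(2) by blast
  then have "bounded_subset X (U - T)"
    using U(2) cfT T(3) unfolding one_ended_def by metis
  then show ?thesis
    by (rule that[OF Z(1,2) N T])
qed

text \<open>\<open>T\<close> splits into \<open>H\<close>, off the closure of \<open>N\<close>,
  which inherits one-endedness and omega-boundedness from \<open>U\<close>, and a collar
  \<open>A\<close> at \<open>Z\<close> inside the compact closure of \<open>N\<close>, where all
  other ends of \<open>T\<close> lie. The collar is Lindelof, which makes those ends short.\<close>

theorem long_trunk_exists:
  assumes tI: "type_I X" and U: "cf_open X U" "omega_bounded X U" "one_ended X U" "\<not> bounded_subset X U"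
  obtains T where "T \<subseteq> U" "bounded_subset X (U - T)" "embedded_long_trunk X T"
proof -
  obtain Z N T where Z: "compactin X Z" "connectedin X Z" and N: "openin X N" "Z \<subseteq> N" "compactin X (X closure_of N)"
    and T: "T \<in> components_off X Z" "T \<subseteq> U" "\<not> bounded_subset X T" "bounded_subset X (U - T)"
    by (rule unbounded_component[OF U(1,3,4)])
  have clZ: "closedin X Z"
    by (rule compactin_imp_closedin[OF Haus Z(1)])
  note opT = components_offD(1)[OF clZ T(1)] and conT = components_offD(2)[OF clZ T(1)]
    and neT = components_offD(3)[OF clZ T(1)] and frT = components_offD(5)[OF clZ T(1)]
  have TZ: "T \<inter> Z = {}"
    using components_offD(4)[OF clZ T(1)] by blast
  have NN: "N \<subseteq> X closure_of N"
    by (rule closure_of_subset[OF openin_subset[OF N(1)]])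

  \<comment> \<open>Closures and bounded sets in \<open>T\<close> and in \<open>X\<close>\<close>
  let ?Y = "subtopology X T"
  have TX: "T \<subseteq> topspace X"
    by (rule openin_subset[OF opT])
  have tY: "topspace ?Y = T"
    using TX by auto
  have mY: "manifold_of_dim n ?Y"
    by (rule open_submanifold[OF opT conT])
  interpret Y: n_manifold ?Y n
    by unfold_locales (rule mY)
  have opY: "openin ?Y S \<longleftrightarrow> openin X S \<and> S \<subseteq> T" for S
    using openin_open_subtopology[OF opT] by blast
  \<comment> \<open>The frontier of \<open>T\<close> lies in \<open>Z\<close>, inside the open set
    \<open>N\<close>; away from \<open>N\<close>, closures cannot leave \<open>T\<close>.\<close>
  have clTN: "X closure_of S \<subseteq> T - N" if S: "S \<subseteq> T - N" for S
  proof -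
    have "X closure_of S \<subseteq> X closure_of T"
      using S by (intro closure_of_mono) blast
    moreover have "N \<inter> X closure_of S = {}"
      by (rule openin_Int_closure_of_empty[OF N(1)]) (use S in blast)
    ultimately show ?thesis
      using frT N(2) by blast
  qed
  have clY: "?Y closure_of S = X closure_of S" if S: "S \<subseteq> T - N" for S
  proof -
    have "T \<inter> S = S" "T \<inter> X closure_of S = X closure_of S"
      using S clTN[OF S] by blast+
    then show ?thesis
      unfolding closure_of_subtopology by simp
  qed
  have bY: "bounded_subset ?Y S" if S: "S \<subseteq> T - N" "bounded_subset X S" for S
  proof -
    have "compactin ?Y (X closure_of S)"
      using bounded_closure[OF S(2)] clTN[OF S(1)] by (auto simp: compactin_subtopology)
    moreover have "S \<subseteq> X closure_of S"
      using closure_of_subset[of S X] S(1) TX by blast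
    ultimately show ?thesis
      unfolding bounded_subset_def by blast
  qed

  \<comment> \<open>The end of \<open>T\<close> away from \<open>Z\<close>\<close>
  define H where "H = T - X closure_of N"
  have HT: "H \<subseteq> T - N"
    unfolding H_def using NN by blast
  have opH: "openin X H"
    unfolding H_def using opT by (intro openin_diff closedin_closure_of)
  have frH: "X closure_of H - H \<subseteq> X closure_of N"
    using clTN[OF HT] unfolding H_def by blast
  have "bounded_subset ?Y (X closure_of H - H)"
  proof (rule bY)
    show "X closure_of H - H \<subseteq> T - N"
      using clTN[OF HT] by blast
    show "bounded_subset X (X closure_of H - H)"
      by (rule bounded_subset_mono[OF compactin_imp_bounded_subset[OF N(3)] frH])
  qed
  then have cfH: "cf_open ?Y H"
    unfolding cf_open_def clY[OF HT] opY using opH HT by blast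
  have TH: "T - H \<subseteq> X closure_of N"
    unfolding H_def by blast
  have unbH: "\<not> bounded_subset ?Y H"
  proof
    assume "bounded_subset ?Y H"
    then have "bounded_subset X H"
      by (rule bounded_subset_subtopology)
    then have "bounded_subset X (H \<union> X closure_of N)"
      using compactin_imp_bounded_subset[OF N(3)] by simp
    then have "bounded_subset X T"
      by (rule bounded_subset_mono) (use TH in blast)
    with T(3) show False ..
  qed
  have obH: "omega_bounded ?Y H"
    unfolding omega_bounded_def
  proof (intro allI impI, elim conjE)
    fix C assume C: "countable C" "C \<subseteq> H"
    then have "C \<subseteq> U"
      using HT T(2) by blast
    then have "bounded_subset X C"
      using U(2) C(1) unfolding omega_bounded_def by blast
    then show "bounded_subset ?Y C"
      using bY C(2) HT by blast
  qed
  have oneH: "one_ended ?Y H"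
    unfolding one_ended_def
  proof (intro allI impI)
    fix V assume V: "cf_open ?Y V"
    have "cf_open X (H \<inter> V)"
    proof (rule cf_openI)
      show "openin X (H \<inter> V)"
        using opH cf_openD(1)[OF V] unfolding opY by blast
      show "bounded_subset X ((?Y closure_of V - V) \<union> X closure_of N)"
        using V bounded_subset_subtopology[of X T] compactin_imp_bounded_subset[OF N(3)] unfolding cf_open_def by simp
      show "X closure_of (H \<inter> V) - H \<inter> V \<subseteq> (?Y closure_of V - V) \<union> X closure_of N"
      proof
        fix p assume p: "p \<in> X closure_of (H \<inter> V) - H \<inter> V"
        then have 1: "p \<in> X closure_of H"
          using closure_of_mono[of "H \<inter> V" H X] by blast
        have "?Y closure_of (H \<inter> V) = X closure_of (H \<inter> V)"
          by (rule clY) (use HT in blast)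
        then have "p \<in> ?Y closure_of V"
          using p closure_of_mono[of "H \<inter> V" V ?Y] by blast
        then show "p \<in> (?Y closure_of V - V) \<union> X closure_of N"
          using p 1 frH by blast
      qed
    qed
    then have "bounded_subset X (U \<inter> (H \<inter> V)) \<or> bounded_subset X (U - H \<inter> V)"
      using U(3) unfolding one_ended_def by blast
    then show "bounded_subset ?Y (H \<inter> V) \<or> bounded_subset ?Y (H - V)"
    proof
      assume "bounded_subset X (U \<inter> (H \<inter> V))"
      then have "bounded_subset X (H \<inter> V)"
        by (rule bounded_subset_mono) (use HT T(2) in blast)
      then show ?thesis
        using bY[of "H \<inter> V"] HT by blast
    next
      assume "bounded_subset X (U - H \<inter> V)"
      then have "bounded_subset X (H - V)"
        by (rule bounded_subset_mono) (use HT T(2) in blast)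
      then show ?thesis
        using bY[of "H - V"] HT by blast
    qed
  qed
  have HTY: "H \<subseteq> topspace ?Y"
    using tY HT by blast
  obtain e where e: "e \<in> ends ?Y" "\<And>W. e \<in> end_nbhd ?Y W \<Longrightarrow> \<not> bounded_subset ?Y (H \<inter> W)"
    by (rule Y.ends_cluster[OF HTY unbH]) (rule that)
  have "H \<inter> (topspace ?Y - ?Y closure_of H) = {}"
    using closure_of_subset[OF HTY] by blast
  then have "e \<notin> end_nbhd ?Y (topspace ?Y - ?Y closure_of H)"
    using e(2)[of "topspace ?Y - ?Y closure_of H"] by auto
  then have eH: "e \<in> end_nbhd ?Y H"
    using Y.end_cases[OF e(1) cfH] by blast
  have uniqH: "d = e" if "d \<in> ends ?Y" "d \<in> end_nbhd ?Y H" for d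
    by (rule Y.one_ended_unique[OF oneH e(1) eH that])
  have long: "long_end ?Y e"
    by (rule Y.omega_bounded_imp_long_end[OF e(1) cf_openD(1)[OF cfH] eH _ obH]) (use uniqH in blast)

  \<comment> \<open>Finiteness of the ends of \<open>T\<close> at \<open>Z\<close>\<close>
  define A where "A = topspace ?Y - ?Y closure_of H"
  have cfA: "cf_open ?Y A"
    unfolding A_def by (rule cf_open_Compl[OF cfH])
  have AN: "A \<subseteq> X closure_of N" "A \<subseteq> T"
    using closure_of_subset[OF HTY] TH tY unfolding A_def by blast+
  have endA: "d \<in> end_nbhd ?Y A" if "d \<in> ends ?Y" "d \<noteq> e" for d
    unfolding A_def using Y.end_cases[OF that(1) cfH] uniqH[OF that(1)] that(2) by blast
  have LA: "Lindelof_in ?Y A"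
    unfolding Lindelof_in_subtopology[OF TX]
    using AN bounded_imp_Lindelof_in[OF bounded_subset_mono[OF compactin_imp_bounded_subset[OF N(3)]]] by blast
  obtain m :: nat where m: "\<forall>k W (V :: nat \<Rightarrow> 'a set) U. openin X W \<and> Z \<subseteq> W \<and> W \<subseteq> N \<and>
      (\<forall>i\<le>k. openin X (V i) \<and> V i \<subseteq> T \<and> X closure_of V i \<inter> Z \<noteq> {} \<and> V i \<inter> U = {}) \<and>
      (\<forall>i\<le>k. \<forall>j\<le>k. i \<noteq> j \<longrightarrow> V i \<inter> V j = {}) \<and>
      openin X U \<and> W \<inter> T \<subseteq> U \<union> (\<Union>i\<le>k. V i) \<longrightarrow> k \<le> m"
    using finitely_many_ends_at_compact[OF Z opT conT neT TZ frT N] by (rule exE)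
  have fin: "finite (ends ?Y - {e})"
  proof (rule ccontr)
    assume inf: "infinite (ends ?Y - {e})"
    \<comment> \<open>Indexed by \<open>0, ..., m + 1\<close>, these ends form a family with
      \<open>k = m + 1\<close>, one more than the bound allows.\<close>
    obtain D where D: "finite D" "card D = m + 2" "D \<subseteq> ends ?Y - {e}"
      using infinite_arbitrarily_large[OF inf, of "m + 2"] by blast
    have DE: "D \<subseteq> ends ?Y"
      using D(3) by blast
    obtain V where V: "\<forall>d\<in>D. cf_open ?Y (V d) \<and> d \<in> end_nbhd ?Y (V d)"
      "\<forall>c\<in>D. \<forall>d\<in>D. c \<noteq> d \<longrightarrow> V c \<inter> V d = {}"
      by (rule exE[OF Y.ends_disjoint_nbhds[OF D(1) DE]]) (erule conjE, rule that)
    have VD: "cf_open ?Y (V d)" "d \<in> end_nbhd ?Y (V d)" if "d \<in> D" for d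
      using V(1) that by blast+
    have VT: "V d \<subseteq> T" "openin X (V d)" if "d \<in> D" for d
      using cf_openD(1)[OF VD(1)[OF that]] unfolding opY by blast+
    obtain h where h: "bij_betw h {0..<card D} D"
      using ex_bij_betw_nat_finite[OF D(1)] by blast
    have hD: "h i \<in> D" if "i \<le> m + 1" for i
      using bij_betwE[OF h] that D(2) by auto
    have hinj: "h i \<noteq> h j" if "i \<le> m + 1" "j \<le> m + 1" "i \<noteq> j" for i j
      using inj_onD[OF bij_betw_imp_inj_on[OF h], of i j] that D(2) by auto
    have hsurj: "\<exists>i\<le>m + 1. d = h i" if "d \<in> D" for d
    proof -
      have "d \<in> h ` {0..<card D}"
        using h that unfolding bij_betw_def by simp
      then obtain i where "i < card D" "d = h i"
        by auto
      then show ?thesis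
        using D(2) by (intro exI[of _ i]) simp
    qed
    define K where "K = (\<Union>d\<in>D. ?Y closure_of V d - V d)"
    define R where "R = T - (\<Union>d\<in>D. ?Y closure_of V d)"
    have "compactin ?Y K"
      unfolding K_def by (rule compactin_Union) (use D(1) Y.compact_frontier[OF VD(1)] in auto)
    then have K: "compactin X K" "K \<subseteq> T"
      by (simp_all add: compactin_subtopology)
    have "closedin ?Y (\<Union>d\<in>D. ?Y closure_of V d)"
      using D(1) by (intro closedin_Union) auto
    then have "openin ?Y (topspace ?Y - (\<Union>d\<in>D. ?Y closure_of V d))"
      by (intro openin_diff openin_topspace)
    then have opR: "openin X R"
      unfolding R_def tY opY by blast
    have "m + 1 \<le> m"
    \<comment> \<open>The frontiers of the sets \<open>V d\<close> form a compact subset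
      \<open>K\<close> of \<open>T\<close>. Without it, \<open>N\<close> is still a neighbourhood of
      \<open>Z\<close>, and there \<open>R\<close> and the sets \<open>V d\<close> cover
      \<open>T\<close>.\<close>
    proof (rule m[rule_format, of "N - K" "m + 1" "\<lambda>i. V (h i)" R], intro conjI allI impI)
      show "openin X (N - K)"
        by (rule openin_diff[OF N(1) compactin_imp_closedin[OF Haus K(1)]])
      show "Z \<subseteq> N - K"
        using N(2) K(2) TZ by blast
      show "N - K \<subseteq> N" by blast
      show "openin X R" by (rule opR)
      show "V (h i) \<inter> V (h j) = {}" if "i \<le> m + 1" "j \<le> m + 1" "i \<noteq> j" for i j
        using V(2) hD[OF that(1)] hD[OF that(2)] hinj[OF that] by blast
      show "(N - K) \<inter> T \<subseteq> R \<union> (\<Union>i\<le>m + 1. V (h i))"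
      proof
        fix x assume x: "x \<in> (N - K) \<inter> T"
        show "x \<in> R \<union> (\<Union>i\<le>m + 1. V (h i))"
        proof (cases "x \<in> R")
          case False
          then obtain d where d: "d \<in> D" "x \<in> ?Y closure_of V d"
            unfolding R_def using x by blast
          then have "x \<in> V d"
            using x unfolding K_def by blast
          moreover obtain i where "i \<le> m + 1" "d = h i"
            using hsurj[OF d(1)] by blast
          ultimately show ?thesis by blast
        qed simp
      qed
    next
      fix i assume i: "i \<le> m + 1"
      let ?d = "h i"
      have d: "?d \<in> ends ?Y" "?d \<noteq> e"
        using hD[OF i] D(3) by blast+
      have VY: "V ?d \<subseteq> ?Y closure_of V ?d"
        by (rule closure_of_subset[OF cf_openD(2)[OF VD(1)[OF hD[OF i]]]])
      \<comment> \<open>Otherwise the closure of \<open>V ?d\<close> would stay in \<open>T\<close>;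
        then \<open>V ?d \<inter> A\<close>, inside the compact closure of \<open>N\<close>, would
        be bounded in \<open>T\<close> although it is a neighbourhood of an end.\<close>
      have "X closure_of V ?d \<inter> Z \<noteq> {}"
      proof
        assume n: "X closure_of V ?d \<inter> Z = {}"
        have "X closure_of V ?d \<subseteq> X closure_of T"
          using VT(1)[OF hD[OF i]] by (rule closure_of_mono)
        then have "X closure_of V ?d \<subseteq> T"
          using n frT by blast
        moreover have "X closure_of (V ?d \<inter> A) \<subseteq> X closure_of V ?d"
          by (rule closure_of_mono) blast
        moreover have "X closure_of (V ?d \<inter> A) \<subseteq> X closure_of N"
          by (rule closure_of_minimal) (use AN in auto)
        then have "compactin X (X closure_of (V ?d \<inter> A))"
          by (rule closed_compactin[OF N(3)]) simp
        ultimately have "compactin ?Y (X closure_of (V ?d \<inter> A))"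
          by (auto simp: compactin_subtopology)
        moreover have "V ?d \<inter> A \<subseteq> X closure_of (V ?d \<inter> A)"
          by (rule closure_of_subset) (use AN(2) TX in blast)
        ultimately have "bounded_subset ?Y (V ?d \<inter> A)"
          unfolding bounded_subset_def by blast
        moreover have "?d \<in> end_nbhd ?Y (V ?d \<inter> A)"
          using VD(2)[OF hD[OF i]] endA[OF d] unfolding Y.end_nbhd_Int by blast
        ultimately show False
          using Y.end_nbhd_unbounded[OF d(1)] by blast
      qed
      moreover have "V ?d \<inter> R = {}"
        unfolding R_def using VY hD[OF i] by blast
      ultimately show "X closure_of V ?d \<inter> Z \<noteq> {}" "V ?d \<inter> R = {}"
        by simp_all
      show "openin X (V ?d)" "V ?d \<subseteq> T"
        using VT[OF hD[OF i]] by simp_all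
    qed
    then show False by simp
  qed
  have finE: "finite (ends ?Y)"
    using fin by simp

  \<comment> \<open>The ends of \<open>T\<close> at \<open>Z\<close> are short\<close>
  have short: "short_end ?Y d \<and> \<not> long_end ?Y d" if d: "d \<in> ends ?Y" "d \<noteq> e" for d
  proof -
    have fd: "finite (ends ?Y - {d})" "ends ?Y - {d} \<subseteq> ends ?Y - {d}"
      using finE by simp_all
    obtain V where V: "cf_open ?Y V" "d \<in> end_nbhd ?Y V" "(ends ?Y - {d}) \<inter> end_nbhd ?Y V = {}"
      by (rule Y.ends_isolating_nbhd[OF fd(1) d(1) fd(2)])
    define B where "B = V \<inter> A"
    have B: "cf_open ?Y B" "d \<in> end_nbhd ?Y B"
      unfolding B_def using V(1,2) cfA endA[OF d] by (simp_all add: cf_open_Int Y.end_nbhd_Int)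
    have "end_nbhd ?Y B \<subseteq> end_nbhd ?Y V"
      unfolding B_def by (rule end_nbhd_mono) blast
    then have oneB: "ends ?Y \<inter> end_nbhd ?Y B \<subseteq> {d}"
      using V(3) by blast
    have LB: "Lindelof_in ?Y B"
      by (rule Y.Lindelof_in_subset[OF LA]) (simp add: B_def)
    obtain \<G> where \<G>: "countable \<G>" "\<And>N. N \<in> \<G> \<Longrightarrow> openin ?Y N" "\<And>N. N \<in> \<G> \<Longrightarrow> compactin ?Y (?Y closure_of N)"
      "\<And>N. N \<in> \<G> \<Longrightarrow> ?Y closure_of N \<subseteq> B" "\<And>K. compactin ?Y K \<Longrightarrow> K \<subseteq> B \<Longrightarrow> \<exists>N\<in>\<G>. K \<subseteq> N"
      by (rule Y.compact_exhaustion[OF cf_openD(1)[OF B(1)] Y.second_countable_subset[OF LB order_refl]]) (rule that)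
    \<comment> \<open>\<open>B\<close> excludes the other ends and is exhausted by countably many
      sets with compact closure, whose exteriors exclude the points of \<open>B\<close>.\<close>
    define \<W> where "\<W> = insert B ((\<lambda>G. topspace ?Y - ?Y closure_of G) ` \<G>)"
    have "short_end ?Y d"
    proof (rule Y.short_endI[OF d(1), of \<W>])
      show "countable \<W>" "\<W> \<noteq> {}"
        unfolding \<W>_def using \<G>(1) by simp_all
      show "openin ?Y W" if "W \<in> \<W>" for W
      proof -
        from that consider "W = B" | G where "W = topspace ?Y - ?Y closure_of G"
          unfolding \<W>_def by blast
        then show ?thesis
        proof cases
          case 1
          then show ?thesis
            using cf_openD(1)[OF B(1)] by simp
        next
          case (2 G)
          have "openin ?Y (topspace ?Y - ?Y closure_of G)"
            by (intro openin_diff openin_topspace closedin_closure_of)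
          then show ?thesis
            unfolding 2 .
        qed
      qed
      show "d \<in> end_nbhd ?Y W" if "W \<in> \<W>" for W
      proof -
        from that consider "W = B" | G where "G \<in> \<G>" "W = topspace ?Y - ?Y closure_of G"
          unfolding \<W>_def by blast
        then show ?thesis
        proof cases
          case 1
          then show ?thesis
            using B(2) by simp
        next
          case (2 G)
          then show ?thesis
            using Y.end_nbhd_Compl[OF d(1) compactin_imp_bounded_subset[OF \<G>(3)[OF 2(1)]]] by simp
        qed
      qed
      show "\<Inter>\<W> = {}"
      proof (rule equals0I)
        fix x assume x: "x \<in> \<Inter>\<W>"
        then have xB: "x \<in> B"
          unfolding \<W>_def by blast
        have "x \<in> topspace ?Y"
          using xB cf_openD(2)[OF B(1)] by blast
        then have "compactin ?Y {x}" "{x} \<subseteq> B"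
          using xB by simp_all
        then obtain G where G: "G \<in> \<G>" "{x} \<subseteq> G"
          using \<G>(5)[of "{x}"] by blast
        have "x \<in> ?Y closure_of G"
          using closure_of_subset[OF openin_subset[OF \<G>(2)[OF G(1)]]] G(2) by blast
        moreover have "topspace ?Y - ?Y closure_of G \<in> \<W>"
          unfolding \<W>_def using G(1) by blast
        ultimately show False
          using x by blast
      qed
      show "\<exists>W\<in>\<W>. d' \<notin> end_nbhd ?Y W" if "d' \<in> ends ?Y" "d' \<noteq> d" for d'
        using that oneB unfolding \<W>_def by blast
    qed
    \<comment> \<open>A long end would make the Lindelof set \<open>B\<close> omega-bounded, hence
      bounded, but \<open>B\<close> is a neighbourhood of an end.\<close>
    moreover have "\<not> long_end ?Y d"
    proof
      assume "long_end ?Y d"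
      then have "omega_bounded ?Y B"
        by (rule Y.long_end_imp_omega_bounded[OF _ B(1) oneB])
      then have "bounded_subset ?Y B"
        by (rule Y.omega_bounded_Lindelof[OF _ order_refl LB])
      then show False
        using Y.end_nbhd_unbounded[OF d(1) B(2)] by blast
    qed
    ultimately show ?thesis by blast
  qed
  have edp: "end_dichotomy ?Y"
    unfolding end_dichotomy_def using short long by blast
  have ex1: "\<exists>!d. long_end ?Y d"
  proof (rule ex1I[of "long_end ?Y" e, OF long])
    fix d assume "long_end ?Y d"
    moreover from this have "d \<in> ends ?Y"
      unfolding long_end_def by blast
    ultimately show "d = e"
      using short by blast
  qed

  \<comment> \<open>\<open>T\<close> is trunklike\<close>
  have trunk: "trunklike ?Y"
    unfolding trunklike_def
  proof (intro conjI allI impI)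
    show "locally_connected_space ?Y"
      by (rule Y.locally_connected)
    fix C assume C: "closedin ?Y C \<and> Lindelof_space (subtopology ?Y C)"
    then have clC: "closedin ?Y C" and CT: "C \<subseteq> T"
      using closedin_subset[of ?Y C] tY by blast+
    have "Lindelof_in ?Y C"
      unfolding Lindelof_in_def using C closedin_subset[of ?Y C] by blast
    then have "Lindelof_in X C"
      unfolding Lindelof_in_subtopology[OF TX] by blast
    then have "Lindelof_in X (C - N)"
      by (rule Lindelof_in_subset) blast
    then have "bounded_subset X (C - N)"
      using omega_bounded_Lindelof[OF U(2)] CT T(2) by blast
    then have bC: "bounded_subset ?Y (C - N)"
      using bY[of "C - N"] CT by blast
    \<comment> \<open>What \<open>T\<close> has outside of \<open>H\<close> lies in the compact
      closure of \<open>N\<close>, so a non-Lindelof component must have an unbounded trace on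
      \<open>H\<close>.\<close>
    have small: "Lindelof_in ?Y K" if K: "K \<subseteq> T" "bounded_subset ?Y (K \<inter> H)" for K
    proof -
      have "Lindelof_in X ((K \<inter> H) \<union> X closure_of N)"
        by (rule bounded_imp_Lindelof_in)
          (use bounded_subset_subtopology[OF K(2)] compactin_imp_bounded_subset[OF N(3)] in simp)
      then have "Lindelof_in X K"
        by (rule Lindelof_in_subset) (use TH K(1) in blast)
      then show ?thesis
        unfolding Lindelof_in_subtopology[OF TX] using K(1) by blast
    qed
    show "\<exists>\<^sub>\<le>\<^sub>1 K. K \<in> components_off ?Y C \<and> \<not> Lindelof_space (subtopology ?Y K)"
    proof (rule Uniq_I, rule ccontr)
      fix K L assume K: "K \<in> components_off ?Y C \<and> \<not> Lindelof_space (subtopology ?Y K)"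
        and L: "L \<in> components_off ?Y C \<and> \<not> Lindelof_space (subtopology ?Y L)" and "K \<noteq> L"
      then have KL: "K \<inter> L = {}"
        using Y.components_off_disjoint[of K C L] by blast
      have opK: "openin ?Y K"
        using Y.components_offD(1)[OF clC] K by blast
      have KT: "K \<subseteq> T" and LT: "L \<subseteq> T"
        using Y.components_offD(4)[OF clC] K L tY by blast+
      have frK: "?Y closure_of K - K \<subseteq> C"
        using Y.components_offD(5)[OF clC] K by blast
      \<comment> \<open>The frontier of \<open>K\<close> lies in \<open>C\<close>, and only the
        bounded part \<open>C - N\<close> matters near \<open>H\<close>. One-endedness of
        \<open>H\<close> then leaves a bounded trace to \<open>K\<close> or to the disjoint
        component \<open>L\<close>.\<close>
      have "cf_open ?Y (H \<inter> K)"
      proof (rule cf_openI)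
        show "openin ?Y (H \<inter> K)"
          using cf_openD(1)[OF cfH] opK by (rule openin_Int)
        show "bounded_subset ?Y ((?Y closure_of H - H) \<union> (C - N))"
          using bC cfH unfolding cf_open_def by simp
        show "?Y closure_of (H \<inter> K) - H \<inter> K \<subseteq> (?Y closure_of H - H) \<union> (C - N)"
        proof
          fix p assume p: "p \<in> ?Y closure_of (H \<inter> K) - H \<inter> K"
          have 1: "p \<in> ?Y closure_of H" and 2: "p \<in> ?Y closure_of K"
            using p closure_of_mono[of "H \<inter> K" H ?Y] closure_of_mono[of "H \<inter> K" K ?Y] by blast+
          have "p \<notin> N"
            using 1 clY[OF HT] clTN[OF HT] by blast
          then show "p \<in> (?Y closure_of H - H) \<union> (C - N)"
            using p 1 2 frK by blast
        qed
      qed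
      then have "bounded_subset ?Y (H \<inter> (H \<inter> K)) \<or> bounded_subset ?Y (H - H \<inter> K)"
        using oneH unfolding one_ended_def by blast
      then show False
      proof
        assume "bounded_subset ?Y (H \<inter> (H \<inter> K))"
        then have "bounded_subset ?Y (K \<inter> H)"
          by (rule bounded_subset_mono) blast
        then show False
          using small[OF KT] K unfolding Lindelof_in_def by blast
      next
        assume "bounded_subset ?Y (H - H \<inter> K)"
        then have "bounded_subset ?Y (L \<inter> H)"
          by (rule bounded_subset_mono) (use KL in blast)
        then show False
          using small[OF LT] L unfolding Lindelof_in_def by blast
      qed
    qed
  qed
  have "long_trunk ?Y"
    unfolding long_trunk_def manifold_def
    using mY open_subset_type_I[OF tI opT] trunk edp finE ex1 by blast
  then have "embedded_long_trunk X T"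
    unfolding embedded_long_trunk_def using TX mani mY by blast
  then show ?thesis
    by (rule that[OF T(2,4)])
qed

end

context lc_Hausdorff
begin

text \<open>A given countable base need not come from sets with compact frontier. For every pair of
  base sets between which the ends of such a set fit, one is selected; countably many pairs yield
  countably many sets, and they still form a base.\<close>

lemma countable_cf_base:
  assumes "second_countable (end_space X)"
  obtains \<B> where "countable \<B>" "\<And>B. B \<in> \<B> \<Longrightarrow> cf_open X B"
    "\<And>e W. e \<in> ends X \<Longrightarrow> e \<in> end_nbhd X W \<Longrightarrow> openin X W \<Longrightarrow>
      \<exists>B\<in>\<B>. e \<in> end_nbhd X B \<and> ends X \<inter> end_nbhd X B \<subseteq> end_nbhd X W"
proof -
  obtain \<O> where O0: "countable \<O> \<and> (\<forall>V\<in>\<O>. openin (end_space X) V) \<and>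
      (\<forall>U x. openin (end_space X) U \<and> x \<in> U \<longrightarrow> (\<exists>V\<in>\<O>. x \<in> V \<and> V \<subseteq> U))"
    using assms unfolding second_countable_def by (elim exE) (rule that)
  have O: "countable \<O>" "\<And>V. V \<in> \<O> \<Longrightarrow> openin (end_space X) V"
    "\<And>U x. openin (end_space X) U \<Longrightarrow> x \<in> U \<Longrightarrow> \<exists>V\<in>\<O>. x \<in> V \<and> V \<subseteq> U"
    using O0 by simp_all
  have op: "openin (end_space X) (ends X \<inter> end_nbhd X W)" if "openin X W" for W
    unfolding end_space_def using openin_end_nbhd[OF that] by (simp add: openin_subtopology_Int2)
  define P where "P p B \<longleftrightarrow> cf_open X B \<and> fst p \<subseteq> ends X \<inter> end_nbhd X B \<and> ends X \<inter> end_nbhd X B \<subseteq> snd p" for p B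
  define \<B> where "\<B> = (\<lambda>p. SOME B. P p B) ` {p \<in> \<O> \<times> \<O>. \<exists>B. P p B}"
  have "countable \<B>"
    unfolding \<B>_def using O(1) by simp
  moreover have "cf_open X B" if B: "B \<in> \<B>" for B
  proof -
    obtain p where p: "\<exists>B. P p B" "B = (SOME B. P p B)"
      using B unfolding \<B>_def by blast
    have "P p B"
      unfolding p(2) by (rule someI_ex[OF p(1)])
    then show ?thesis
      unfolding P_def by simp
  qed
  moreover have "\<exists>B\<in>\<B>. e \<in> end_nbhd X B \<and> ends X \<inter> end_nbhd X B \<subseteq> end_nbhd X W"
    if e: "e \<in> ends X" "e \<in> end_nbhd X W" "openin X W" for e W
  proof -
    have "e \<in> ends X \<inter> end_nbhd X W"
      using e by simp
    from O(3)[OF op[OF e(3)] this]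
    obtain O2 where O2: "O2 \<in> \<O>" "e \<in> O2" "O2 \<subseteq> ends X \<inter> end_nbhd X W"
      by blast
    obtain W' where W': "openin (freudenthal X) W'" "O2 = W' \<inter> ends X"
      using O(2)[OF O2(1)] unfolding end_space_def openin_subtopology by (elim exE conjE)
    have "e \<in> W'"
      using O2(2) W'(2) by simp
    then obtain V where V: "openin X V" "e \<in> end_nbhd X V" "end_nbhd X V \<subseteq> W'"
      by (rule freudenthal_base[OF W'(1)])
    obtain C where C: "cf_open X C" "e \<in> end_nbhd X C" "X closure_of C \<subseteq> V"
      by (rule end_cf_base[OF e(1) V(2)])
    have "C \<subseteq> V"
      using C(3) closure_of_subset[OF cf_openD(2)[OF C(1)]] by blast
    then have CO2: "ends X \<inter> end_nbhd X C \<subseteq> O2"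
      using end_nbhd_mono[of C V X] V(3) W'(2) by blast
    have "e \<in> ends X \<inter> end_nbhd X C"
      using e(1) C(2) by simp
    from O(3)[OF op[OF cf_openD(1)[OF C(1)]] this]
    obtain O1 where O1: "O1 \<in> \<O>" "e \<in> O1" "O1 \<subseteq> ends X \<inter> end_nbhd X C"
      by blast
    have ex: "\<exists>B. P (O1, O2) B"
      unfolding P_def using C(1) O1(3) CO2 by auto
    define B where "B = (SOME B. P (O1, O2) B)"
    have PB: "P (O1, O2) B"
      unfolding B_def by (rule someI_ex[OF ex])
    have "B \<in> \<B>"
      unfolding \<B>_def B_def using ex O1(1) O2(1) by blast
    moreover have "e \<in> end_nbhd X B" "ends X \<inter> end_nbhd X B \<subseteq> end_nbhd X W"
      using PB O1(2) O2(3) unfolding P_def by auto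
    ultimately show ?thesis by blast
  qed
  ultimately show ?thesis
    by (rule that)
qed

text \<open>Otherwise each base neighbourhood of \<open>e\<close> contains another end. Choosing one
  in each gives a countable set that accumulates at \<open>e\<close>, which a weak P-point
  excludes.\<close>

lemma long_end_isolated:
  assumes e: "long_end X e" and B: "countable \<B>" 
    and base: "\<And>W. e \<in> end_nbhd X W \<Longrightarrow> openin X W \<Longrightarrow>
      \<exists>B\<in>\<B>. e \<in> end_nbhd X B \<and> ends X \<inter> end_nbhd X B \<subseteq> end_nbhd X W"
  shows "\<exists>B\<in>\<B>. e \<in> end_nbhd X B \<and> ends X \<inter> end_nbhd X B \<subseteq> {e}"
proof (rule ccontr)
  assume n: "\<not> (\<exists>B\<in>\<B>. e \<in> end_nbhd X B \<and> ends X \<inter> end_nbhd X B \<subseteq> {e})"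
  have eE: "e \<in> ends X"
    using e unfolding long_end_def by blast
  let ?C = "{B \<in> \<B>. e \<in> end_nbhd X B}"
  have "\<forall>B\<in>?C. \<exists>d. d \<in> ends X \<inter> end_nbhd X B \<and> d \<noteq> e"
    using n by blast
  from bchoice[OF this] obtain d where d: "\<forall>B\<in>?C. d B \<in> ends X \<inter> end_nbhd X B \<and> d B \<noteq> e"
    by (rule exE)
  have "countable (d ` ?C)"
    using B by simp
  moreover have "d ` ?C \<subseteq> topspace (freudenthal X)"
  proof (rule image_subsetI)
    fix B assume "B \<in> ?C"
    then have "d B \<in> ends X"
      using d by simp
    then show "d B \<in> topspace (freudenthal X)"
      by (rule end_in_topspace)
  qed
  ultimately have "e \<notin> freudenthal X derived_set_of (d ` ?C)"
    using e unfolding long_end_def by simp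
  then obtain T where T: "e \<in> T" "openin (freudenthal X) T" "\<And>y. y \<noteq> e \<Longrightarrow> y \<in> d ` ?C \<Longrightarrow> y \<notin> T"
    using end_in_topspace[OF eE] unfolding derived_set_of_def by blast
  obtain W where W: "openin X W" "e \<in> end_nbhd X W" "end_nbhd X W \<subseteq> T"
    by (rule freudenthal_base[OF T(2,1)])
  obtain B where B: "B \<in> \<B>" "e \<in> end_nbhd X B" "ends X \<inter> end_nbhd X B \<subseteq> end_nbhd X W"
    using base[OF W(2,1)] by blast
  then have BC: "B \<in> ?C" by simp
  then have "d B \<in> ends X \<inter> end_nbhd X B" "d B \<noteq> e"
    using d by simp_all
  moreover from this have "d B \<in> T"
    using B(3) W(3) by blast
  ultimately show False
    using T(3)[of "d B"] BC by simp
qed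

end

context n_manifold
begin

text \<open>Different long ends have different isolating sets in the countable base, so there are
  countably many of them, and they are numbered by natural numbers.\<close>

lemma disjoint_long_end_nbhds:
  assumes sc: "second_countable (end_space X)"
  obtains I :: "nat set" and U e where
    "\<And>i. i \<in> I \<Longrightarrow> cf_open X (U i)" "\<And>i. i \<in> I \<Longrightarrow> long_end X (e i)" "\<And>i. i \<in> I \<Longrightarrow> e i \<in> end_nbhd X (U i)"
    "\<And>i. i \<in> I \<Longrightarrow> ends X \<inter> end_nbhd X (U i) \<subseteq> {e i}" "\<And>d. long_end X d \<Longrightarrow> \<exists>i\<in>I. d = e i"
    "\<And>i j. i \<in> I \<Longrightarrow> j \<in> I \<Longrightarrow> i \<noteq> j \<Longrightarrow> U i \<inter> U j = {}"
proof -
  obtain \<B> where B: "countable \<B>" "\<And>B. B \<in> \<B> \<Longrightarrow> cf_open X B"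
    "\<And>e W. e \<in> ends X \<Longrightarrow> e \<in> end_nbhd X W \<Longrightarrow> openin X W \<Longrightarrow>
      \<exists>B\<in>\<B>. e \<in> end_nbhd X B \<and> ends X \<inter> end_nbhd X B \<subseteq> end_nbhd X W"
    by (rule countable_cf_base[OF sc]) (rule that)
  define E where "E = Collect (long_end X)"
  have EE: "d \<in> ends X" if "d \<in> E" for d
    using that unfolding E_def long_end_def by simp
  have "\<forall>d\<in>E. \<exists>B. B \<in> \<B> \<and> d \<in> end_nbhd X B \<and> ends X \<inter> end_nbhd X B \<subseteq> {d}"
  proof
    fix d assume d: "d \<in> E"
    then have "long_end X d"
      unfolding E_def by simp
    from long_end_isolated[OF this B(1) B(3)[OF EE[OF d]]]
    show "\<exists>B. B \<in> \<B> \<and> d \<in> end_nbhd X B \<and> ends X \<inter> end_nbhd X B \<subseteq> {d}"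
      by blast
  qed
  from bchoice[OF this] obtain b where
    b0: "\<forall>d\<in>E. b d \<in> \<B> \<and> d \<in> end_nbhd X (b d) \<and> ends X \<inter> end_nbhd X (b d) \<subseteq> {d}"
    by (rule exE)
  have b: "b d \<in> \<B>" "d \<in> end_nbhd X (b d)" "ends X \<inter> end_nbhd X (b d) \<subseteq> {d}" if "d \<in> E" for d
    using b0 that by simp_all
  have bcf: "cf_open X (b d)" if "d \<in> E" for d
    by (rule B(2)[OF b(1)[OF that]])
  have "inj_on b E"
  proof (rule inj_onI)
    fix c d assume cd: "c \<in> E" "d \<in> E" "b c = b d"
    then have "c \<in> ends X \<inter> end_nbhd X (b d)"
      using b(2)[OF cd(1)] EE[OF cd(1)] by simp
    then show "c = d"
      using b(3)[OF cd(2)] by blast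
  qed
  moreover have "countable (b ` E)"
    by (rule countable_subset[OF _ B(1)]) (use b(1) in blast)
  ultimately have cE: "countable E"
    using countable_image_inj_on by blast
  define I where "I = to_nat_on E ` E"
  define e where "e i = from_nat_into E i" for i
  have eI: "e (to_nat_on E d) = d" if "d \<in> E" for d
    unfolding e_def by (rule from_nat_into_to_nat_on[OF cE that])
  have eE: "e i \<in> E" if "i \<in> I" for i
    using that eI unfolding I_def by auto
  have einj: "e i \<noteq> e j" if "i \<in> I" "j \<in> I" "i \<noteq> j" for i j
    using that eI unfolding I_def by auto
  \<comment> \<open>Only the exteriors of earlier sets are intersected. They are finitely many, so
    the frontier stays compact, and each contains \<open>e i\<close> because \<open>e i\<close> does
    not lie in the earlier set.\<close>
  define F where "F i = (\<lambda>j. topspace X - X closure_of b (e j)) ` {j \<in> I. j < i}" for i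
  define U where "U i = b (e i) \<inter> (topspace X \<inter> \<Inter>(F i))" for i
  have finF: "finite (F i)" for i
    unfolding F_def by simp
  have Ub: "U i \<subseteq> b (e i)" for i
    unfolding U_def by blast
  show ?thesis
  proof (rule that[of I U e])
    fix i assume i: "i \<in> I"
    have eiE: "e i \<in> ends X"
      by (rule EE[OF eE[OF i]])
    show "cf_open X (U i)"
      unfolding U_def
    proof (rule cf_open_Int[OF bcf[OF eE[OF i]] cf_open_Inter[OF finF]])
      fix S assume "S \<in> F i"
      then obtain j where "j \<in> I" "S = topspace X - X closure_of b (e j)"
        unfolding F_def by blast
      then show "cf_open X S"
        using cf_open_Compl[OF bcf[OF eE]] by simp
    qed
    show "long_end X (e i)"
      using eE[OF i] unfolding E_def by simp
    have "e i \<in> end_nbhd X (topspace X \<inter> \<Inter>(F i))"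
    proof (rule end_nbhd_Inter[OF finF end_in_topspace[OF eiE]])
      fix S assume "S \<in> F i"
      then obtain j where j: "j \<in> I" "j < i" "S = topspace X - X closure_of b (e j)"
        unfolding F_def by blast
      then have "e i \<notin> end_nbhd X (b (e j))"
        using b(3)[OF eE[OF j(1)]] einj[OF i j(1)] eiE by auto
      then show "e i \<in> end_nbhd X S"
        using end_cases[OF eiE bcf[OF eE[OF j(1)]]] j(3) by simp
    qed
    then show "e i \<in> end_nbhd X (U i)"
      unfolding U_def end_nbhd_Int[of "b (e i)"] using b(2)[OF eE[OF i]] by simp
    show "ends X \<inter> end_nbhd X (U i) \<subseteq> {e i}"
      using b(3)[OF eE[OF i]] end_nbhd_mono[OF Ub, of X i] by blast
  next
    fix d assume "long_end X d"
    then have d: "d \<in> E"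
      unfolding E_def by simp
    then have "to_nat_on E d \<in> I"
      unfolding I_def by blast
    then show "\<exists>i\<in>I. d = e i"
      using eI[OF d] by metis
  next
    have *: "U i \<inter> U j = {}" if "i \<in> I" "j \<in> I" "j < i" for i j
    proof -
      have "topspace X - X closure_of b (e j) \<in> F i"
        unfolding F_def using that by blast
      then have "U i \<subseteq> topspace X - X closure_of b (e j)"
        unfolding U_def by blast
      moreover have "U j \<subseteq> X closure_of b (e j)"
        using Ub[of j] closure_of_subset[OF cf_openD(2)[OF bcf[OF eE[OF that(2)]]]] by blast
      ultimately show ?thesis by blast
    qed
    fix i j :: nat assume "i \<in> I" "j \<in> I" "i \<noteq> j"
    then show "U i \<inter> U j = {}"
      using *[of i j] *[of j i] by (cases "i < j") auto
  qed
qed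

theorem second_countable_ends_imp_trunks:
  assumes tI: "type_I X" and sc: "second_countable (end_space X)" and edp: "end_dichotomy X"
    and x0: "x0 \<in> topspace X"
  shows "\<exists>(I :: nat set) T. (\<forall>i\<in>I. embedded_long_trunk X (T i)) \<and> disjoint_family_on T I \<and>
    Lindelof_space (subtopology X (topspace X - X closure_of (\<Union>i\<in>I. T i)))"
proof -
  obtain I :: "nat set" and U e where U: "\<And>i. i \<in> I \<Longrightarrow> cf_open X (U i)" "\<And>i. i \<in> I \<Longrightarrow> long_end X (e i)"
    "\<And>i. i \<in> I \<Longrightarrow> e i \<in> end_nbhd X (U i)" "\<And>i. i \<in> I \<Longrightarrow> ends X \<inter> end_nbhd X (U i) \<subseteq> {e i}"
    "\<And>d. long_end X d \<Longrightarrow> \<exists>i\<in>I. d = e i" "\<And>i j. i \<in> I \<Longrightarrow> j \<in> I \<Longrightarrow> i \<noteq> j \<Longrightarrow> U i \<inter> U j = {}"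
    by (rule disjoint_long_end_nbhds[OF sc]) (rule that)
  have "\<forall>i\<in>I. \<exists>T. T \<subseteq> U i \<and> bounded_subset X (U i - T) \<and> embedded_long_trunk X T"
  proof
    fix i assume i: "i \<in> I"
    have "e i \<in> ends X"
      using U(2)[OF i] unfolding long_end_def by simp
    then have nb: "\<not> bounded_subset X (U i)"
      using end_nbhd_unbounded U(3)[OF i] by blast
    obtain T where "T \<subseteq> U i" "bounded_subset X (U i - T)" "embedded_long_trunk X T"
      by (rule long_trunk_exists[OF tI U(1)[OF i] long_end_imp_omega_bounded[OF U(2)[OF i] U(1)[OF i] U(4)[OF i]]
          one_endedI[OF U(1)[OF i] U(4)[OF i]] nb])
    then show "\<exists>T. T \<subseteq> U i \<and> bounded_subset X (U i - T) \<and> embedded_long_trunk X T"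
      by blast
  qed
  from bchoice[OF this] obtain T where
    "\<forall>i\<in>I. T i \<subseteq> U i \<and> bounded_subset X (U i - T i) \<and> embedded_long_trunk X (T i)"
    by (rule exE)
  then have T: "\<And>i. i \<in> I \<Longrightarrow> T i \<subseteq> U i" "\<And>i. i \<in> I \<Longrightarrow> bounded_subset X (U i - T i)"
    "\<And>i. i \<in> I \<Longrightarrow> embedded_long_trunk X (T i)"
    by simp_all
  obtain \<B> where B: "countable \<B>" "\<And>B. B \<in> \<B> \<Longrightarrow> cf_open X B"
    "\<And>e W. e \<in> ends X \<Longrightarrow> e \<in> end_nbhd X W \<Longrightarrow> openin X W \<Longrightarrow>
      \<exists>B\<in>\<B>. e \<in> end_nbhd X B \<and> ends X \<inter> end_nbhd X B \<subseteq> end_nbhd X W"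
    by (rule countable_cf_base[OF sc]) (rule that)
  \<comment> \<open>The remainders \<open>U i - T i\<close> are included so that a component inside
    \<open>U i\<close> lies in \<open>T i\<close>; \<open>x0\<close> keeps \<open>L\<close>
    nonempty, as \<open>countable_components_off\<close> requires.\<close>
  define S where "S = (\<Union>B\<in>\<B>. X closure_of B - B) \<union> (\<Union>i\<in>I. X closure_of U i - U i) \<union> (\<Union>i\<in>I. U i - T i) \<union> {x0}"
  have LS: "Lindelof_in X S"
    unfolding S_def
  proof (rule Lindelof_in_Un[OF Lindelof_in_Un[OF Lindelof_in_Un]])
    show "Lindelof_in X (\<Union>B\<in>\<B>. X closure_of B - B)"
      by (rule Lindelof_in_UN[OF B(1) compactin_imp_Lindelof_in[OF compact_frontier[OF B(2)]]])
    show "Lindelof_in X (\<Union>i\<in>I. X closure_of U i - U i)"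
      by (rule Lindelof_in_UN[OF _ compactin_imp_Lindelof_in[OF compact_frontier[OF U(1)]]]) simp
    show "Lindelof_in X (\<Union>i\<in>I. U i - T i)"
      by (rule Lindelof_in_UN[OF _ bounded_imp_Lindelof_in[OF T(2)]]) simp
    show "Lindelof_in X {x0}"
      by (rule compactin_imp_Lindelof_in) (simp add: x0)
  qed
  define L where "L = X closure_of S"
  have LL: "Lindelof_in X L"
    unfolding L_def by (rule type_I_Lindelof_closure[OF tI LS])
  have SL: "S \<subseteq> L"
    unfolding L_def by (rule closure_of_subset) (use LS in \<open>simp add: Lindelof_in_def\<close>)
  have clL: "closedin X L"
    unfolding L_def by simp
  have neL: "L \<noteq> {}"
    using SL unfolding S_def by blast
  obtain G where G: "openin X G" "second_countable (subtopology X G)" "L \<subseteq> G"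
    by (rule second_countable_nbhd[OF LL])
  have cnt: "countable (components_off X L)"
    by (rule countable_components_off[OF clL neL G])
  \<comment> \<open>A component off \<open>L\<close> cannot leave an open set that it meets, if the
    frontier of that set belongs to \<open>S\<close>. Since an unbounded component clusters at an
    end \<open>d\<close>, it is trapped in every base neighbourhood of \<open>d\<close>.\<close>
  have inside: "Y \<subseteq> V" if Y: "Y \<in> components_off X L" and V: "openin X V" "X closure_of V - V \<subseteq> S" "Y \<inter> V \<noteq> {}" for Y V
    by (rule connectedin_subset_openin[OF components_offD(2)[OF clL Y] V(1,3)])
      (use V(2) SL components_offD(4)[OF clL Y] in blast)
  have frB: "X closure_of B - B \<subseteq> S" if "B \<in> \<B>" for B
    unfolding S_def using that by blast
  have frU: "X closure_of U i - U i \<subseteq> S" "U i - T i \<subseteq> S" if "i \<in> I" for i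
    unfolding S_def using that by blast+
  define \<Y> where "\<Y> = {Y \<in> components_off X L. \<not> (\<exists>i\<in>I. Y \<subseteq> T i)}"
  have LY: "Lindelof_in X Y" if Y: "Y \<in> \<Y>" for Y
  proof (cases "bounded_subset X Y")
    case True
    then show ?thesis
      by (rule bounded_imp_Lindelof_in)
  next
    case False
    have Yc: "Y \<in> components_off X L" and YT: "\<And>i. i \<in> I \<Longrightarrow> \<not> Y \<subseteq> T i"
      using Y unfolding \<Y>_def by blast+
    have YX: "Y \<subseteq> topspace X"
      using components_offD(4)[OF clL Yc] by blast
    obtain d where d: "d \<in> ends X" "\<And>W. d \<in> end_nbhd X W \<Longrightarrow> \<not> bounded_subset X (Y \<inter> W)"
      by (rule ends_cluster[OF YX False]) (rule that)
    have meet: "Y \<inter> W \<noteq> {}" if "d \<in> end_nbhd X W" for W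
      using d(2)[OF that] by auto
    show ?thesis
    proof (cases "long_end X d")
      case True
      then obtain i where i: "i \<in> I" "d = e i"
        using U(5) by blast
      have "Y \<subseteq> U i"
        by (rule inside[OF Yc cf_openD(1)[OF U(1)[OF i(1)]] frU(1)[OF i(1)] meet]) (use U(3)[OF i(1)] i(2) in simp)
      then have "Y \<subseteq> T i"
        using frU(2)[OF i(1)] SL components_offD(4)[OF clL Yc] by blast
      with YT[OF i(1)] show ?thesis ..
    next
      case False
      then have "short_end X d"
        using edp d(1) unfolding end_dichotomy_def by blast
      then obtain W :: "nat \<Rightarrow> 'a set" where W: "\<And>n. cf_open X (W n)" "\<And>n. d \<in> end_nbhd X (W n)" "(\<Inter>n. W n) = {}"
        by (rule short_end_nbhds) (rule that)
      \<comment> \<open>\<open>Y\<close> is trapped in a base set \<open>B\<close> all of whose ends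
        lie in \<open>W n\<close>, so \<open>B - W n\<close> is bounded. As the sets
        \<open>W n\<close> have empty intersection, these bounded differences exhaust
        \<open>Y\<close>.\<close>
      have bd: "bounded_subset X (Y - W n)" for n
      proof -
        obtain B where B': "B \<in> \<B>" "d \<in> end_nbhd X B" "ends X \<inter> end_nbhd X B \<subseteq> end_nbhd X (W n)"
          using B(3)[OF d(1) W(2) cf_openD(1)[OF W(1)]] by blast
        have "bounded_subset X (B - W n)"
          using end_nbhd_subset_iff[OF B(2)[OF B'(1)]] B'(3) by blast
        moreover have "Y \<subseteq> B"
          by (rule inside[OF Yc cf_openD(1)[OF B(2)[OF B'(1)]] frB[OF B'(1)] meet[OF B'(2)]])
        ultimately show ?thesis
          using bounded_subset_mono[of X "B - W n" "Y - W n"] by blast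
      qed
      have "Lindelof_in X (\<Union>n. Y - W n)"
        by (rule Lindelof_in_UN[OF _ bounded_imp_Lindelof_in[OF bd]]) simp
      moreover have "(\<Union>n. Y - W n) = Y"
        using W(3) by blast
      ultimately show ?thesis by simp
    qed
  qed
  have "countable \<Y>"
    unfolding \<Y>_def using cnt by simp
  then have "Lindelof_in X (L \<union> \<Union>\<Y>)"
    by (intro Lindelof_in_Un LL Lindelof_in_Union LY)
  moreover have "topspace X - X closure_of (\<Union>i\<in>I. T i) \<subseteq> L \<union> \<Union>\<Y>"
  proof
    fix x assume x: "x \<in> topspace X - X closure_of (\<Union>i\<in>I. T i)"
    have TX: "(\<Union>i\<in>I. T i) \<subseteq> topspace X"
      using T(1) cf_openD(2)[OF U(1)] by blast
    then have xT: "x \<notin> (\<Union>i\<in>I. T i)"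
      using closure_of_subset[OF TX] x by blast
    show "x \<in> L \<union> \<Union>\<Y>"
    proof (cases "x \<in> L")
      case False
      then obtain Y where "Y \<in> components_off X L" "x \<in> Y"
        using x components_off_cover[of L] by blast
      then have "Y \<in> \<Y>"
        unfolding \<Y>_def using xT by blast
      with \<open>x \<in> Y\<close> show ?thesis by blast
    qed simp
  qed
  ultimately have "Lindelof_in X (topspace X - X closure_of (\<Union>i\<in>I. T i))"
    by (rule Lindelof_in_subset)
  moreover have "disjoint_family_on T I"
    unfolding disjoint_family_on_def
  proof (intro ballI impI)
    fix i j assume "i \<in> I" "j \<in> I" "i \<noteq> j"
    then have "U i \<inter> U j = {}" "T i \<subseteq> U i" "T j \<subseteq> U j"
      using U(6) T(1) by simp_all
    then show "T i \<inter> T j = {}" by blast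
  qed
  ultimately show ?thesis
    using T(3) unfolding Lindelof_in_def by (intro exI[of _ I] exI[of _ T]) simp
qed

end

theorem theorem1p6:
  fixes M :: "'a topology"
  assumes "manifold M" and "type_I M"
  shows "second_countable (end_space M) \<and> end_dichotomy M \<longleftrightarrow>
    (\<exists>(I :: nat set) (T :: nat \<Rightarrow> 'a set).
        (\<forall>i \<in> I. embedded_long_trunk M (T i)) \<and>
        disjoint_family_on T I \<and>
        Lindelof_space (subtopology M (topspace M - M closure_of (\<Union>i\<in>I. T i))))"
proof -
  obtain n where "manifold_of_dim n M"
    using assms(1) unfolding manifold_def by blast
  then interpret n_manifold M n
    by unfold_locales
  show ?thesis
  proof
    assume A: "second_countable (end_space M) \<and> end_dichotomy M"
    show "\<exists>(I :: nat set) T. (\<forall>i \<in> I. embedded_long_trunk M (T i)) \<and> disjoint_family_on T I \<and>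
        Lindelof_space (subtopology M (topspace M - M closure_of (\<Union>i\<in>I. T i)))"
    \<comment> \<open>The empty space passes as a manifold; there the empty family of trunks will
      do, while the general argument starts from a point \<open>x0\<close>.\<close>
    proof (cases "topspace M = {}")
      case True
      then have "Lindelof_space (subtopology M (topspace M - M closure_of (\<Union>i\<in>{}. T i)))" for T :: "nat \<Rightarrow> 'a set"
        by (intro Lindelof_space_topspace_empty) simp
      then show ?thesis
        by (intro exI[of _ "{}"] exI[of _ "\<lambda>i. {}"]) (simp add: disjoint_family_on_def)
    next
      case False
      then obtain x0 where "x0 \<in> topspace M" by blast
      with A show ?thesis
        by (intro second_countable_ends_imp_trunks[OF assms(2)]) simp_all
    qed
  next
    assume "\<exists>(I :: nat set) T. (\<forall>i \<in> I. embedded_long_trunk M (T i)) \<and> disjoint_family_on T I \<and>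
        Lindelof_space (subtopology M (topspace M - M closure_of (\<Union>i\<in>I. T i)))"
    then obtain I :: "nat set" and T where "\<And>i. i \<in> I \<Longrightarrow> embedded_long_trunk M (T i)"
      "Lindelof_space (subtopology M (topspace M - M closure_of (\<Union>i\<in>I. T i)))"
      by blast
    then show "second_countable (end_space M) \<and> end_dichotomy M"
      by (intro trunks_imp_second_countable_ends[OF assms(2), of I T]) simp_all
  qed
qed

end
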